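(* The filter and compact-element functors $\mathcal F,\mathcal K$ and the functors $\mathcal V^a,\mathcal Y$, $\mathcal A=\mathcal K\circ\mathcal V^a$, $\mathcal X=\mathcal Y\circ\mathcal F$ (in the versions for bounded semilattices, compact frames and generalized Priestley spaces given in the context) yield: (1) $\mathsf{KAlgFrm_{Sup}}$ is equivalent to $\mathsf{BDMS}$ and dually equivalent to $\mathsf{GPS}$ (so $\mathsf{BDMS}$ is dually equivalent to $\mathsf{GPS}$). (2) $\mathsf{KAlgFrm_{SupB}}$ is equivalent to $\mathsf{BDMS_B}$ and dually equivalent to $\mathsf{GPS_T}$ (so $\mathsf{BDMS_B}$ is dually equivalent to $\mathsf{GPS_T}$).
   Context: Semilattices. A meet-semilattice is a poset with all finite meets, including the empty one (top $1$). It is distributive if $a\wedge b\le c$ implies there are $a'\ge a$, $b'\ge b$ with $a'\wedge b'=c$; bounded if it has a bottom $0$. $\mathsf{BDMS}$: bounded distributive meet-semilattices with maps preserving all finite meets (including $1$, but not necessarily $0$). $\mathsf{BDMS_B}$: same objects, those morphisms with $\alpha(0)=0$. Frames. $\mathsf K(L)$ is the set of compact elements of a complete lattice $L$. An algebraic frame is a frame in which every element is a join of compact elements; it is compact if $1\in\mathsf K(L)$. $\mathsf{KAlgFrm_{Sup}}$: compact algebraic frames with maps preserving arbitrary joins and compact elements. $\mathsf{KAlgFrm_{SupB}}$: same objects, those morphisms with $\alpha(1)=1$. Spaces. A Priestley space is a compact space with a partial order such that $x\not\le y$ implies there is a clopen upset containing $x$ and missing $y$. Given a subset $X_0$, a clopen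 upset $U$ is admissible if the maximal points of $X\setminus U$ lie in $X_0$; $\mathcal A(X)$ is the set of admissible clopen upsets and $\mathcal I_x=\{U\in\mathcal A(X)\mid x\notin U\}$. A generalized Priestley space is a tuple $(X,\tau,\le,X_0)$ such that: $(X,\tau,\le)$ is a Priestley space; $X_0$ is dense in $X$; for each $x\in X$ there is $y\in X_0$ with $x\le y$; $x\in X_0$ iff $\mathcal I_x$ is directed under inclusion; $x\le y$ iff for all $U\in\mathcal A(X)$, $x\in U$ implies $y\in U$. For $R\subseteq X\times Y$ write $R[x]=\{y\mid x\mathrel Ry\}$, $\Box_RU=\{x\mid R[x]\subseteq U\}$. A generalized Priestley morphism $R\subseteq X\times Y$ satisfies: (i) if $x\not\mathrel Ry$ there is $U\in\mathcal A(Y)$ with $R[x]\subseteq U$, $y\notin U$; (ii) $U\in\mathcal A(Y)$ implies $\Box_RU\in\mathcal A(X)$. It is total if $R[x]\neq\varnothing$ for all $x\in X$. $\mathsf{GPS}$: generalized Priestley spaces and generalized Priestley morphisms; identities are $\le$ and $x\mathrel{(S*R)}z$ iff for all $U\in\mathcal A(Z)$, $x\in\Box_R\Box_SU$ implies $z\in U$. $\mathsf{GPS_T}$: same objects, total morphisms. Functors. $\mathcal F(M)$ is the set of all filters of $M$ ordered by inclusion, $\mathcal F(\alpha)(G)={\uparrow}\alpha[G]$. $\mathcal K(L)$ is $\mathsf K(L)$ with the dual order, $\mathcal K(\alpha)$ the restriction of $\alpha$. $\mathcal V^a(X)$ is the set of closed upsets $C$ of $X$ with $X\setminus C={\downarrow}(X_0\setminus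 C)$, ordered by $\supseteq$; $\mathcal V^a(R)=\Box_R\colon\mathcal V^a(Y)\to\mathcal V^a(X)$ for $R\subseteq X\times Y$. For $\mathcal Y$: $a\ll b$ means $b\le\bigvee S$ implies $a\le\bigvee T$ for some finite $T\subseteq S$; $p\ne1$ is prime if $a\wedge b\le p$ implies $a\le p$ or $b\le p$, and pseudoprime if for all $n\ge1$, $a_1\wedge\dots\wedge a_n\ll p$ implies some $a_i\le p$; $\mathsf P(L)$, $\mathsf{PP}(L)$ are the sets of primes and pseudoprimes. $\mathcal Y(L)=(\mathsf{PP}(L),\lambda,\le,\mathsf P(L))$, where $\lambda$ is the restriction of the topology on $L$ with subbasis $\{{\uparrow}k\mid k\in\mathsf K(L)\}\cup\{L\setminus{\uparrow}l\mid l\in\mathsf K(L)\}$; for $\alpha\colon L_1\to L_2$ with right adjoint $r$, $\mathcal Y(\alpha)\subseteq\mathsf{PP}(L_2)\times\mathsf{PP}(L_1)$ relates $p$ to $q$ iff $r(p)\le q$. *)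

theory Defs
  imports "HOL-Algebra.Galois_Connection" "HOL-Analysis.Abstract_Topology"
begin

section \<open>Categories, functors, natural isomorphisms\<close>

text \<open>Hom-sets need not be disjoint, so composition and the action of a functor on a morphism
  take the objects involved as arguments. In \<open>cmp C A B D g f\<close> we have
  \<open>f : A \<rightarrow> B\<close> and \<open>g : B \<rightarrow> D\<close>.\<close>

record ('o, 'm) cat =
  obj :: "'o set"
  hom :: "'o \<Rightarrow> 'o \<Rightarrow> 'm set"
  ide :: "'o \<Rightarrow> 'm"
  cmp :: "'o \<Rightarrow> 'o \<Rightarrow> 'o \<Rightarrow> 'm \<Rightarrow> 'm \<Rightarrow> 'm"

definition category :: "('o, 'm) cat \<Rightarrow> bool" where
  "category C \<longleftrightarrow>
     (\<forall>A\<in>obj C. ide C A \<in> hom C A A) \<and>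
     (\<forall>A\<in>obj C. \<forall>B\<in>obj C. \<forall>D\<in>obj C. \<forall>f\<in>hom C A B. \<forall>g\<in>hom C B D.
        cmp C A B D g f \<in> hom C A D) \<and>
     (\<forall>A\<in>obj C. \<forall>B\<in>obj C. \<forall>f\<in>hom C A B.
        cmp C A A B f (ide C A) = f \<and> cmp C A B B (ide C B) f = f) \<and>
     (\<forall>A\<in>obj C. \<forall>B\<in>obj C. \<forall>D\<in>obj C. \<forall>E\<in>obj C.
        \<forall>f\<in>hom C A B. \<forall>g\<in>hom C B D. \<forall>h\<in>hom C D E.
        cmp C A D E h (cmp C A B D g f) = cmp C A B E (cmp C B D E h g) f)"

definition op_cat :: "('o, 'm) cat \<Rightarrow> ('o, 'm) cat" where
  "op_cat C = \<lparr>obj = obj C, hom = (\<lambda>A B. hom C B A), ide = ide C,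
                cmp = (\<lambda>A B D g f. cmp C D B A f g)\<rparr>"

definition iso_in :: "('o, 'm) cat \<Rightarrow> 'o \<Rightarrow> 'o \<Rightarrow> 'm \<Rightarrow> bool" where
  "iso_in C A B f \<longleftrightarrow> f \<in> hom C A B \<and>
     (\<exists>g\<in>hom C B A. cmp C A B A g f = ide C A \<and> cmp C B A B f g = ide C B)"

record ('o, 'm, 'p, 'n) functor_data =
  on_ob :: "'o \<Rightarrow> 'p"
  on_hom :: "'o \<Rightarrow> 'o \<Rightarrow> 'm \<Rightarrow> 'n"

definition is_functor ::
  "('o, 'm) cat \<Rightarrow> ('p, 'n) cat \<Rightarrow> ('o, 'm, 'p, 'n) functor_data \<Rightarrow> bool" where
  "is_functor C D F \<longleftrightarrow> category C \<and> category D \<and>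
     (\<forall>A\<in>obj C. on_ob F A \<in> obj D) \<and>
     (\<forall>A\<in>obj C. \<forall>B\<in>obj C. \<forall>f\<in>hom C A B. on_hom F A B f \<in> hom D (on_ob F A) (on_ob F B)) \<and>
     (\<forall>A\<in>obj C. on_hom F A A (ide C A) = ide D (on_ob F A)) \<and>
     (\<forall>A\<in>obj C. \<forall>B\<in>obj C. \<forall>E\<in>obj C. \<forall>f\<in>hom C A B. \<forall>g\<in>hom C B E.
        on_hom F A E (cmp C A B E g f) =
        cmp D (on_ob F A) (on_ob F B) (on_ob F E) (on_hom F B E g) (on_hom F A B f))"

definition fully_faithful ::
  "('o, 'm) cat \<Rightarrow> ('p, 'n) cat \<Rightarrow> ('o, 'm, 'p, 'n) functor_data \<Rightarrow> bool" where
  "fully_faithful C D F \<longleftrightarrow> is_functor C D F \<and>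
     (\<forall>A\<in>obj C. \<forall>B\<in>obj C.
        bij_betw (on_hom F A B) (hom C A B) (hom D (on_ob F A) (on_ob F B)))"

definition comp_functor ::
  "('p, 'n, 'q, 'k) functor_data \<Rightarrow> ('o, 'm, 'p, 'n) functor_data \<Rightarrow> ('o, 'm, 'q, 'k) functor_data"
  (infixr \<open>\<circ>\<^sub>F\<close> 55) where
  "G \<circ>\<^sub>F F = \<lparr>on_ob = (\<lambda>A. on_ob G (on_ob F A)),
              on_hom = (\<lambda>A B f. on_hom G (on_ob F A) (on_ob F B) (on_hom F A B f))\<rparr>"

definition naturally_isomorphic ::
  "('o, 'm) cat \<Rightarrow> ('p, 'n) cat \<Rightarrow> ('o, 'm, 'p, 'n) functor_data \<Rightarrow> ('o, 'm, 'p, 'n) functor_data \<Rightarrow> bool"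
  where
  "naturally_isomorphic C D F G \<longleftrightarrow> is_functor C D F \<and> is_functor C D G \<and>
     (\<exists>\<eta>. (\<forall>A\<in>obj C. iso_in D (on_ob F A) (on_ob G A) (\<eta> A)) \<and>
          (\<forall>A\<in>obj C. \<forall>B\<in>obj C. \<forall>f\<in>hom C A B.
             cmp D (on_ob F A) (on_ob F B) (on_ob G B) (\<eta> B) (on_hom F A B f) =
             cmp D (on_ob F A) (on_ob G A) (on_ob G B) (on_hom G A B f) (\<eta> A)))"

text \<open>A category of structures here consists of all structures whose points are taken from a
  given type, and it is polymorphic in that type. Functors such as \<open>M \<mapsto> \<F>(M)\<close> take structures
  over \<open>'u\<close> to structures over \<open>'u set\<close>, so a composite that the mathematics compares with the
  identity of \<open>C\<close> here goes from \<open>C\<close> over \<open>'u\<close> to \<open>C'\<close>, the same category over a larger type. It is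
  compared with the change-of-universe functor \<open>J : C \<rightarrow> C'\<close>, which renames points along an
  injection (\<open>order_lift\<close>, \<open>gps_lift\<close> below). An equivalence with quasi-inverse functors \<open>F\<close> and
  \<open>G\<close> amounts to \<open>quasi_inverse_up_to_lift\<close> for \<open>(F, G)\<close> and for \<open>(G, F)\<close>, over every type.\<close>

definition quasi_inverse_up_to_lift ::
  "('o, 'm) cat \<Rightarrow> ('p, 'n) cat \<Rightarrow> ('q, 'k) cat \<Rightarrow> ('o, 'm, 'q, 'k) functor_data \<Rightarrow>
   ('o, 'm, 'p, 'n) functor_data \<Rightarrow> ('p, 'n, 'q, 'k) functor_data \<Rightarrow> bool" where
  "quasi_inverse_up_to_lift C D C' J F G \<longleftrightarrow>
     fully_faithful C C' J \<and> fully_faithful C D F \<and> fully_faithful D C' G \<and>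
     naturally_isomorphic C C' (G \<circ>\<^sub>F F) J"


section \<open>Semilattices\<close>

definition bounded_distributive_meet_semilattice :: "'a gorder \<Rightarrow> bool" where
  "bounded_distributive_meet_semilattice M \<longleftrightarrow>
     lower_semilattice M \<and>
     (\<exists>t. greatest M t (carrier M)) \<and>
     (\<exists>z. least M z (carrier M)) \<and>
     (\<forall>a\<in>carrier M. \<forall>b\<in>carrier M. \<forall>c\<in>carrier M. a \<sqinter>\<^bsub>M\<^esub> b \<sqsubseteq>\<^bsub>M\<^esub> c \<longrightarrow>
        (\<exists>a'\<in>carrier M. \<exists>b'\<in>carrier M. a \<sqsubseteq>\<^bsub>M\<^esub> a' \<and> b \<sqsubseteq>\<^bsub>M\<^esub> b' \<and> a' \<sqinter>\<^bsub>M\<^esub> b' = c))"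

definition bdms :: "('a gorder, 'a \<Rightarrow> 'a) cat" where
  "bdms = \<lparr>obj = {M. bounded_distributive_meet_semilattice M},
    hom = (\<lambda>M N. {\<alpha> \<in> carrier M \<rightarrow>\<^sub>E carrier N.
       (\<forall>a\<in>carrier M. \<forall>b\<in>carrier M. \<alpha> (a \<sqinter>\<^bsub>M\<^esub> b) = \<alpha> a \<sqinter>\<^bsub>N\<^esub> \<alpha> b) \<and> \<alpha> \<top>\<^bsub>M\<^esub> = \<top>\<^bsub>N\<^esub>}),
    ide = (\<lambda>M. \<lambda>x\<in>carrier M. x),
    cmp = (\<lambda>M N P \<beta> \<alpha>. compose (carrier M) \<beta> \<alpha>)\<rparr>"

definition bdms_B :: "('a gorder, 'a \<Rightarrow> 'a) cat" where
  "bdms_B = bdms\<lparr>hom := (\<lambda>M N. {\<alpha> \<in> hom bdms M N. \<alpha> \<bottom>\<^bsub>M\<^esub> = \<bottom>\<^bsub>N\<^esub>})\<rparr>"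


section \<open>Compact algebraic frames\<close>

definition way_below :: "'a gorder \<Rightarrow> 'a \<Rightarrow> 'a \<Rightarrow> bool" where
  "way_below L a b \<longleftrightarrow>
     (\<forall>S. S \<subseteq> carrier L \<and> b \<sqsubseteq>\<^bsub>L\<^esub> \<Squnion>\<^bsub>L\<^esub>S \<longrightarrow> (\<exists>T. finite T \<and> T \<subseteq> S \<and> a \<sqsubseteq>\<^bsub>L\<^esub> \<Squnion>\<^bsub>L\<^esub>T))"

definition compact_elements :: "'a gorder \<Rightarrow> 'a set" where
  "compact_elements L = {k \<in> carrier L. way_below L k k}"

definition compact_algebraic_frame :: "'a gorder \<Rightarrow> bool" where
  "compact_algebraic_frame L \<longleftrightarrow>
     complete_lattice L \<and>
     (\<forall>a\<in>carrier L. \<forall>S. S \<subseteq> carrier L \<longrightarrow> a \<sqinter>\<^bsub>L\<^esub> \<Squnion>\<^bsub>L\<^esub>S = \<Squnion>\<^bsub>L\<^esub>((\<lambda>s. a \<sqinter>\<^bsub>L\<^esub> s) ` S)) \<and>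
     (\<forall>a\<in>carrier L. \<exists>S. S \<subseteq> compact_elements L \<and> a = \<Squnion>\<^bsub>L\<^esub>S) \<and>
     \<top>\<^bsub>L\<^esub> \<in> compact_elements L"

definition kalgfrm_sup :: "('a gorder, 'a \<Rightarrow> 'a) cat" where
  "kalgfrm_sup = \<lparr>obj = {L. compact_algebraic_frame L},
    hom = (\<lambda>L\<^sub>1 L\<^sub>2. {\<alpha> \<in> carrier L\<^sub>1 \<rightarrow>\<^sub>E carrier L\<^sub>2.
       (\<forall>S. S \<subseteq> carrier L\<^sub>1 \<longrightarrow> \<alpha> (\<Squnion>\<^bsub>L\<^sub>1\<^esub>S) = \<Squnion>\<^bsub>L\<^sub>2\<^esub>(\<alpha> ` S)) \<and>
       \<alpha> ` compact_elements L\<^sub>1 \<subseteq> compact_elements L\<^sub>2}),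
    ide = (\<lambda>L. \<lambda>x\<in>carrier L. x),
    cmp = (\<lambda>L\<^sub>1 L\<^sub>2 L\<^sub>3 \<beta> \<alpha>. compose (carrier L\<^sub>1) \<beta> \<alpha>)\<rparr>"

definition kalgfrm_supB :: "('a gorder, 'a \<Rightarrow> 'a) cat" where
  "kalgfrm_supB = kalgfrm_sup\<lparr>hom := (\<lambda>L\<^sub>1 L\<^sub>2. {\<alpha> \<in> hom kalgfrm_sup L\<^sub>1 L\<^sub>2. \<alpha> \<top>\<^bsub>L\<^sub>1\<^esub> = \<top>\<^bsub>L\<^sub>2\<^esub>})\<rparr>"

definition prime_elements :: "'a gorder \<Rightarrow> 'a set" where
  "prime_elements L = {p \<in> carrier L. p \<noteq> \<top>\<^bsub>L\<^esub> \<and>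
     (\<forall>a\<in>carrier L. \<forall>b\<in>carrier L. a \<sqinter>\<^bsub>L\<^esub> b \<sqsubseteq>\<^bsub>L\<^esub> p \<longrightarrow> a \<sqsubseteq>\<^bsub>L\<^esub> p \<or> b \<sqsubseteq>\<^bsub>L\<^esub> p)}"

definition pseudoprime_elements :: "'a gorder \<Rightarrow> 'a set" where
  "pseudoprime_elements L = {p \<in> carrier L. p \<noteq> \<top>\<^bsub>L\<^esub> \<and>
     (\<forall>A. finite A \<and> A \<noteq> {} \<and> A \<subseteq> carrier L \<and> way_below L (\<Sqinter>\<^bsub>L\<^esub>A) p \<longrightarrow> (\<exists>a\<in>A. a \<sqsubseteq>\<^bsub>L\<^esub> p))}"

definition right_adjoint :: "'a gorder \<Rightarrow> 'b gorder \<Rightarrow> ('a \<Rightarrow> 'b) \<Rightarrow> 'b \<Rightarrow> 'a" where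
  "right_adjoint L\<^sub>1 L\<^sub>2 \<alpha> = (THE r. r \<in> extensional (carrier L\<^sub>2) \<and>
     galois_connection \<lparr>orderA = L\<^sub>1, orderB = L\<^sub>2, lower = \<alpha>, upper = r\<rparr>)"


section \<open>Generalized Priestley spaces\<close>

text \<open>The underlying set of a space is the \<open>topspace\<close> of its topology.\<close>

record 'a gps =
  gps_top :: "'a topology"
  gps_ord :: "'a rel"
  gps_core :: "'a set"

abbreviation points :: "'a gps \<Rightarrow> 'a set" where
  "points X \<equiv> topspace (gps_top X)"

definition upset :: "'a gps \<Rightarrow> 'a set \<Rightarrow> bool" where
  "upset X U \<longleftrightarrow> U \<subseteq> points X \<and> (\<forall>x y. x \<in> U \<and> (x, y) \<in> gps_ord X \<longrightarrow> y \<in> U)"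

definition clopen_upset :: "'a gps \<Rightarrow> 'a set \<Rightarrow> bool" where
  "clopen_upset X U \<longleftrightarrow> openin (gps_top X) U \<and> closedin (gps_top X) U \<and> upset X U"

definition maximal_points :: "'a gps \<Rightarrow> 'a set \<Rightarrow> 'a set" where
  "maximal_points X S = {x \<in> S. \<forall>y\<in>S. (x, y) \<in> gps_ord X \<longrightarrow> y = x}"

definition admissible :: "'a gps \<Rightarrow> 'a set set" where
  "admissible X = {U. clopen_upset X U \<and> maximal_points X (points X - U) \<subseteq> gps_core X}"

definition admissible_missing :: "'a gps \<Rightarrow> 'a \<Rightarrow> 'a set set" where
  "admissible_missing X x = {U \<in> admissible X. x \<notin> U}"

definition directed_by_inclusion :: "'a set set \<Rightarrow> bool" where
  "directed_by_inclusion \<U> \<longleftrightarrow> \<U> \<noteq> {} \<and> (\<forall>U\<in>\<U>. \<forall>V\<in>\<U>. \<exists>W\<in>\<U>. U \<subseteq> W \<and> V \<subseteq> W)"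

definition priestley_space :: "'a gps \<Rightarrow> bool" where
  "priestley_space X \<longleftrightarrow>
     compact_space (gps_top X) \<and> partial_order_on (points X) (gps_ord X) \<and>
     (\<forall>x\<in>points X. \<forall>y\<in>points X. (x, y) \<notin> gps_ord X \<longrightarrow> (\<exists>U. clopen_upset X U \<and> x \<in> U \<and> y \<notin> U))"

definition generalized_priestley_space :: "'a gps \<Rightarrow> bool" where
  "generalized_priestley_space X \<longleftrightarrow>
     priestley_space X \<and>
     gps_core X \<subseteq> points X \<and> gps_top X closure_of gps_core X = points X \<and>
     (\<forall>x\<in>points X. \<exists>y\<in>gps_core X. (x, y) \<in> gps_ord X) \<and>
     (\<forall>x\<in>points X. x \<in> gps_core X \<longleftrightarrow> directed_by_inclusion (admissible_missing X x)) \<and>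
     (\<forall>x\<in>points X. \<forall>y\<in>points X.
        (x, y) \<in> gps_ord X \<longleftrightarrow> (\<forall>U\<in>admissible X. x \<in> U \<longrightarrow> y \<in> U))"

definition rel_box :: "'a gps \<Rightarrow> ('a \<times> 'b) set \<Rightarrow> 'b set \<Rightarrow> 'a set" where
  "rel_box X R U = {x \<in> points X. R `` {x} \<subseteq> U}"

definition gps :: "('a gps, 'a rel) cat" where
  "gps = \<lparr>obj = {X. generalized_priestley_space X},
    hom = (\<lambda>X Y. {R. R \<subseteq> points X \<times> points Y \<and>
       (\<forall>x\<in>points X. \<forall>y\<in>points Y. (x, y) \<notin> R \<longrightarrow> (\<exists>U\<in>admissible Y. R `` {x} \<subseteq> U \<and> y \<notin> U)) \<and>
       (\<forall>U\<in>admissible Y. rel_box X R U \<in> admissible X)}),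
    ide = gps_ord,
    cmp = (\<lambda>X Y Z S R. {(x, z). x \<in> points X \<and> z \<in> points Z \<and>
       (\<forall>U\<in>admissible Z. x \<in> rel_box X R (rel_box Y S U) \<longrightarrow> z \<in> U)})\<rparr>"

definition gps_T :: "('a gps, 'a rel) cat" where
  "gps_T = gps\<lparr>hom := (\<lambda>X Y. {R \<in> hom gps X Y. \<forall>x\<in>points X. R `` {x} \<noteq> {}})\<rparr>"


section \<open>The functors\<close>

definition mfilters :: "'a gorder \<Rightarrow> 'a set set" where
  "mfilters M = {G. G \<subseteq> carrier M \<and> G \<noteq> {} \<and>
     (\<forall>a\<in>G. \<forall>b\<in>carrier M. a \<sqsubseteq>\<^bsub>M\<^esub> b \<longrightarrow> b \<in> G) \<and> (\<forall>a\<in>G. \<forall>b\<in>G. a \<sqinter>\<^bsub>M\<^esub> b \<in> G)}"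

definition filter_frame :: "'a gorder \<Rightarrow> 'a set gorder" where
  "filter_frame M = \<lparr>carrier = mfilters M, eq = (=), le = (\<subseteq>)\<rparr>"

definition functor_F :: "('a gorder, 'a \<Rightarrow> 'a, 'a set gorder, 'a set \<Rightarrow> 'a set) functor_data" where
  "functor_F = \<lparr>on_ob = filter_frame,
     on_hom = (\<lambda>M N \<alpha>. \<lambda>G\<in>mfilters M. {b \<in> carrier N. \<exists>a\<in>G. \<alpha> a \<sqsubseteq>\<^bsub>N\<^esub> b})\<rparr>"

definition functor_K :: "('a gorder, 'a \<Rightarrow> 'a, 'a gorder, 'a \<Rightarrow> 'a) functor_data" where
  "functor_K = \<lparr>on_ob = (\<lambda>L. inv_gorder (L\<lparr>carrier := compact_elements L\<rparr>)),
     on_hom = (\<lambda>L\<^sub>1 L\<^sub>2 \<alpha>. restrict \<alpha> (compact_elements L\<^sub>1))\<rparr>"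

definition va_elements :: "'a gps \<Rightarrow> 'a set set" where
  "va_elements X = {C. closedin (gps_top X) C \<and> upset X C \<and>
     points X - C = {x \<in> points X. \<exists>y \<in> gps_core X - C. (x, y) \<in> gps_ord X}}"

text \<open>A contravariant functor on \<open>gps\<close> is a functor on \<open>op_cat gps\<close>: below, a morphism \<open>X \<rightarrow> Y\<close> of
  \<open>op_cat gps\<close> is a relation \<open>R\<close> from \<open>Y\<close> to \<open>X\<close>.\<close>

definition functor_V :: "('a gps, 'a rel, 'a set gorder, 'a set \<Rightarrow> 'a set) functor_data" where
  "functor_V = \<lparr>on_ob = (\<lambda>X. \<lparr>carrier = va_elements X, eq = (=), le = (\<lambda>C D. D \<subseteq> C)\<rparr>),
     on_hom = (\<lambda>X Y R. \<lambda>C\<in>va_elements X. rel_box Y R C)\<rparr>"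

definition up_set :: "'a gorder \<Rightarrow> 'a \<Rightarrow> 'a set" where
  "up_set L a = {b \<in> carrier L. a \<sqsubseteq>\<^bsub>L\<^esub> b}"

definition pseudoprime_space :: "'a gorder \<Rightarrow> 'a gps" where
  "pseudoprime_space L = \<lparr>
     gps_top = subtopology
       (topology_generated_by
          (up_set L ` compact_elements L \<union> (\<lambda>l. carrier L - up_set L l) ` compact_elements L))
       (pseudoprime_elements L),
     gps_ord = {(p, q). p \<in> pseudoprime_elements L \<and> q \<in> pseudoprime_elements L \<and> p \<sqsubseteq>\<^bsub>L\<^esub> q},
     gps_core = prime_elements L\<rparr>"

definition functor_Y :: "('a gorder, 'a \<Rightarrow> 'a, 'a gps, 'a rel) functor_data" where
  "functor_Y = \<lparr>on_ob = pseudoprime_space,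
     on_hom = (\<lambda>L\<^sub>1 L\<^sub>2 \<alpha>. {(p, q). p \<in> pseudoprime_elements L\<^sub>2 \<and> q \<in> pseudoprime_elements L\<^sub>1 \<and>
                              right_adjoint L\<^sub>1 L\<^sub>2 \<alpha> p \<sqsubseteq>\<^bsub>L\<^sub>1\<^esub> q})\<rparr>"

definition functor_A :: "('a gps, 'a rel, 'a set gorder, 'a set \<Rightarrow> 'a set) functor_data" where
  "functor_A = functor_K \<circ>\<^sub>F functor_V"

definition functor_X :: "('a gorder, 'a \<Rightarrow> 'a, 'a set gps, 'a set rel) functor_data" where
  "functor_X = functor_Y \<circ>\<^sub>F functor_F"


section \<open>Change of universe\<close>

text \<open>The parameter \<open>j\<close> is meant to be injective; \<open>x \<mapsto> {x}\<close> and \<open>x \<mapsto> {{x}}\<close> are used. The same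
  \<open>gps_lift\<close> serves \<open>gps\<close> and \<open>op_cat gps\<close>.\<close>

definition order_lift :: "('a \<Rightarrow> 'b) \<Rightarrow> ('a gorder, 'a \<Rightarrow> 'a, 'b gorder, 'b \<Rightarrow> 'b) functor_data" where
  "order_lift j = \<lparr>
     on_ob = (\<lambda>L. \<lparr>carrier = j ` carrier L, eq = (=), le = (\<lambda>x y. inv j x \<sqsubseteq>\<^bsub>L\<^esub> inv j y)\<rparr>),
     on_hom = (\<lambda>L\<^sub>1 L\<^sub>2 \<alpha>. \<lambda>x\<in>j ` carrier L\<^sub>1. j (\<alpha> (inv j x)))\<rparr>"

definition gps_lift :: "('a \<Rightarrow> 'b) \<Rightarrow> ('a gps, 'a rel, 'b gps, 'b rel) functor_data" where
  "gps_lift j = \<lparr>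
     on_ob = (\<lambda>X. \<lparr>gps_top = pullback_topology (j ` points X) (inv j) (gps_top X),
                    gps_ord = map_prod j j ` gps_ord X, gps_core = j ` gps_core X\<rparr>),
     on_hom = (\<lambda>X Y R. map_prod j j ` R)\<rparr>"

end

theory Submission
  imports Defs "HOL-Analysis.Function_Topology"
begin

text \<open>Each equivalence reduces to natural isomorphisms. If \<open>F\<close> and \<open>G\<close> are functors in every universe
  and both composites are naturally isomorphic to lifting functors, which are fully faithful, then
  \<open>F\<close> and \<open>G\<close> are fully faithful (\<open>quasi_inverse_up_to_lift_if_naturally_isomorphic\<close>). A natural
  isomorphism into a lifting functor is a natural family of order isomorphisms, or of bijections that
  match admissible sets, between structures over different types. Part (2) then follows from
  part (1): the morphisms singled out there form wide subcategories that contain all isomorphisms,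
  and each functor preserves and reflects membership (\<open>quasi_inverse_up_to_lift_wide_subcategory\<close>).

  Semilattices and frames. The compact elements of \<open>\<F>(M)\<close> are the principal filters, so
  \<open>a \<mapsto> \<up>a\<close> identifies \<open>M\<close> with \<open>\<K>(\<F>(M))\<close>; distributivity of \<open>M\<close> is the frame law of \<open>\<F>(M)\<close>
  (\<open>filter_frame_distrib\<close>) and conversely (\<open>compact_split\<close>). An element of an algebraic frame \<open>L\<close> is
  determined by the ideal of compact elements below it, which is a filter of \<open>\<K>(L)\<close>.

  Frames and spaces. In \<open>\<Y>(L)\<close> the admissible clopen upsets are exactly the traces \<open>pp_hull k\<close> of \<open>\<up>k\<close>
  for compact \<open>k\<close> (\<open>admissible_pp\<close>). This rests on two separation principles: primes separate the
  elements of \<open>L\<close> (\<open>exists_prime_above\<close>), and joins of prime ideals provide enough pseudoprimes for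
  the space to be compact (\<open>exists_pseudoprime\<close>). In a generalized Priestley space \<open>X\<close>, directedness
  at the core points makes the elements of \<open>\<V>\<^sup>a(X)\<close> the intersections of admissible sets
  (\<open>va_separation\<close>), with the admissible sets as compact elements (\<open>compact_va\<close>), and turns meets into
  unions on the core, whence the frame law. Hence \<open>a \<mapsto> pp_hull a\<close> identifies \<open>L\<close> with
  \<open>\<V>\<^sup>a(\<Y>(L))\<close>. The pseudoprimes of \<open>\<V>\<^sup>a(X)\<close> are the principal upsets of points, so \<open>x \<mapsto> \<up>x\<close> identifies
  \<open>X\<close> with \<open>\<Y>(\<V>\<^sup>a(X))\<close> (\<open>gps_iso_principal_upset\<close>).

  Morphisms of spaces are determined by their box operators on admissible sets, and these compose as
  functions (\<open>gps_hom_eqI\<close>, \<open>rel_box_cmp\<close>). The box operator of \<open>\<Y>(\<alpha>)\<close> takes \<open>pp_hull a\<close> to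
  \<open>pp_hull (\<alpha> a)\<close> (\<open>rel_box_functor_Y\<close>), so all identities between relations become identities between
  join-preserving maps. The dualities between semilattices and spaces compose the isomorphisms just
  named.\<close>

section \<open>Equivalences up to a change of universe\<close>

lemma
  assumes "category C"
  shows category_ide: "A \<in> obj C \<Longrightarrow> ide C A \<in> hom C A A"
    and category_cmp: "\<lbrakk>A \<in> obj C; B \<in> obj C; D \<in> obj C; f \<in> hom C A B; g \<in> hom C B D\<rbrakk>
      \<Longrightarrow> cmp C A B D g f \<in> hom C A D"
    and category_unit: "\<lbrakk>A \<in> obj C; B \<in> obj C; f \<in> hom C A B\<rbrakk> \<Longrightarrow> cmp C A A B f (ide C A) = f"
      "\<lbrakk>A \<in> obj C; B \<in> obj C; f \<in> hom C A B\<rbrakk> \<Longrightarrow> cmp C A B B (ide C B) f = f"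
    and category_assoc: "\<lbrakk>A \<in> obj C; B \<in> obj C; D \<in> obj C; E \<in> obj C;
        f \<in> hom C A B; g \<in> hom C B D; h \<in> hom C D E\<rbrakk>
      \<Longrightarrow> cmp C A D E h (cmp C A B D g f) = cmp C A B E (cmp C B D E h g) f"
  using assms unfolding category_def by blast+

lemma
  assumes "is_functor C D F"
  shows functor_cod: "category D"
    and functor_ob: "A \<in> obj C \<Longrightarrow> on_ob F A \<in> obj D"
    and functor_hom: "\<lbrakk>A \<in> obj C; B \<in> obj C; f \<in> hom C A B\<rbrakk>
      \<Longrightarrow> on_hom F A B f \<in> hom D (on_ob F A) (on_ob F B)"
  using assms unfolding is_functor_def by blast+

lemma comp_functor_simps [simp]:
  "on_ob (G \<circ>\<^sub>F F) A = on_ob G (on_ob F A)"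
  "on_hom (G \<circ>\<^sub>F F) A B f = on_hom G (on_ob F A) (on_ob F B) (on_hom F A B f)"
  by (simp_all add: comp_functor_def)

lemma iso_inI:
  "\<lbrakk>f \<in> hom C A B; g \<in> hom C B A; cmp C A B A g f = ide C A; cmp C B A B f g = ide C B\<rbrakk>
    \<Longrightarrow> iso_in C A B f"
  unfolding iso_in_def by blast

lemma is_functor_comp: "is_functor C D F \<Longrightarrow> is_functor D E G \<Longrightarrow> is_functor C E (G \<circ>\<^sub>F F)"
  unfolding is_functor_def by simp

lemma op_cat_simps [simp]:
  "obj (op_cat C) = obj C" "hom (op_cat C) A B = hom C B A" "ide (op_cat C) = ide C"
  "cmp (op_cat C) A B D g f = cmp C D B A f g"
  by (simp_all add: op_cat_def)

lemma category_op_cat: "category C \<Longrightarrow> category (op_cat C)"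
  unfolding category_def op_cat_simps by (auto 0 0)

text \<open>With the inverses named, each of the two functors becomes a conjugate of the other; this is the
  form in which a natural isomorphism is used below.\<close>

definition inverse_natural_families where
  "inverse_natural_families C D F G \<eta> \<theta> \<longleftrightarrow>
     is_functor C D F \<and> is_functor C D G \<and>
     (\<forall>A\<in>obj C. \<eta> A \<in> hom D (on_ob F A) (on_ob G A) \<and> \<theta> A \<in> hom D (on_ob G A) (on_ob F A) \<and>
        cmp D (on_ob F A) (on_ob G A) (on_ob F A) (\<theta> A) (\<eta> A) = ide D (on_ob F A) \<and>
        cmp D (on_ob G A) (on_ob F A) (on_ob G A) (\<eta> A) (\<theta> A) = ide D (on_ob G A)) \<and>
     (\<forall>A\<in>obj C. \<forall>B\<in>obj C. \<forall>f\<in>hom C A B.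
        cmp D (on_ob F A) (on_ob F B) (on_ob G B) (\<eta> B) (on_hom F A B f) =
        cmp D (on_ob F A) (on_ob G A) (on_ob G B) (on_hom G A B f) (\<eta> A))"

lemma naturally_isomorphic_iff:
  "naturally_isomorphic C D F G \<longleftrightarrow> (\<exists>\<eta> \<theta>. inverse_natural_families C D F G \<eta> \<theta>)"
proof
  assume "naturally_isomorphic C D F G"
  then obtain \<eta> where fn: "is_functor C D F" "is_functor C D G"
    and iso: "\<forall>A\<in>obj C. iso_in D (on_ob F A) (on_ob G A) (\<eta> A)"
    and nat: "\<forall>A\<in>obj C. \<forall>B\<in>obj C. \<forall>f\<in>hom C A B.
             cmp D (on_ob F A) (on_ob F B) (on_ob G B) (\<eta> B) (on_hom F A B f) =
             cmp D (on_ob F A) (on_ob G A) (on_ob G B) (on_hom G A B f) (\<eta> A)"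
    unfolding naturally_isomorphic_def by blast
  have "\<forall>A\<in>obj C. \<exists>t. t \<in> hom D (on_ob G A) (on_ob F A) \<and>
      cmp D (on_ob F A) (on_ob G A) (on_ob F A) t (\<eta> A) = ide D (on_ob F A) \<and>
      cmp D (on_ob G A) (on_ob F A) (on_ob G A) (\<eta> A) t = ide D (on_ob G A)"
    using iso unfolding iso_in_def by blast
  then obtain \<theta> where "\<forall>A\<in>obj C. \<theta> A \<in> hom D (on_ob G A) (on_ob F A) \<and>
      cmp D (on_ob F A) (on_ob G A) (on_ob F A) (\<theta> A) (\<eta> A) = ide D (on_ob F A) \<and>
      cmp D (on_ob G A) (on_ob F A) (on_ob G A) (\<eta> A) (\<theta> A) = ide D (on_ob G A)"
    using bchoice[of "obj C" "\<lambda>A t. t \<in> hom D (on_ob G A) (on_ob F A) \<and>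
      cmp D (on_ob F A) (on_ob G A) (on_ob F A) t (\<eta> A) = ide D (on_ob F A) \<and>
      cmp D (on_ob G A) (on_ob F A) (on_ob G A) (\<eta> A) t = ide D (on_ob G A)"] by blast
  with fn iso nat have "inverse_natural_families C D F G \<eta> \<theta>"
    unfolding inverse_natural_families_def iso_in_def by blast
  then show "\<exists>\<eta> \<theta>. inverse_natural_families C D F G \<eta> \<theta>" by blast
next
  assume "\<exists>\<eta> \<theta>. inverse_natural_families C D F G \<eta> \<theta>"
  then show "naturally_isomorphic C D F G"
    unfolding inverse_natural_families_def naturally_isomorphic_def iso_in_def by meson
qed

lemma
  assumes N: "inverse_natural_families C D F G \<eta> \<theta>"
  shows conjugate_right: "\<lbrakk>A \<in> obj C; B \<in> obj C; f \<in> hom C A B\<rbrakk> \<Longrightarrow> on_hom G A B f =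
       cmp D (on_ob G A) (on_ob F B) (on_ob G B) (\<eta> B)
         (cmp D (on_ob G A) (on_ob F A) (on_ob F B) (on_hom F A B f) (\<theta> A))"
    and conjugate_left: "\<lbrakk>A \<in> obj C; B \<in> obj C; f \<in> hom C A B\<rbrakk> \<Longrightarrow> on_hom F A B f =
       cmp D (on_ob F A) (on_ob G B) (on_ob F B) (\<theta> B)
         (cmp D (on_ob F A) (on_ob G A) (on_ob G B) (on_hom G A B f) (\<eta> A))"
proof -
  have F: "is_functor C D F" and G: "is_functor C D G"
    and \<eta>: "\<And>A. A \<in> obj C \<Longrightarrow> \<eta> A \<in> hom D (on_ob F A) (on_ob G A)"
    and \<theta>: "\<And>A. A \<in> obj C \<Longrightarrow> \<theta> A \<in> hom D (on_ob G A) (on_ob F A)"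
    and id: "\<And>A. A \<in> obj C \<Longrightarrow> cmp D (on_ob F A) (on_ob G A) (on_ob F A) (\<theta> A) (\<eta> A) = ide D (on_ob F A)"
      "\<And>A. A \<in> obj C \<Longrightarrow> cmp D (on_ob G A) (on_ob F A) (on_ob G A) (\<eta> A) (\<theta> A) = ide D (on_ob G A)"
    and nat: "\<And>A B f. \<lbrakk>A \<in> obj C; B \<in> obj C; f \<in> hom C A B\<rbrakk> \<Longrightarrow>
        cmp D (on_ob F A) (on_ob F B) (on_ob G B) (\<eta> B) (on_hom F A B f) =
        cmp D (on_ob F A) (on_ob G A) (on_ob G B) (on_hom G A B f) (\<eta> A)"
    using N unfolding inverse_natural_families_def by blast+
  note D = functor_cod[OF F]
  note ob = functor_ob[OF F] functor_ob[OF G]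
  note hm = functor_hom[OF F] functor_hom[OF G]
  show "on_hom G A B f = cmp D (on_ob G A) (on_ob F B) (on_ob G B) (\<eta> B)
         (cmp D (on_ob G A) (on_ob F A) (on_ob F B) (on_hom F A B f) (\<theta> A))"
    if A: "A \<in> obj C" and B: "B \<in> obj C" and f: "f \<in> hom C A B"
  proof -
    have "cmp D (on_ob G A) (on_ob F B) (on_ob G B) (\<eta> B)
         (cmp D (on_ob G A) (on_ob F A) (on_ob F B) (on_hom F A B f) (\<theta> A))
       = cmp D (on_ob G A) (on_ob F A) (on_ob G B)
           (cmp D (on_ob F A) (on_ob F B) (on_ob G B) (\<eta> B) (on_hom F A B f)) (\<theta> A)"
      by (rule category_assoc[OF D]) (use A B f \<eta> \<theta> ob hm in auto)
    also have "\<dots> = cmp D (on_ob G A) (on_ob F A) (on_ob G B)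
           (cmp D (on_ob F A) (on_ob G A) (on_ob G B) (on_hom G A B f) (\<eta> A)) (\<theta> A)"
      by (simp only: nat[OF A B f])
    also have "\<dots> = cmp D (on_ob G A) (on_ob G A) (on_ob G B) (on_hom G A B f)
                    (cmp D (on_ob G A) (on_ob F A) (on_ob G A) (\<eta> A) (\<theta> A))"
      by (rule category_assoc[OF D, symmetric]) (use A B f \<eta> \<theta> ob hm in auto)
    also have "\<dots> = on_hom G A B f"
      using A B f ob hm by (simp add: id category_unit(1)[OF D])
    finally show ?thesis ..
  qed
  show "on_hom F A B f = cmp D (on_ob F A) (on_ob G B) (on_ob F B) (\<theta> B)
         (cmp D (on_ob F A) (on_ob G A) (on_ob G B) (on_hom G A B f) (\<eta> A))"
    if A: "A \<in> obj C" and B: "B \<in> obj C" and f: "f \<in> hom C A B"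
  proof -
    have "cmp D (on_ob F A) (on_ob G B) (on_ob F B) (\<theta> B)
         (cmp D (on_ob F A) (on_ob F B) (on_ob G B) (\<eta> B) (on_hom F A B f))
       = cmp D (on_ob F A) (on_ob F B) (on_ob F B)
           (cmp D (on_ob F B) (on_ob G B) (on_ob F B) (\<theta> B) (\<eta> B)) (on_hom F A B f)"
      by (rule category_assoc[OF D]) (use A B f \<eta> \<theta> ob hm in auto)
    also have "\<dots> = on_hom F A B f"
      using A B f ob hm by (simp add: id category_unit(2)[OF D])
    finally show ?thesis by (simp only: nat[OF A B f])
  qed
qed

text \<open>The lift \<open>J f\<close> is a conjugate of \<open>G (F f)\<close>, so \<open>F f\<close> determines it, and \<open>J\<close> is faithful.\<close>

lemma faithful_if_retract:
  assumes iso: "naturally_isomorphic C C' (G \<circ>\<^sub>F F) J" and J: "fully_faithful C C' J"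
    and A: "A \<in> obj C" and B: "B \<in> obj C"
  shows "inj_on (on_hom F A B) (hom C A B)"
proof (rule inj_onI)
  fix f g assume f: "f \<in> hom C A B" and g: "g \<in> hom C A B" and eq: "on_hom F A B f = on_hom F A B g"
  obtain \<eta> \<theta> where N: "inverse_natural_families C C' (G \<circ>\<^sub>F F) J \<eta> \<theta>"
    using iso unfolding naturally_isomorphic_iff by blast
  have "on_hom J A B f = on_hom J A B g"
    unfolding conjugate_right[OF N A B f] conjugate_right[OF N A B g] by (simp add: eq)
  moreover have "inj_on (on_hom J A B) (hom C A B)"
    using J A B by (auto simp: fully_faithful_def bij_betw_def)
  ultimately show "f = g" using f g by (auto dest: inj_onD)
qed

text \<open>Given \<open>h : F A \<rightarrow> F B\<close>, conjugate \<open>G h\<close> into a morphism \<open>J A \<rightarrow> J B\<close>. Fullness of \<open>J\<close> writes it as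
  \<open>J f\<close>; conjugating back gives \<open>G (F f) = G h\<close>, and faithfulness of \<open>G\<close> cancels \<open>G\<close>.\<close>

lemma fully_faithful_if_retract:
  assumes iso: "naturally_isomorphic C C' (G \<circ>\<^sub>F F) J" and J: "fully_faithful C C' J"
    and F: "is_functor C D F" and G: "is_functor D C' G"
    and inj: "\<And>A B. \<lbrakk>A \<in> obj D; B \<in> obj D\<rbrakk> \<Longrightarrow> inj_on (on_hom G A B) (hom D A B)"
  shows "fully_faithful C D F"
proof -
  note C' = functor_cod[OF G]
  have Jf: "is_functor C C' J" using J by (simp add: fully_faithful_def)
  have "bij_betw (on_hom F A B) (hom C A B) (hom D (on_ob F A) (on_ob F B))"
    if A: "A \<in> obj C" and B: "B \<in> obj C" for A B
  proof (rule bij_betw_imageI)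
    show "inj_on (on_hom F A B) (hom C A B)"
      by (rule faithful_if_retract[OF iso J A B])
    show "on_hom F A B ` hom C A B = hom D (on_ob F A) (on_ob F B)"
    proof (intro equalityI subsetI)
      fix h assume h: "h \<in> hom D (on_ob F A) (on_ob F B)"
      define a where "a = on_ob G (on_ob F A)"
      define b where "b = on_ob G (on_ob F B)"
      have Gh: "on_hom G (on_ob F A) (on_ob F B) h \<in> hom C' a b" (is "?Gh \<in> _")
        unfolding a_def b_def using h A B by (intro functor_hom[OF G] functor_ob[OF F])
      have ob: "a \<in> obj C'" "b \<in> obj C'" "on_ob J A \<in> obj C'" "on_ob J B \<in> obj C'"
        unfolding a_def b_def using A B functor_ob[OF F] functor_ob[OF G] functor_ob[OF Jf] by auto
      obtain \<eta> \<theta> where N: "inverse_natural_families C C' (G \<circ>\<^sub>F F) J \<eta> \<theta>"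
        using iso unfolding naturally_isomorphic_iff by blast
      then have \<eta>: "\<eta> A \<in> hom C' a (on_ob J A)" "\<eta> B \<in> hom C' b (on_ob J B)"
        and \<theta>: "\<theta> A \<in> hom C' (on_ob J A) a" "\<theta> B \<in> hom C' (on_ob J B) b"
        and id: "cmp C' a (on_ob J A) a (\<theta> A) (\<eta> A) = ide C' a"
          "cmp C' b (on_ob J B) b (\<theta> B) (\<eta> B) = ide C' b"
        using A B by (auto simp: a_def b_def inverse_natural_families_def)
      define k where "k = cmp C' (on_ob J A) b (on_ob J B) (\<eta> B) (cmp C' (on_ob J A) a b ?Gh (\<theta> A))"
      have Gt: "cmp C' (on_ob J A) a b ?Gh (\<theta> A) \<in> hom C' (on_ob J A) b"
        by (rule category_cmp[OF C']) (use ob Gh \<theta> in auto)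
      have "k \<in> hom C' (on_ob J A) (on_ob J B)"
        unfolding k_def by (rule category_cmp[OF C']) (use ob Gt \<eta> in auto)
      then obtain f where f: "f \<in> hom C A B" and k: "on_hom J A B f = k"
        using J A B unfolding fully_faithful_def bij_betw_def by (metis imageE)
      have "cmp C' a (on_ob J A) (on_ob J B) k (\<eta> A) = cmp C' a b (on_ob J B) (\<eta> B)
            (cmp C' a (on_ob J A) b (cmp C' (on_ob J A) a b ?Gh (\<theta> A)) (\<eta> A))"
        unfolding k_def by (rule category_assoc[OF C', symmetric]) (use ob Gt \<eta> in auto)
      also have "cmp C' a (on_ob J A) b (cmp C' (on_ob J A) a b ?Gh (\<theta> A)) (\<eta> A)
          = cmp C' a a b ?Gh (cmp C' a (on_ob J A) a (\<theta> A) (\<eta> A))"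
        by (rule category_assoc[OF C', symmetric]) (use ob Gh \<theta> \<eta> in auto)
      also have "\<dots> = ?Gh" using ob Gh by (simp add: id category_unit[OF C'])
      finally have "cmp C' a (on_ob J B) b (\<theta> B) (cmp C' a (on_ob J A) (on_ob J B) k (\<eta> A))
          = cmp C' a b b (cmp C' b (on_ob J B) b (\<theta> B) (\<eta> B)) ?Gh"
        using category_assoc[OF C', of a b "on_ob J B" b ?Gh "\<eta> B" "\<theta> B"] ob Gh \<theta> \<eta> by simp
      also have "\<dots> = ?Gh" using ob Gh by (simp add: id category_unit[OF C'])
      finally have "on_hom G (on_ob F A) (on_ob F B) (on_hom F A B f) = ?Gh"
        using conjugate_left[OF N A B f] k by (simp add: a_def b_def)
      then have "on_hom F A B f = h"
        using inj[of "on_ob F A" "on_ob F B"] h f A B functor_ob[OF F] functor_hom[OF F]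
        by (auto dest: inj_onD)
      then show "h \<in> on_hom F A B ` hom C A B" using f by blast
    qed (use A B functor_hom[OF F] in auto)
  qed
  then show ?thesis using F by (simp add: fully_faithful_def)
qed

text \<open>Fullness of \<open>F\<close> rests on faithfulness of \<open>G\<close>, which rests on a retraction of \<open>G\<close>; and that lives
  one universe higher. Fullness of \<open>G\<close> takes one more step up. So three consecutive natural
  isomorphisms give full faithfulness, and neither functor is inverted on morphisms by hand.\<close>

lemma quasi_inverse_up_to_lift_if_naturally_isomorphic:
  assumes F: "is_functor C D F" and G: "is_functor D C' G" and F': "is_functor C' D' F'"
    and GF: "naturally_isomorphic C C' (G \<circ>\<^sub>F F) J" and J: "fully_faithful C C' J"
    and FG: "naturally_isomorphic D D' (F' \<circ>\<^sub>F G) I" and I: "fully_faithful D D' I"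
    and GF': "naturally_isomorphic C' C'' (G' \<circ>\<^sub>F F') J'" and J': "fully_faithful C' C'' J'"
  shows "quasi_inverse_up_to_lift C D C' J F G"
  unfolding quasi_inverse_up_to_lift_def
  using GF J fully_faithful_if_retract[OF GF J F G] fully_faithful_if_retract[OF FG I G F']
    faithful_if_retract[OF FG I] faithful_if_retract[OF GF' J'] by blast


section \<open>Wide subcategories\<close>

definition wide_subcategory :: "('o, 'm) cat \<Rightarrow> ('o \<Rightarrow> 'o \<Rightarrow> 'm \<Rightarrow> bool) \<Rightarrow> ('o, 'm) cat" where
  "wide_subcategory C P = C\<lparr>hom := \<lambda>A B. {f \<in> hom C A B. P A B f}\<rparr>"

lemma wide_subcategory_simps [simp]:
  "obj (wide_subcategory C P) = obj C" "ide (wide_subcategory C P) = ide C"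
  "cmp (wide_subcategory C P) = cmp C"
  "hom (wide_subcategory C P) A B = {f \<in> hom C A B. P A B f}"
  by (simp_all add: wide_subcategory_def)

lemma category_wide_subcategory:
  assumes "category C" and "\<And>A. A \<in> obj C \<Longrightarrow> P A A (ide C A)"
    and "\<And>A B D f g. \<lbrakk>A \<in> obj C; B \<in> obj C; D \<in> obj C; f \<in> hom C A B; g \<in> hom C B D;
           P A B f; P B D g\<rbrakk> \<Longrightarrow> P A D (cmp C A B D g f)"
  shows "category (wide_subcategory C P)"
  unfolding category_def wide_subcategory_simps
  using assms(2,3) category_ide[OF assms(1)] category_cmp[OF assms(1)] category_unit[OF assms(1)]
    category_assoc[OF assms(1)] by auto

lemma is_functor_wide_subcategory:
  assumes "is_functor C D F" "category (wide_subcategory C P)" "category (wide_subcategory D Q)"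
    and "\<And>A B f. \<lbrakk>A \<in> obj C; B \<in> obj C; f \<in> hom C A B; P A B f\<rbrakk>
           \<Longrightarrow> Q (on_ob F A) (on_ob F B) (on_hom F A B f)"
  shows "is_functor (wide_subcategory C P) (wide_subcategory D Q) F"
  using assms unfolding is_functor_def by simp

lemma fully_faithful_wide_subcategory:
  assumes ff: "fully_faithful C D F"
    and cats: "category (wide_subcategory C P)" "category (wide_subcategory D Q)"
    and PQ: "\<And>A B f. \<lbrakk>A \<in> obj C; B \<in> obj C; f \<in> hom C A B\<rbrakk>
           \<Longrightarrow> Q (on_ob F A) (on_ob F B) (on_hom F A B f) \<longleftrightarrow> P A B f"
  shows "fully_faithful (wide_subcategory C P) (wide_subcategory D Q) F"
proof -
  have "is_functor (wide_subcategory C P) (wide_subcategory D Q) F"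
    using ff PQ cats by (intro is_functor_wide_subcategory) (auto simp: fully_faithful_def)
  moreover have "bij_betw (on_hom F A B) {f \<in> hom C A B. P A B f}
      {f \<in> hom D (on_ob F A) (on_ob F B). Q (on_ob F A) (on_ob F B) f}"
    if "A \<in> obj C" "B \<in> obj C" for A B
  proof -
    have bij: "bij_betw (on_hom F A B) (hom C A B) (hom D (on_ob F A) (on_ob F B))"
      using ff that by (simp add: fully_faithful_def)
    then have "bij_betw (on_hom F A B) {f \<in> hom C A B. P A B f}
        (on_hom F A B ` {f \<in> hom C A B. P A B f})"
      by (auto simp: bij_betw_def intro: inj_on_subset)
    moreover have "on_hom F A B ` {f \<in> hom C A B. P A B f}
        = {f \<in> on_hom F A B ` hom C A B. Q (on_ob F A) (on_ob F B) f}"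
      using PQ[OF that] by auto
    ultimately show ?thesis
      using bij by (simp add: bij_betw_imp_surj_on)
  qed
  ultimately show ?thesis by (simp add: fully_faithful_def)
qed

text \<open>The lifting functor respects membership as well, because \<open>J f\<close> is a conjugate of \<open>G (F f)\<close> by
  isomorphisms, and these belong to the subcategory.\<close>

lemma quasi_inverse_up_to_lift_wide_subcategory:
  assumes qi: "quasi_inverse_up_to_lift C D C' J F G"
    and cats: "category (wide_subcategory C P)" "category (wide_subcategory D Q)"
      "category (wide_subcategory C' P')"
    and F: "\<And>A B f. \<lbrakk>A \<in> obj C; B \<in> obj C; f \<in> hom C A B\<rbrakk>
           \<Longrightarrow> Q (on_ob F A) (on_ob F B) (on_hom F A B f) \<longleftrightarrow> P A B f"
    and G: "\<And>A B f. \<lbrakk>A \<in> obj D; B \<in> obj D; f \<in> hom D A B\<rbrakk>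
           \<Longrightarrow> P' (on_ob G A) (on_ob G B) (on_hom G A B f) \<longleftrightarrow> Q A B f"
    and isos: "\<And>A B f. \<lbrakk>A \<in> obj C'; B \<in> obj C'; iso_in C' A B f\<rbrakk> \<Longrightarrow> P' A B f"
  shows "quasi_inverse_up_to_lift (wide_subcategory C P) (wide_subcategory D Q)
    (wide_subcategory C' P') J F G"
proof -
  let ?w = wide_subcategory
  have ff: "fully_faithful C C' J" "fully_faithful C D F" "fully_faithful D C' G"
    and nat: "naturally_isomorphic C C' (G \<circ>\<^sub>F F) J"
    using qi by (auto simp: quasi_inverse_up_to_lift_def)
  have fn: "is_functor C C' J" "is_functor C D F" "is_functor D C' G"
    using ff by (auto simp: fully_faithful_def)
  have GF: "P' (on_ob G (on_ob F A)) (on_ob G (on_ob F B))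
      (on_hom G (on_ob F A) (on_ob F B) (on_hom F A B f)) \<longleftrightarrow> P A B f"
    if "A \<in> obj C" "B \<in> obj C" "f \<in> hom C A B" for A B f
    using G[of "on_ob F A" "on_ob F B"] F that functor_ob[OF fn(2)] functor_hom[OF fn(2)] by auto
  obtain \<eta> \<theta> where N: "inverse_natural_families C C' (G \<circ>\<^sub>F F) J \<eta> \<theta>"
    using nat unfolding naturally_isomorphic_iff by blast
  then have \<eta>: "\<And>A. A \<in> obj C \<Longrightarrow> \<eta> A \<in> hom C' (on_ob G (on_ob F A)) (on_ob J A)"
    and \<theta>: "\<And>A. A \<in> obj C \<Longrightarrow> \<theta> A \<in> hom C' (on_ob J A) (on_ob G (on_ob F A))"
    and id: "\<And>A. A \<in> obj C \<Longrightarrow> cmp C' (on_ob G (on_ob F A)) (on_ob J A) (on_ob G (on_ob F A)) (\<theta> A) (\<eta> A)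
               = ide C' (on_ob G (on_ob F A))"
      "\<And>A. A \<in> obj C \<Longrightarrow> cmp C' (on_ob J A) (on_ob G (on_ob F A)) (on_ob J A) (\<eta> A) (\<theta> A) = ide C' (on_ob J A)"
    unfolding inverse_natural_families_def comp_functor_simps by blast+
  note ob = functor_ob[OF fn(1)] functor_ob[OF fn(2)] functor_ob[OF fn(3)]
  note hm = functor_hom[OF fn(1)] functor_hom[OF fn(2)] functor_hom[OF fn(3)]
  have P'\<eta>: "P' (on_ob G (on_ob F A)) (on_ob J A) (\<eta> A)" if "A \<in> obj C" for A
    by (rule isos, use that ob in simp, use that ob in simp, rule iso_inI[where g = "\<theta> A"])
      (use that \<eta> \<theta> id in simp_all)
  have P'\<theta>: "P' (on_ob J A) (on_ob G (on_ob F A)) (\<theta> A)" if "A \<in> obj C" for A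
    by (rule isos, use that ob in simp, use that ob in simp, rule iso_inI[where g = "\<eta> A"])
      (use that \<eta> \<theta> id in simp_all)
  have closed: "cmp C' A B D g f \<in> hom C' A D \<and> P' A D (cmp C' A B D g f)"
    if "A \<in> obj C'" "B \<in> obj C'" "D \<in> obj C'" "f \<in> hom C' A B \<and> P' A B f" "g \<in> hom C' B D \<and> P' B D g"
    for A B D f g
    using category_cmp[OF cats(3), of A B D f g] that by simp
  have JP: "P' (on_ob J A) (on_ob J B) (on_hom J A B f) \<longleftrightarrow> P A B f"
    if "A \<in> obj C" "B \<in> obj C" "f \<in> hom C A B" for A B f
  proof
    assume "P A B f"
    then have "P' (on_ob G (on_ob F A)) (on_ob G (on_ob F B))
        (on_hom G (on_ob F A) (on_ob F B) (on_hom F A B f))"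
      using GF that by simp
    then show "P' (on_ob J A) (on_ob J B) (on_hom J A B f)"
      unfolding conjugate_right[OF N that] comp_functor_simps using that \<eta> \<theta> ob hm P'\<eta> P'\<theta> by (intro closed[THEN conjunct2] closed) auto
  next
    assume "P' (on_ob J A) (on_ob J B) (on_hom J A B f)"
    then have "P' (on_ob G (on_ob F A)) (on_ob G (on_ob F B))
        (on_hom G (on_ob F A) (on_ob F B) (on_hom F A B f))"
      unfolding conjugate_left[OF N that, unfolded comp_functor_simps] using that \<eta> \<theta> ob hm P'\<eta> P'\<theta> by (intro closed[THEN conjunct2] closed) auto
    then show "P A B f" using GF that by simp
  qed
  have ffw: "fully_faithful (?w C P) (?w C' P') J" "fully_faithful (?w C P) (?w D Q) F"
    "fully_faithful (?w D Q) (?w C' P') G"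
    by (rule fully_faithful_wide_subcategory; fact ff cats F G JP)+
  have "is_functor (?w C P) (?w C' P') (G \<circ>\<^sub>F F)" "is_functor (?w C P) (?w C' P') J"
    using ffw is_functor_comp unfolding fully_faithful_def by blast+
  then have "inverse_natural_families (?w C P) (?w C' P') (G \<circ>\<^sub>F F) J \<eta> \<theta>"
    using N P'\<eta> P'\<theta> unfolding inverse_natural_families_def by simp
  then have "naturally_isomorphic (?w C P) (?w C' P') (G \<circ>\<^sub>F F) J"
    unfolding naturally_isomorphic_iff by blast
  then show ?thesis using ffw by (simp add: quasi_inverse_up_to_lift_def)
qed


section \<open>Order isomorphisms\<close>

context partial_order
begin

lemma sup_eqI:
  assumes "s \<in> carrier L" "A \<subseteq> carrier L" "\<And>x. x \<in> A \<Longrightarrow> x \<sqsubseteq> s"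
    "\<And>y. y \<in> carrier L \<Longrightarrow> (\<And>x. x \<in> A \<Longrightarrow> x \<sqsubseteq> y) \<Longrightarrow> s \<sqsubseteq> y"
  shows "\<Squnion>A = s"
proof -
  have "least L s (Upper L A)"
    by (rule least_UpperI) (use assms in \<open>auto simp: Upper_def intro!: assms(4)\<close>)
  then show ?thesis
    unfolding sup_def by (blast intro: some_equality least_unique)
qed

lemma inf_eqI:
  assumes "s \<in> carrier L" "A \<subseteq> carrier L" "\<And>x. x \<in> A \<Longrightarrow> s \<sqsubseteq> x"
    "\<And>y. y \<in> carrier L \<Longrightarrow> (\<And>x. x \<in> A \<Longrightarrow> y \<sqsubseteq> x) \<Longrightarrow> y \<sqsubseteq> s"
  shows "\<Sqinter>A = s"
proof -
  have "greatest L s (Lower L A)"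
    by (rule greatest_LowerI) (use assms in \<open>auto simp: Lower_def intro!: assms(4)\<close>)
  then show ?thesis
    unfolding inf_def by (blast intro: some_equality greatest_unique)
qed

lemma meet_eqI:
  assumes "s \<in> carrier L" "x \<in> carrier L" "y \<in> carrier L" "s \<sqsubseteq> x" "s \<sqsubseteq> y"
    "\<And>z. z \<in> carrier L \<Longrightarrow> z \<sqsubseteq> x \<Longrightarrow> z \<sqsubseteq> y \<Longrightarrow> z \<sqsubseteq> s"
  shows "x \<sqinter> y = s"
  unfolding meet_def by (rule inf_eqI) (use assms in auto)

lemma top_eqI:
  assumes "t \<in> carrier L" "\<And>x. x \<in> carrier L \<Longrightarrow> x \<sqsubseteq> t"
  shows "\<top> = t"
proof -
  have "greatest L t (carrier L)" using assms by (auto simp: greatest_def)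
  then show ?thesis unfolding top_def by (blast intro: some_equality greatest_unique)
qed

lemma bottom_eqI:
  assumes "t \<in> carrier L" "\<And>x. x \<in> carrier L \<Longrightarrow> t \<sqsubseteq> x"
  shows "\<bottom> = t"
proof -
  have "least L t (carrier L)" using assms by (auto simp: least_def)
  then show ?thesis unfolding bottom_def by (blast intro: some_equality least_unique)
qed

end

lemma partial_orderI:
  assumes "eq L = (=)" "\<And>x. x \<in> carrier L \<Longrightarrow> x \<sqsubseteq>\<^bsub>L\<^esub> x"
    "\<And>x y. \<lbrakk>x \<sqsubseteq>\<^bsub>L\<^esub> y; y \<sqsubseteq>\<^bsub>L\<^esub> x; x \<in> carrier L; y \<in> carrier L\<rbrakk> \<Longrightarrow> x = y"
    "\<And>x y z. \<lbrakk>x \<sqsubseteq>\<^bsub>L\<^esub> y; y \<sqsubseteq>\<^bsub>L\<^esub> z; x \<in> carrier L; y \<in> carrier L; z \<in> carrier L\<rbrakk> \<Longrightarrow> x \<sqsubseteq>\<^bsub>L\<^esub> z"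
  shows "partial_order L"
  by unfold_locales (use assms in auto)

lemma way_belowE:
  assumes "way_below L a b" "S \<subseteq> carrier L" "b \<sqsubseteq>\<^bsub>L\<^esub> \<Squnion>\<^bsub>L\<^esub>S"
  obtains T where "finite T" "T \<subseteq> S" "a \<sqsubseteq>\<^bsub>L\<^esub> \<Squnion>\<^bsub>L\<^esub>T"
proof -
  have "\<exists>T. finite T \<and> T \<subseteq> S \<and> a \<sqsubseteq>\<^bsub>L\<^esub> \<Squnion>\<^bsub>L\<^esub>T"
    using assms(1)[unfolded way_below_def, rule_format, of S] assms(2,3) by simp
  then show thesis using that by blast
qed

text \<open>Unlike an isomorphism in a category, an order isomorphism may change the type of the points.\<close>

definition order_iso :: "'a gorder \<Rightarrow> 'b gorder \<Rightarrow> ('a \<Rightarrow> 'b) \<Rightarrow> bool" where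
  "order_iso L L' e \<longleftrightarrow> bij_betw e (carrier L) (carrier L') \<and>
     (\<forall>x\<in>carrier L. \<forall>y\<in>carrier L. e x \<sqsubseteq>\<^bsub>L'\<^esub> e y \<longleftrightarrow> x \<sqsubseteq>\<^bsub>L\<^esub> y)"

lemma
  assumes "order_iso L L' e"
  shows order_iso_image: "e ` carrier L = carrier L'"
    and order_iso_inj: "inj_on e (carrier L)"
    and order_iso_closed: "x \<in> carrier L \<Longrightarrow> e x \<in> carrier L'"
    and order_iso_le: "\<lbrakk>x \<in> carrier L; y \<in> carrier L\<rbrakk> \<Longrightarrow> e x \<sqsubseteq>\<^bsub>L'\<^esub> e y \<longleftrightarrow> x \<sqsubseteq>\<^bsub>L\<^esub> y"
  using assms by (auto simp: order_iso_def bij_betw_def)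

lemma order_iso_inverse:
  assumes "order_iso L L' e"
  shows "order_iso L' L (inv_into (carrier L) e)"
proof -
  have e: "bij_betw e (carrier L) (carrier L')" using assms by (simp add: order_iso_def)
  have "inv_into (carrier L) e x \<in> carrier L" "e (inv_into (carrier L) e x) = x" if "x \<in> carrier L'" for x
    using e that by (auto simp: bij_betw_inv_into_right bij_betw_imp_surj_on inv_into_into)
  then show ?thesis
    using bij_betw_inv_into[OF e] assms unfolding order_iso_def by metis
qed

lemma order_iso_comp:
  assumes "order_iso L L' e" "order_iso L' L'' d"
  shows "order_iso L L'' (d \<circ> e)"
  using assms bij_betw_trans[of e "carrier L" "carrier L'" d "carrier L''"] unfolding order_iso_def
  by (auto simp: bij_betw_apply)

locale order_isomorphism = L: partial_order L for L :: "'a gorder" (structure) +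
  fixes L' :: "'b gorder" and e :: "'a \<Rightarrow> 'b"
  assumes iso: "order_iso L L' e" and eq_target: "eq L' = (=)"
begin

lemmas closed = order_iso_closed[OF iso]
lemmas le_iff = order_iso_le[OF iso]
lemmas image = order_iso_image[OF iso]

lemma elements: "x \<in> carrier L' \<longleftrightarrow> (\<exists>a\<in>carrier L. x = e a)"
  using image by blast

lemma eq_iff: "\<lbrakk>x \<in> carrier L; y \<in> carrier L\<rbrakk> \<Longrightarrow> e x = e y \<longleftrightarrow> x = y"
  using order_iso_inj[OF iso] by (auto dest: inj_onD)

lemma subsets: assumes "A \<subseteq> carrier L'" obtains B where "B \<subseteq> carrier L" "A = e ` B"
  using assms image by (metis subset_image_iff)

sublocale target: partial_order L'
  by (rule partial_orderI)
    (auto simp: eq_target elements le_iff eq_iff intro: L.le_antisym L.le_trans)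

lemma image_Upper:
  assumes A: "A \<subseteq> carrier L"
  shows "Upper L' (e ` A) = e ` Upper L A"
proof (rule subset_antisym; rule subsetI)
  fix y assume y: "y \<in> Upper L' (e ` A)"
  then obtain a where a: "a \<in> carrier L" "y = e a" by (auto simp: Upper_def elements)
  then have "a \<in> Upper L A" using A y closed by (auto simp: Upper_def le_iff)
  with a show "y \<in> e ` Upper L A" by blast
qed (use A in \<open>auto simp: Upper_def le_iff closed\<close>)

lemma image_Lower:
  assumes A: "A \<subseteq> carrier L"
  shows "Lower L' (e ` A) = e ` Lower L A"
proof (rule subset_antisym; rule subsetI)
  fix y assume y: "y \<in> Lower L' (e ` A)"
  then obtain a where a: "a \<in> carrier L" "y = e a" by (auto simp: Lower_def elements)
  then have "a \<in> Lower L A" using A y closed by (auto simp: Lower_def le_iff)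
  with a show "y \<in> e ` Lower L A" by blast
qed (use A in \<open>auto simp: Lower_def le_iff closed\<close>)

lemma least: "least L s A \<Longrightarrow> least L' (e s) (e ` A)"
  by (auto simp: least_def closed le_iff subset_iff)

lemma greatest: "greatest L s A \<Longrightarrow> greatest L' (e s) (e ` A)"
  by (auto simp: greatest_def closed le_iff subset_iff)

lemma map_sup:
  assumes "A \<subseteq> carrier L" "\<exists>s. least L s (Upper L A)"
  shows "e (\<Squnion>A) = \<Squnion>\<^bsub>L'\<^esub>(e ` A)"
proof -
  have "least L (\<Squnion>A) (Upper L A)"
    unfolding sup_def using assms(2) by (rule someI_ex)
  from least[OF this] have *: "least L' (e (\<Squnion>A)) (Upper L' (e ` A))"
    by (simp add: image_Upper assms(1))
  have "e ` A \<subseteq> carrier L'" using assms(1) closed by blast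
  with * show ?thesis unfolding sup_def[of L'] by (metis some_equality target.least_unique)
qed

lemma map_inf:
  assumes "A \<subseteq> carrier L" "\<exists>s. greatest L s (Lower L A)"
  shows "e (\<Sqinter>A) = \<Sqinter>\<^bsub>L'\<^esub>(e ` A)"
proof -
  have "greatest L (\<Sqinter>A) (Lower L A)"
    unfolding inf_def using assms(2) by (rule someI_ex)
  from greatest[OF this] have *: "greatest L' (e (\<Sqinter>A)) (Lower L' (e ` A))"
    by (simp add: image_Lower assms(1))
  then show ?thesis unfolding inf_def[of L'] by (metis some_equality target.greatest_unique)
qed

lemma map_meet:
  assumes "x \<in> carrier L" "y \<in> carrier L" "\<exists>s. greatest L s (Lower L {x, y})"
  shows "e (x \<sqinter> y) = e x \<sqinter>\<^bsub>L'\<^esub> e y"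
  using map_inf[of "{x, y}"] assms by (simp add: meet_def)

lemma map_top:
  assumes "\<exists>t. greatest L t (carrier L)"
  shows "e \<top> = \<top>\<^bsub>L'\<^esub>"
proof -
  have "greatest L \<top> (carrier L)" unfolding top_def using assms by (rule someI_ex)
  from greatest[OF this] show ?thesis
    unfolding image top_def[of L'] by (metis some_equality target.greatest_unique)
qed

lemma lower_semilattice_target:
  assumes "lower_semilattice L"
  shows "lower_semilattice L'"
proof -
  interpret lower_semilattice L by fact
  show ?thesis
  proof
    fix x y assume "x \<in> carrier L'" "y \<in> carrier L'"
    then obtain a b where ab: "a \<in> carrier L" "b \<in> carrier L" "x = e a" "y = e b"
      by (auto simp: elements)
    then obtain s where "greatest L s (Lower L {a, b})" using inf_of_two_exists by blast
    from greatest[OF this] show "\<exists>s. greatest L' s (Lower L' {x, y})"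
      using image_Lower[of "{a, b}"] ab by auto
  qed
qed

lemma complete_lattice_target:
  assumes "complete_lattice L"
  shows "complete_lattice L'"
proof -
  interpret complete_lattice L by fact
  show ?thesis
  proof
    fix A assume "A \<subseteq> carrier L'"
    then obtain B where B: "B \<subseteq> carrier L" "A = e ` B" by (rule subsets)
    show "\<exists>s. least L' s (Upper L' A)"
      using least image_Upper[OF B(1)] sup_exists[OF B(1)] B(2) by auto
    show "\<exists>s. greatest L' s (Lower L' A)"
      using greatest image_Lower[OF B(1)] inf_exists[OF B(1)] B(2) by auto
  qed
qed

end

locale complete_order_isomorphism = order_isomorphism + complete_lattice L
begin

lemma map_Sup: "A \<subseteq> carrier L \<Longrightarrow> e (\<Squnion>A) = \<Squnion>\<^bsub>L'\<^esub>(e ` A)"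
  by (simp add: map_sup sup_exists)

lemma map_Inf: "A \<subseteq> carrier L \<Longrightarrow> e (\<Sqinter>A) = \<Sqinter>\<^bsub>L'\<^esub>(e ` A)"
  by (simp add: map_inf inf_exists)

lemma map_Meet: "\<lbrakk>x \<in> carrier L; y \<in> carrier L\<rbrakk> \<Longrightarrow> e (x \<sqinter> y) = e x \<sqinter>\<^bsub>L'\<^esub> e y"
  by (simp add: map_meet inf_exists)

lemma map_Top: "e \<top> = \<top>\<^bsub>L'\<^esub>"
  by (rule map_top) (use top_greatest in blast)

lemma way_below_iff:
  assumes "a \<in> carrier L" "b \<in> carrier L"
  shows "way_below L' (e a) (e b) \<longleftrightarrow> way_below L a b"
proof
  assume w: "way_below L' (e a) (e b)"
  show "way_below L a b" unfolding way_below_def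
  proof (intro allI impI)
    fix S assume S: "S \<subseteq> carrier L \<and> b \<sqsubseteq> \<Squnion>S"
    then have "e ` S \<subseteq> carrier L' \<and> e b \<sqsubseteq>\<^bsub>L'\<^esub> \<Squnion>\<^bsub>L'\<^esub>(e ` S)"
      using assms closed by (auto simp: le_iff simp flip: map_Sup)
    then obtain T' where T': "finite T'" "T' \<subseteq> e ` S" "e a \<sqsubseteq>\<^bsub>L'\<^esub> \<Squnion>\<^bsub>L'\<^esub>T'"
      by (elim conjE way_belowE[OF w])
    then obtain T where T: "finite T" "T \<subseteq> S" "e a \<sqsubseteq>\<^bsub>L'\<^esub> \<Squnion>\<^bsub>L'\<^esub>(e ` T)"
      using finite_subset_image[OF T'(1,2)] by blast
    with S have "T \<subseteq> carrier L" by blast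
    with T assms show "\<exists>T. finite T \<and> T \<subseteq> S \<and> a \<sqsubseteq> \<Squnion>T"
      by (auto simp: le_iff simp flip: map_Sup)
  qed
next
  assume w: "way_below L a b"
  show "way_below L' (e a) (e b)" unfolding way_below_def
  proof (intro allI impI)
    fix S' assume S': "S' \<subseteq> carrier L' \<and> e b \<sqsubseteq>\<^bsub>L'\<^esub> \<Squnion>\<^bsub>L'\<^esub>S'"
    then obtain S where S: "S \<subseteq> carrier L" "S' = e ` S" using subsets by metis
    with S' assms have "b \<sqsubseteq> \<Squnion>S" by (auto simp: le_iff simp flip: map_Sup)
    then obtain T where T: "finite T" "T \<subseteq> S" "a \<sqsubseteq> \<Squnion>T"
      by (rule way_belowE[OF w S(1)])
    have "T \<subseteq> carrier L" using T S by blast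
    then have "e a \<sqsubseteq>\<^bsub>L'\<^esub> \<Squnion>\<^bsub>L'\<^esub>(e ` T)"
      using T assms by (auto simp: le_iff simp flip: map_Sup)
    with T S show "\<exists>T. finite T \<and> T \<subseteq> S' \<and> e a \<sqsubseteq>\<^bsub>L'\<^esub> \<Squnion>\<^bsub>L'\<^esub>T"
      by (intro exI[of _ "e ` T"]) auto
  qed
qed

lemma compact_elements_target: "compact_elements L' = e ` compact_elements L"
  by (auto simp: compact_elements_def elements way_below_iff)

lemma pseudoprime_elements_target: "pseudoprime_elements L' = e ` pseudoprime_elements L"
proof -
  have "e p \<in> pseudoprime_elements L' \<longleftrightarrow> p \<in> pseudoprime_elements L" if p: "p \<in> carrier L" for p
  proof -
    have "(\<forall>A. finite A \<and> A \<noteq> {} \<and> A \<subseteq> carrier L' \<and> way_below L' (\<Sqinter>\<^bsub>L'\<^esub>A) (e p)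
              \<longrightarrow> (\<exists>a\<in>A. a \<sqsubseteq>\<^bsub>L'\<^esub> e p)) \<longleftrightarrow>
          (\<forall>A. finite A \<and> A \<noteq> {} \<and> A \<subseteq> carrier L \<and> way_below L (\<Sqinter>A) p \<longrightarrow> (\<exists>a\<in>A. a \<sqsubseteq> p))"
      (is "?l \<longleftrightarrow> ?r")
    proof
      assume l: ?l
      show ?r
      proof (intro allI impI)
        fix A assume A: "finite A \<and> A \<noteq> {} \<and> A \<subseteq> carrier L \<and> way_below L (\<Sqinter>A) p"
        then have "way_below L' (\<Sqinter>\<^bsub>L'\<^esub>(e ` A)) (e p)"
          using p by (simp add: way_below_iff flip: map_Inf)
        with A have "\<exists>a\<in>e ` A. a \<sqsubseteq>\<^bsub>L'\<^esub> e p" using closed by (intro l[rule_format]) auto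
        with A p show "\<exists>a\<in>A. a \<sqsubseteq> p" by (auto simp: le_iff subset_iff)
      qed
    next
      assume r: ?r
      show ?l
      proof (intro allI impI)
        fix A' assume A': "finite A' \<and> A' \<noteq> {} \<and> A' \<subseteq> carrier L' \<and> way_below L' (\<Sqinter>\<^bsub>L'\<^esub>A') (e p)"
        then have "A' \<subseteq> carrier L'" by blast
        then obtain A where A: "A \<subseteq> carrier L" "A' = e ` A" by (rule subsets)
        then have "finite A"
          using A' order_iso_inj[OF iso] by (metis finite_imageD inj_on_subset)
        moreover have "way_below L (\<Sqinter>A) p"
          using A' A p by (simp add: way_below_iff flip: map_Inf)
        ultimately have "\<exists>a\<in>A. a \<sqsubseteq> p" using A A' by (intro r[rule_format]) auto
        with A p show "\<exists>a\<in>A'. a \<sqsubseteq>\<^bsub>L'\<^esub> e p" by (auto simp: le_iff subset_iff)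
      qed
    qed
    then show ?thesis
      using p eq_iff[OF p top_closed] closed by (simp add: pseudoprime_elements_def map_Top)
  qed
  moreover have "pseudoprime_elements L' \<subseteq> e ` carrier L" "pseudoprime_elements L \<subseteq> carrier L"
    by (auto simp: pseudoprime_elements_def image)
  ultimately show ?thesis by blast
qed

end

lemma compact_algebraic_frame_transport:
  assumes L: "compact_algebraic_frame L" and iso: "order_iso L L' e" and eq: "eq L' = (=)"
  shows "compact_algebraic_frame L'"
proof -
  interpret complete_lattice L using L by (simp add: compact_algebraic_frame_def)
  interpret complete_order_isomorphism L L' e
    by unfold_locales (fact iso eq)+
  have frame: "a \<sqinter>\<^bsub>L\<^esub> \<Squnion>\<^bsub>L\<^esub>S = \<Squnion>\<^bsub>L\<^esub>((\<lambda>s. a \<sqinter>\<^bsub>L\<^esub> s) ` S)" if "a \<in> carrier L" "S \<subseteq> carrier L" for a S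
    using L that by (simp add: compact_algebraic_frame_def)
  show ?thesis unfolding compact_algebraic_frame_def
  proof (intro conjI ballI allI impI)
    show "complete_lattice L'"
      by (rule complete_lattice_target) unfold_locales
    show "\<top>\<^bsub>L'\<^esub> \<in> compact_elements L'"
      using L by (auto simp: compact_elements_target compact_algebraic_frame_def simp flip: map_Top)
    fix a' assume "a' \<in> carrier L'"
    then obtain a where a: "a \<in> carrier L" "a' = e a" by (auto simp: elements)
    then obtain S where "S \<subseteq> compact_elements L" "a = \<Squnion>\<^bsub>L\<^esub>S"
      using L unfolding compact_algebraic_frame_def by blast
    moreover from this have "S \<subseteq> carrier L" by (auto simp: compact_elements_def)
    ultimately show "\<exists>S. S \<subseteq> compact_elements L' \<and> a' = \<Squnion>\<^bsub>L'\<^esub>S"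
      by (intro exI[of _ "e ` S"]) (auto simp: a compact_elements_target map_Sup)
    fix S' assume "S' \<subseteq> carrier L'"
    then obtain T where T: "T \<subseteq> carrier L" "S' = e ` T" by (rule subsets)
    have "(\<lambda>s. a' \<sqinter>\<^bsub>L'\<^esub> s) ` S' = e ` (\<lambda>s. a \<sqinter>\<^bsub>L\<^esub> s) ` T"
      using T a map_Meet[OF a(1)] by (auto simp: image_image subset_iff intro!: image_cong)
    moreover have "(\<lambda>s. a \<sqinter>\<^bsub>L\<^esub> s) ` T \<subseteq> carrier L" using T a by auto
    moreover have "a' \<sqinter>\<^bsub>L'\<^esub> \<Squnion>\<^bsub>L'\<^esub>S' = e (a \<sqinter>\<^bsub>L\<^esub> \<Squnion>\<^bsub>L\<^esub>T)"
      using T a by (simp add: map_Meet map_Sup)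
    ultimately show "a' \<sqinter>\<^bsub>L'\<^esub> \<Squnion>\<^bsub>L'\<^esub>S' = \<Squnion>\<^bsub>L'\<^esub>((\<lambda>s. a' \<sqinter>\<^bsub>L'\<^esub> s) ` S')"
      using frame[OF a(1) T(1)] map_Sup by simp
  qed
qed

lemma bounded_distributive_meet_semilattice_transport:
  assumes L: "bounded_distributive_meet_semilattice L" and iso: "order_iso L L' e" and eq: "eq L' = (=)"
  shows "bounded_distributive_meet_semilattice L'"
proof -
  interpret lower_semilattice L using L by (simp add: bounded_distributive_meet_semilattice_def)
  interpret order_isomorphism L L' e
    by unfold_locales (fact iso eq)+
  have meet: "e (x \<sqinter>\<^bsub>L\<^esub> y) = e x \<sqinter>\<^bsub>L'\<^esub> e y" if "x \<in> carrier L" "y \<in> carrier L" for x y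
    using that by (simp add: map_meet inf_of_two_exists)
  show ?thesis unfolding bounded_distributive_meet_semilattice_def
  proof (intro conjI ballI impI)
    show "lower_semilattice L'" by (rule lower_semilattice_target) unfold_locales
    show "\<exists>t. greatest L' t (carrier L')" "\<exists>z. least L' z (carrier L')"
      using L greatest least unfolding bounded_distributive_meet_semilattice_def image[symmetric] by blast+
    fix a' b' c' assume "a' \<in> carrier L'" "b' \<in> carrier L'" "c' \<in> carrier L'" and le: "a' \<sqinter>\<^bsub>L'\<^esub> b' \<sqsubseteq>\<^bsub>L'\<^esub> c'"
    then obtain a b c where abc: "a \<in> carrier L" "b \<in> carrier L" "c \<in> carrier L"
      "a' = e a" "b' = e b" "c' = e c" by (auto simp: elements)
    with le have "a \<sqinter>\<^bsub>L\<^esub> b \<sqsubseteq>\<^bsub>L\<^esub> c" by (simp add: le_iff flip: meet)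
    then obtain x y where "x \<in> carrier L" "y \<in> carrier L" "a \<sqsubseteq>\<^bsub>L\<^esub> x" "b \<sqsubseteq>\<^bsub>L\<^esub> y" "x \<sqinter>\<^bsub>L\<^esub> y = c"
      using L abc unfolding bounded_distributive_meet_semilattice_def by blast
    then show "\<exists>a''\<in>carrier L'. \<exists>b''\<in>carrier L'. a' \<sqsubseteq>\<^bsub>L'\<^esub> a'' \<and> b' \<sqsubseteq>\<^bsub>L'\<^esub> b'' \<and> a'' \<sqinter>\<^bsub>L'\<^esub> b'' = c'"
      using abc by (intro bexI[of _ "e x"] bexI[of _ "e y"]) (auto simp: le_iff closed simp flip: meet)
  qed
qed


section \<open>Categories of ordered sets\<close>

definition order_category :: "('a gorder, 'a \<Rightarrow> 'a) cat \<Rightarrow> bool" where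
  "order_category C \<longleftrightarrow> category C \<and> (\<forall>A\<in>obj C. partial_order A) \<and>
     (\<forall>A\<in>obj C. \<forall>B\<in>obj C. hom C A B \<subseteq> carrier A \<rightarrow>\<^sub>E carrier B) \<and>
     ide C = (\<lambda>A. \<lambda>x\<in>carrier A. x) \<and> cmp C = (\<lambda>A B D g f. compose (carrier A) g f)"

lemma order_categoryI:
  assumes "\<And>A. A \<in> obj C \<Longrightarrow> partial_order A"
    and "\<And>A B. A \<in> obj C \<Longrightarrow> B \<in> obj C \<Longrightarrow> hom C A B \<subseteq> carrier A \<rightarrow>\<^sub>E carrier B"
    and "ide C = (\<lambda>A. \<lambda>x\<in>carrier A. x)" "cmp C = (\<lambda>A B D g f. compose (carrier A) g f)"
    and "\<And>A. A \<in> obj C \<Longrightarrow> (\<lambda>x\<in>carrier A. x) \<in> hom C A A"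
    and "\<And>A B D f g. \<lbrakk>A \<in> obj C; B \<in> obj C; D \<in> obj C; f \<in> hom C A B; g \<in> hom C B D\<rbrakk>
          \<Longrightarrow> compose (carrier A) g f \<in> hom C A D"
  shows "order_category C"
proof -
  have hom: "f \<in> carrier A \<rightarrow>\<^sub>E carrier B" if "A \<in> obj C" "B \<in> obj C" "f \<in> hom C A B" for A B f
    using assms(2) that by blast
  have "compose (carrier A) f (\<lambda>x\<in>carrier A. x) = f \<and> compose (carrier A) (\<lambda>x\<in>carrier B. x) f = f"
    if "A \<in> obj C" "B \<in> obj C" "f \<in> hom C A B" for A B f
    using hom[OF that] by (auto simp: compose_def PiE_def extensional_def fun_eq_iff Pi_iff)
  moreover have "compose (carrier A) h (compose (carrier A) g f) = compose (carrier A) (compose (carrier B) h g) f"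
    if "A \<in> obj C" "B \<in> obj C" "f \<in> hom C A B" for A B f g h
    using hom[OF that] by (auto simp: compose_def PiE_def Pi_iff)
  ultimately have "category C"
    unfolding category_def assms(3,4) using assms(5,6) by blast
  with assms show ?thesis by (simp add: order_category_def)
qed

lemma
  assumes "order_category C"
  shows order_category_category: "category C"
    and order_category_ide: "ide C A = (\<lambda>x\<in>carrier A. x)"
    and order_category_cmp: "cmp C A B D g f = compose (carrier A) g f"
    and order_category_hom: "\<lbrakk>A \<in> obj C; B \<in> obj C; f \<in> hom C A B\<rbrakk> \<Longrightarrow> f \<in> carrier A \<rightarrow>\<^sub>E carrier B"
proof -
  show "f \<in> carrier A \<rightarrow>\<^sub>E carrier B" if "A \<in> obj C" "B \<in> obj C" "f \<in> hom C A B"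
    using assms that unfolding order_category_def by blast
qed (use assms in \<open>simp_all add: order_category_def\<close>)

text \<open>Meant for one and the same category over two types of points, whose definition mentions only
  the order.\<close>

definition order_invariant :: "('a gorder, 'a \<Rightarrow> 'a) cat \<Rightarrow> ('b gorder, 'b \<Rightarrow> 'b) cat \<Rightarrow> bool" where
  "order_invariant C C' \<longleftrightarrow>
     (\<forall>A A' e. A \<in> obj C \<and> order_iso A A' e \<and> eq A' = (=) \<longrightarrow> A' \<in> obj C') \<and>
     (\<forall>A B A' B' e d f f'. A \<in> obj C \<and> B \<in> obj C \<and> A' \<in> obj C' \<and> B' \<in> obj C' \<and>
        order_iso A A' e \<and> order_iso B B' d \<and>
        f \<in> hom C A B \<and> f' \<in> carrier A' \<rightarrow>\<^sub>E carrier B' \<and> (\<forall>x\<in>carrier A. f' (e x) = d (f x)) \<longrightarrow>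
        f' \<in> hom C' A' B')"

lemma order_invariant_obj:
  "\<lbrakk>order_invariant C C'; A \<in> obj C; order_iso A A' e; eq A' = (=)\<rbrakk> \<Longrightarrow> A' \<in> obj C'"
  unfolding order_invariant_def by blast

lemma order_invariant_hom:
  "\<lbrakk>order_invariant C C'; A \<in> obj C; B \<in> obj C; A' \<in> obj C'; B' \<in> obj C';
     order_iso A A' e; order_iso B B' d; f \<in> hom C A B; f' \<in> carrier A' \<rightarrow>\<^sub>E carrier B';
     \<And>x. x \<in> carrier A \<Longrightarrow> f' (e x) = d (f x)\<rbrakk> \<Longrightarrow> f' \<in> hom C' A' B'"
  unfolding order_invariant_def by blast

lemma order_iso_hom:
  assumes C: "order_category C" and inv: "order_invariant C C"
    and A: "A \<in> obj C" and B: "B \<in> obj C" and e: "order_iso A B e"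
  shows "(\<lambda>x\<in>carrier A. e x) \<in> hom C A B"
proof (rule order_invariant_hom[OF inv A A A B _ e])
  show "order_iso A A id" by (simp add: order_iso_def)
  show "(\<lambda>x\<in>carrier A. x) \<in> hom C A A"
    using category_ide[OF order_category_category[OF C] A] by (simp add: order_category_ide[OF C])
qed (use order_iso_closed[OF e] in auto)

lemma order_iso_lift:
  assumes "inj j"
  shows "order_iso A (on_ob (order_lift j) A) j"
  using assms by (auto simp: order_iso_def order_lift_def bij_betw_def inj_on_def)

lemma order_iso_unlift:
  assumes "inj j"
  shows "order_iso (on_ob (order_lift j) A) A (inv j)"
  using assms by (auto simp: order_iso_def order_lift_def bij_betw_def inj_on_def image_image)

text \<open>Renaming along \<open>j\<close> is an order isomorphism, so invariance gives the action on morphisms, and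
  invariance in the other direction gives fullness.\<close>

lemma fully_faithful_order_lift:
  assumes C: "order_category C" and C': "order_category C'"
    and inv: "order_invariant C C'" "order_invariant C' C" and j: "inj j"
  shows "fully_faithful C C' (order_lift j)"
proof -
  let ?J = "order_lift j"
  have carrier: "carrier (on_ob ?J A) = j ` carrier A" for A by (simp add: order_lift_def)
  have J: "on_hom ?J A B f = (\<lambda>x\<in>j ` carrier A. j (f (inv j x)))" for A B f
    by (simp add: order_lift_def)
  have ob: "on_ob ?J A \<in> obj C'" if "A \<in> obj C" for A
    by (rule order_invariant_obj[OF inv(1) that order_iso_lift[OF j]]) (simp add: order_lift_def)
  have ext: "on_hom ?J A B f \<in> carrier (on_ob ?J A) \<rightarrow>\<^sub>E carrier (on_ob ?J B)"
    if "A \<in> obj C" "B \<in> obj C" "f \<in> hom C A B" for A B f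
    using order_category_hom[OF C that] j by (auto simp: J carrier)
  have hm: "on_hom ?J A B f \<in> hom C' (on_ob ?J A) (on_ob ?J B)"
    if "A \<in> obj C" "B \<in> obj C" "f \<in> hom C A B" for A B f
    by (rule order_invariant_hom[OF inv(1) that(1,2) ob[OF that(1)] ob[OF that(2)]
          order_iso_lift[OF j] order_iso_lift[OF j] that(3) ext[OF that]]) (use j in \<open>auto simp: J\<close>)
  have "is_functor C C' ?J"
    unfolding is_functor_def
  proof (intro conjI ballI)
    show "category C" "category C'" using C C' order_category_category by auto
    fix A assume A: "A \<in> obj C"
    show "on_hom ?J A A (ide C A) = ide C' (on_ob ?J A)"
      unfolding J order_category_ide[OF C] order_category_ide[OF C'] carrier
      by (rule restrict_ext) (use j in auto)
    fix B E f g assume *: "B \<in> obj C" "E \<in> obj C" "f \<in> hom C A B" "g \<in> hom C B E"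
    have "f \<in> carrier A \<rightarrow>\<^sub>E carrier B" using order_category_hom[OF C A] * by blast
    then show "on_hom ?J A E (cmp C A B E g f) =
        cmp C' (on_ob ?J A) (on_ob ?J B) (on_ob ?J E) (on_hom ?J B E g) (on_hom ?J A B f)"
      unfolding J order_category_cmp[OF C] order_category_cmp[OF C'] carrier compose_def
      by (intro restrict_ext) (use j in auto)
  qed (use ob hm in auto)
  moreover have "bij_betw (on_hom ?J A B) (hom C A B) (hom C' (on_ob ?J A) (on_ob ?J B))"
    if A: "A \<in> obj C" and B: "B \<in> obj C" for A B
  proof (rule bij_betw_imageI)
    show "inj_on (on_hom ?J A B) (hom C A B)"
    proof (rule inj_onI)
      fix f g assume fg: "f \<in> hom C A B" "g \<in> hom C A B" and eq: "on_hom ?J A B f = on_hom ?J A B g"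
      have "f x = g x" if "x \<in> carrier A" for x
        using fun_cong[OF eq, of "j x"] that j by (simp add: J inj_eq)
      then show "f = g"
        using PiE_ext[OF order_category_hom[OF C A B fg(1)] order_category_hom[OF C A B fg(2)]] by blast
    qed
    show "on_hom ?J A B ` hom C A B = hom C' (on_ob ?J A) (on_ob ?J B)"
    proof (intro equalityI subsetI)
      fix h assume h: "h \<in> hom C' (on_ob ?J A) (on_ob ?J B)"
      define f where "f = (\<lambda>x\<in>carrier A. inv j (h (j x)))"
      have hE: "h \<in> j ` carrier A \<rightarrow>\<^sub>E j ` carrier B"
        using order_category_hom[OF C' ob[OF A] ob[OF B] h] by (simp add: carrier)
      then have fE: "f \<in> carrier A \<rightarrow>\<^sub>E carrier B"
        unfolding f_def using j by (force simp: PiE_def Pi_iff)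
      have "f \<in> hom C A B"
        by (rule order_invariant_hom[OF inv(2) ob[OF A] ob[OF B] A B order_iso_unlift[OF j]
              order_iso_unlift[OF j] h fE]) (use j in \<open>auto simp: carrier f_def\<close>)
      moreover have "on_hom ?J A B f = h"
      proof
        fix x show "on_hom ?J A B f x = h x"
        proof (cases "x \<in> j ` carrier A")
          case True
          then have "h x \<in> j ` carrier B" using hE by auto
          with True j show ?thesis by (auto simp: J f_def)
        qed (use hE in \<open>auto simp: J\<close>)
      qed
      ultimately show "h \<in> on_hom ?J A B ` hom C A B" by blast
    qed (use hm A B in auto)
  qed
  ultimately show ?thesis by (simp add: fully_faithful_def)
qed

definition natural_order_iso where
  "natural_order_iso C T e \<longleftrightarrow>
     (\<forall>A\<in>obj C. order_iso A (on_ob T A) (e A)) \<and>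
     (\<forall>A\<in>obj C. \<forall>B\<in>obj C. \<forall>f\<in>hom C A B. \<forall>x\<in>carrier A. on_hom T A B f (e A x) = e B (f x))"

lemma
  assumes "natural_order_iso C T e"
  shows natural_order_iso_iso: "A \<in> obj C \<Longrightarrow> order_iso A (on_ob T A) (e A)"
    and natural_order_iso_natural: "\<lbrakk>A \<in> obj C; B \<in> obj C; f \<in> hom C A B; x \<in> carrier A\<rbrakk>
      \<Longrightarrow> on_hom T A B f (e A x) = e B (f x)"
  using assms by (simp_all add: natural_order_iso_def)

text \<open>A natural isomorphism into the lifting functor along \<open>j\<close> amounts to a natural family of order
  isomorphisms between structures over different types; \<open>j\<close> itself drops out.\<close>

lemma naturally_isomorphic_order_lift:
  assumes C: "order_category C" and C': "order_category C'" and inv: "order_invariant C' C'"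
    and J: "is_functor C C' (order_lift j)" and T: "is_functor C C' T" and j: "inj j"
    and e: "natural_order_iso C T e"
  shows "naturally_isomorphic C C' T (order_lift j)"
proof -
  let ?J = "order_lift j"
  define i where "i A = inv_into (carrier A) (e A)" for A
  define \<eta> where "\<eta> A = (\<lambda>y\<in>carrier (on_ob T A). j (i A y))" for A
  define \<theta> where "\<theta> A = (\<lambda>z\<in>j ` carrier A. e A (inv j z))" for A
  have carrier: "carrier (on_ob ?J A) = j ` carrier A" for A by (simp add: order_lift_def)
  have iso: "order_iso A (on_ob T A) (e A)" if "A \<in> obj C" for A
    using e that by (simp add: natural_order_iso_def)
  have e_mem: "e A x \<in> carrier (on_ob T A)" if "A \<in> obj C" "x \<in> carrier A" for A x
    using order_iso_closed[OF iso] that by blast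
  have ie: "i A (e A x) = x" if "A \<in> obj C" "x \<in> carrier A" for A x
    unfolding i_def using order_iso_inj[OF iso] that by simp
  have ei: "e A (i A y) = y" "i A y \<in> carrier A" if "A \<in> obj C" "y \<in> carrier (on_ob T A)" for A y
    unfolding i_def using order_iso_image[OF iso, of A] that by (auto intro: f_inv_into_f inv_into_into)
  have \<eta>: "\<eta> A \<in> hom C' (on_ob T A) (on_ob ?J A)" if A: "A \<in> obj C" for A
  proof -
    have "order_iso (on_ob T A) (on_ob ?J A) (j \<circ> i A)"
      using order_iso_comp[OF order_iso_inverse[OF iso[OF A]] order_iso_lift[OF j]] by (simp add: i_def)
    from order_iso_hom[OF C' inv functor_ob[OF T A] functor_ob[OF J A] this]
    show ?thesis by (simp add: \<eta>_def)
  qed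
  have \<theta>: "\<theta> A \<in> hom C' (on_ob ?J A) (on_ob T A)" if A: "A \<in> obj C" for A
  proof -
    have "order_iso (on_ob ?J A) (on_ob T A) (e A \<circ> inv j)"
      using order_iso_comp[OF order_iso_unlift[OF j] iso[OF A]] .
    from order_iso_hom[OF C' inv functor_ob[OF J A] functor_ob[OF T A] this]
    show ?thesis by (simp add: \<theta>_def carrier)
  qed
  have "inverse_natural_families C C' T ?J \<eta> \<theta>"
    unfolding inverse_natural_families_def
  proof (intro conjI ballI)
    fix A assume A: "A \<in> obj C"
    show "cmp C' (on_ob T A) (on_ob ?J A) (on_ob T A) (\<theta> A) (\<eta> A) = ide C' (on_ob T A)"
      unfolding order_category_cmp[OF C'] order_category_ide[OF C'] compose_def
      by (rule restrict_ext) (use ei[OF A] j in \<open>simp add: \<eta>_def \<theta>_def\<close>)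
    show "cmp C' (on_ob ?J A) (on_ob T A) (on_ob ?J A) (\<eta> A) (\<theta> A) = ide C' (on_ob ?J A)"
      unfolding order_category_cmp[OF C'] order_category_ide[OF C'] compose_def carrier
      by (rule restrict_ext) (use ie[OF A] e_mem[OF A] j in \<open>auto simp: \<eta>_def \<theta>_def\<close>)
    fix B f assume B: "B \<in> obj C" and f: "f \<in> hom C A B"
    have Tf: "on_hom T A B f \<in> carrier (on_ob T A) \<rightarrow>\<^sub>E carrier (on_ob T B)"
      by (rule order_category_hom[OF C' functor_ob[OF T A] functor_ob[OF T B] functor_hom[OF T A B f]])
    have fE: "f \<in> carrier A \<rightarrow>\<^sub>E carrier B" by (rule order_category_hom[OF C A B f])
    have nat: "on_hom T A B f (e A x) = e B (f x)" if "x \<in> carrier A" for x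
      using e A B f that by (simp add: natural_order_iso_def)
    have "\<eta> B (on_hom T A B f y) = on_hom ?J A B f (\<eta> A y)" if y: "y \<in> carrier (on_ob T A)" for y
    proof -
      have "on_hom T A B f y = e B (f (i A y))"
        using nat[of "i A y"] ei[OF A y] by simp
      moreover have "f (i A y) \<in> carrier B" using ei[OF A y] fE by auto
      ultimately show ?thesis
        using y ei[OF A y] j e_mem[OF B] by (simp add: \<eta>_def ie[OF B] order_lift_def)
    qed
    then show "cmp C' (on_ob T A) (on_ob T B) (on_ob ?J B) (\<eta> B) (on_hom T A B f)
        = cmp C' (on_ob T A) (on_ob ?J A) (on_ob ?J B) (on_hom ?J A B f) (\<eta> A)"
      by (auto simp: order_category_cmp[OF C'] compose_def)
  qed (use T J \<eta> \<theta> in auto)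
  then show ?thesis unfolding naturally_isomorphic_iff by blast
qed

subsection \<open>Bounded distributive meet-semilattices\<close>

lemma bdms_simps:
  "obj bdms = {M. bounded_distributive_meet_semilattice M}"
  "hom bdms M N = {\<alpha> \<in> carrier M \<rightarrow>\<^sub>E carrier N.
     (\<forall>a\<in>carrier M. \<forall>b\<in>carrier M. \<alpha> (a \<sqinter>\<^bsub>M\<^esub> b) = \<alpha> a \<sqinter>\<^bsub>N\<^esub> \<alpha> b) \<and> \<alpha> \<top>\<^bsub>M\<^esub> = \<top>\<^bsub>N\<^esub>}"
  "ide bdms M = (\<lambda>x\<in>carrier M. x)" "cmp bdms M N P \<beta> \<alpha> = compose (carrier M) \<beta> \<alpha>"
  by (simp_all add: bdms_def)

locale bounded_distributive_semilattice =
  fixes M :: "'a gorder" (structure)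
  assumes bdms: "bounded_distributive_meet_semilattice M"
begin

sublocale lower_semilattice M
  using bdms by (simp add: bounded_distributive_meet_semilattice_def)

sublocale weak_partial_order_top M
  by unfold_locales (use bdms in \<open>simp add: bounded_distributive_meet_semilattice_def\<close>)

sublocale weak_partial_order_bottom M
  by unfold_locales (use bdms in \<open>simp add: bounded_distributive_meet_semilattice_def\<close>)

lemma distributive:
  assumes "a \<in> carrier M" "b \<in> carrier M" "c \<in> carrier M" "a \<sqinter> b \<sqsubseteq> c"
  obtains a' b' where "a' \<in> carrier M" "b' \<in> carrier M" "a \<sqsubseteq> a'" "b \<sqsubseteq> b'" "a' \<sqinter> b' = c"
  using bdms assms unfolding bounded_distributive_meet_semilattice_def by blast

end

lemma order_category_bdms: "order_category (bdms :: ('a gorder, 'a \<Rightarrow> 'a) cat)"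
proof (rule order_categoryI)
  fix A :: "'a gorder" assume "A \<in> obj bdms"
  then interpret A: bounded_distributive_semilattice A
    by unfold_locales (simp add: bdms_simps)
  show "partial_order A" by unfold_locales
  show "(\<lambda>x\<in>carrier A. x) \<in> hom bdms A A" by (auto simp: bdms_simps)
  fix B D f g assume "f \<in> hom bdms A B" "g \<in> hom bdms B D"
  then show "compose (carrier A) g f \<in> hom bdms A D"
    by (auto simp: bdms_simps compose_def PiE_iff)
qed (auto simp: bdms_simps bdms_def)

lemma order_invariant_bdms: "order_invariant bdms bdms"
  unfolding order_invariant_def
proof (intro conjI allI impI; elim conjE)
  show "A' \<in> obj bdms" if "A \<in> obj bdms" "order_iso A A' e" "eq A' = (=)"
    for A :: "'a gorder" and A' :: "'b gorder" and e
    using bounded_distributive_meet_semilattice_transport that by (auto simp: bdms_simps)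
next
  fix A B :: "'a gorder" and A' B' :: "'b gorder" and e d f f'
  assume ob: "A \<in> obj bdms" "B \<in> obj bdms" "A' \<in> obj bdms" "B' \<in> obj bdms"
    and iso: "order_iso A A' e" "order_iso B B' d" and f: "f \<in> hom bdms A B"
    and f': "f' \<in> carrier A' \<rightarrow>\<^sub>E carrier B'" and nat: "\<forall>x\<in>carrier A. f' (e x) = d (f x)"
  interpret A: bounded_distributive_semilattice A using ob by unfold_locales (simp add: bdms_simps)
  interpret B: bounded_distributive_semilattice B using ob by unfold_locales (simp add: bdms_simps)
  interpret A': bounded_distributive_semilattice A' using ob by unfold_locales (simp add: bdms_simps)
  interpret B': bounded_distributive_semilattice B' using ob by unfold_locales (simp add: bdms_simps)
  interpret e: order_isomorphism A A' e by unfold_locales (use iso A'.eq_is_equal in auto)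
  interpret d: order_isomorphism B B' d by unfold_locales (use iso B'.eq_is_equal in auto)
  have fE: "f \<in> carrier A \<rightarrow> carrier B" and fm: "\<And>a b. a \<in> carrier A \<Longrightarrow> b \<in> carrier A \<Longrightarrow> f (a \<sqinter>\<^bsub>A\<^esub> b) = f a \<sqinter>\<^bsub>B\<^esub> f b"
    and ft: "f \<top>\<^bsub>A\<^esub> = \<top>\<^bsub>B\<^esub>"
    using f by (auto simp: bdms_simps)
  have em: "e (a \<sqinter>\<^bsub>A\<^esub> b) = e a \<sqinter>\<^bsub>A'\<^esub> e b" if "a \<in> carrier A" "b \<in> carrier A" for a b
    using that by (simp add: e.map_meet A.inf_of_two_exists)
  have dm: "d (a \<sqinter>\<^bsub>B\<^esub> b) = d a \<sqinter>\<^bsub>B'\<^esub> d b" if "a \<in> carrier B" "b \<in> carrier B" for a b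
    using that by (simp add: d.map_meet B.inf_of_two_exists)
  have "f' (a' \<sqinter>\<^bsub>A'\<^esub> b') = f' a' \<sqinter>\<^bsub>B'\<^esub> f' b'" if ab: "a' \<in> carrier A'" "b' \<in> carrier A'" for a' b'
  proof -
    obtain a b where *: "a \<in> carrier A" "b \<in> carrier A" "a' = e a" "b' = e b"
      using ab by (auto simp: e.elements)
    have "f' (a' \<sqinter>\<^bsub>A'\<^esub> b') = f' (e (a \<sqinter>\<^bsub>A\<^esub> b))" using * em by simp
    also have "\<dots> = d (f a \<sqinter>\<^bsub>B\<^esub> f b)" using nat * fm by simp
    also have "\<dots> = f' a' \<sqinter>\<^bsub>B'\<^esub> f' b'" using * fE nat by (subst dm) auto
    finally show ?thesis .
  qed
  moreover have "f' \<top>\<^bsub>A'\<^esub> = \<top>\<^bsub>B'\<^esub>"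
    using nat ft e.map_top[OF A.top_exists] d.map_top[OF B.top_exists] by (metis A.top_closed)
  ultimately show "f' \<in> hom bdms A' B'" using f' by (simp add: bdms_simps)
qed

subsection \<open>Compact algebraic frames\<close>

lemma kalgfrm_sup_simps:
  "obj kalgfrm_sup = {L. compact_algebraic_frame L}"
  "hom kalgfrm_sup L M = {\<alpha> \<in> carrier L \<rightarrow>\<^sub>E carrier M.
     (\<forall>S. S \<subseteq> carrier L \<longrightarrow> \<alpha> (\<Squnion>\<^bsub>L\<^esub>S) = \<Squnion>\<^bsub>M\<^esub>(\<alpha> ` S)) \<and>
     \<alpha> ` compact_elements L \<subseteq> compact_elements M}"
  "ide kalgfrm_sup L = (\<lambda>x\<in>carrier L. x)" "cmp kalgfrm_sup L M N \<beta> \<alpha> = compose (carrier L) \<beta> \<alpha>"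
  by (simp_all add: kalgfrm_sup_def)

lemma compact_elements_carrier: "compact_elements L \<subseteq> carrier L"
  by (auto simp: compact_elements_def)

locale compact_frame =
  fixes L :: "'a gorder" (structure)
  assumes frame: "compact_algebraic_frame L"
begin

sublocale complete_lattice L
  using frame by (simp add: compact_algebraic_frame_def)

lemma compact_carrier: "k \<in> compact_elements L \<Longrightarrow> k \<in> carrier L"
  by (simp add: compact_elements_def)

lemma compact_cover:
  assumes "k \<in> compact_elements L" "S \<subseteq> carrier L" "k \<sqsubseteq> \<Squnion>S"
  obtains T where "finite T" "T \<subseteq> S" "k \<sqsubseteq> \<Squnion>T"
  by (rule way_belowE[of L k k S]) (use assms that in \<open>auto simp: compact_elements_def\<close>)

lemma top_compact: "\<top> \<in> compact_elements L"
  using frame by (simp add: compact_algebraic_frame_def)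

lemma meet_Sup: "\<lbrakk>a \<in> carrier L; S \<subseteq> carrier L\<rbrakk> \<Longrightarrow> a \<sqinter> \<Squnion>S = \<Squnion>((\<lambda>s. a \<sqinter> s) ` S)"
  using frame by (simp add: compact_algebraic_frame_def)

lemma Sup_mono:
  assumes "S \<subseteq> carrier L" "T \<subseteq> S"
  shows "\<Squnion>T \<sqsubseteq> \<Squnion>S"
  using assms by (intro sup_least) (auto intro: sup_upper)

lemma bottom_compact: "\<bottom> \<in> compact_elements L"
proof -
  have "way_below L \<bottom> \<bottom>" unfolding way_below_def
    by (intro allI impI exI[of _ "{}"]) auto
  then show ?thesis by (simp add: compact_elements_def)
qed

lemma join_compact:
  assumes k: "k \<in> compact_elements L" and l: "l \<in> compact_elements L"
  shows "k \<squnion> l \<in> compact_elements L"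
proof -
  note c = compact_carrier[OF k] compact_carrier[OF l]
  have "\<exists>T. finite T \<and> T \<subseteq> S \<and> k \<squnion> l \<sqsubseteq> \<Squnion>T" if S: "S \<subseteq> carrier L" "k \<squnion> l \<sqsubseteq> \<Squnion>S" for S
  proof -
    have "k \<sqsubseteq> \<Squnion>S" "l \<sqsubseteq> \<Squnion>S"
      using S c join_left join_right by (meson join_closed le_trans sup_closed)+
    then obtain T U where TU: "finite T" "T \<subseteq> S" "k \<sqsubseteq> \<Squnion>T" "finite U" "U \<subseteq> S" "l \<sqsubseteq> \<Squnion>U"
      using compact_cover[OF k S(1)] compact_cover[OF l S(1)] by metis
    have TUS: "T \<union> U \<subseteq> carrier L" using TU S by blast
    then have "\<Squnion>T \<sqsubseteq> \<Squnion>(T \<union> U)" "\<Squnion>U \<sqsubseteq> \<Squnion>(T \<union> U)" by (auto intro: Sup_mono)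
    then have "k \<squnion> l \<sqsubseteq> \<Squnion>(T \<union> U)"
      using TU TUS c by (intro join_le) (auto intro: le_trans[of k "\<Squnion>T"] le_trans[of l "\<Squnion>U"])
    then show ?thesis using TU by (intro exI[of _ "T \<union> U"]) auto
  qed
  then show ?thesis using c by (auto simp: compact_elements_def way_below_def)
qed

lemma finite_Sup_compact:
  assumes "finite T" "T \<subseteq> compact_elements L"
  shows "\<Squnion>T \<in> compact_elements L"
  using assms
proof (induction T)
  case empty
  have "\<Squnion>{} = \<bottom>" using weak_sup_empty by (simp add: eq_is_equal)
  then show ?case using bottom_compact by simp
next
  case (insert x T)
  have "\<Squnion>(insert x T) = x \<squnion> \<Squnion>T"
    using insert.prems compact_carrier weak_sup_insert[of x T] by (auto simp: eq_is_equal subset_iff)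
  then show ?case using insert join_compact by auto
qed

lemma compacts_below: "a \<in> carrier L \<Longrightarrow> \<Squnion>{k \<in> compact_elements L. k \<sqsubseteq> a} = a"
proof (rule sup_eqI)
  assume a: "a \<in> carrier L"
  then obtain S where S: "S \<subseteq> compact_elements L" "a = \<Squnion>S"
    using frame unfolding compact_algebraic_frame_def by blast
  then have "S \<subseteq> carrier L" using compact_carrier by blast
  then show "a \<sqsubseteq> y" if "y \<in> carrier L" "\<And>x. x \<in> {k \<in> compact_elements L. k \<sqsubseteq> a} \<Longrightarrow> x \<sqsubseteq> y" for y
    using that S sup_upper[of S] by (auto intro!: sup_least)
qed (use compact_carrier in auto)

lemma compact_below:
  assumes "a \<in> carrier L" "b \<in> carrier L" "\<not> a \<sqsubseteq> b"
  shows "\<exists>k\<in>compact_elements L. k \<sqsubseteq> a \<and> \<not> k \<sqsubseteq> b"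
proof -
  have "\<not> \<Squnion>{k \<in> compact_elements L. k \<sqsubseteq> a} \<sqsubseteq> b" using compacts_below assms by simp
  then show ?thesis using sup_least[of "{k \<in> compact_elements L. k \<sqsubseteq> a}" b] assms compact_carrier by blast
qed

text \<open>The compact elements below \<open>p\<close> have join \<open>p\<close>, and joins of finitely many of them are compact.\<close>

lemma way_below_iff_compact:
  assumes a: "a \<in> carrier L" and p: "p \<in> carrier L"
  shows "way_below L a p \<longleftrightarrow> (\<exists>k\<in>compact_elements L. a \<sqsubseteq> k \<and> k \<sqsubseteq> p)"
proof
  let ?S = "{k \<in> compact_elements L. k \<sqsubseteq> p}"
  assume "way_below L a p"
  moreover have "?S \<subseteq> carrier L \<and> p \<sqsubseteq> \<Squnion>?S" using compacts_below[OF p] p compact_carrier by auto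
  ultimately obtain T where T: "finite T" "T \<subseteq> ?S" "a \<sqsubseteq> \<Squnion>T" by (elim conjE way_belowE)
  then have "\<Squnion>T \<in> compact_elements L" by (intro finite_Sup_compact) auto
  moreover have "\<Squnion>T \<sqsubseteq> p" using T p compact_carrier by (intro sup_least) auto
  ultimately show "\<exists>k\<in>compact_elements L. a \<sqsubseteq> k \<and> k \<sqsubseteq> p" using T by blast
next
  assume "\<exists>k\<in>compact_elements L. a \<sqsubseteq> k \<and> k \<sqsubseteq> p"
  then obtain k where k: "k \<in> compact_elements L" "a \<sqsubseteq> k" "k \<sqsubseteq> p" by blast
  show "way_below L a p" unfolding way_below_def
  proof (intro allI impI; elim conjE)
    fix S assume S: "S \<subseteq> carrier L" "p \<sqsubseteq> \<Squnion>S"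
    then have "k \<sqsubseteq> \<Squnion>S" using k p compact_carrier by (meson le_trans sup_closed)
    then obtain T where "finite T" "T \<subseteq> S" "k \<sqsubseteq> \<Squnion>T" using compact_cover k S by metis
    moreover from this have "a \<sqsubseteq> \<Squnion>T"
      using k a S compact_carrier by (meson le_trans sup_closed subset_trans)
    ultimately show "\<exists>T. finite T \<and> T \<subseteq> S \<and> a \<sqsubseteq> \<Squnion>T" by blast
  qed
qed

end

lemma order_category_kalgfrm_sup: "order_category (kalgfrm_sup :: ('a gorder, 'a \<Rightarrow> 'a) cat)"
proof (rule order_categoryI)
  fix A :: "'a gorder" assume "A \<in> obj kalgfrm_sup"
  then interpret A: compact_frame A
    by unfold_locales (simp add: kalgfrm_sup_simps)
  show "partial_order A" by unfold_locales
  show "(\<lambda>x\<in>carrier A. x) \<in> hom kalgfrm_sup A A"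
    using compact_elements_carrier[of A] by (auto simp: kalgfrm_sup_simps subset_iff)
  fix B D :: "'a gorder" and f g assume "B \<in> obj kalgfrm_sup"
    and f: "f \<in> hom kalgfrm_sup A B" and g: "g \<in> hom kalgfrm_sup B D"
  have fS: "compose (carrier A) g f ` S = g ` f ` S" if "S \<subseteq> carrier A" for S
    using that by (auto simp: compose_def image_iff subset_iff)
  have fB: "f ` S \<subseteq> carrier B" if "S \<subseteq> carrier A" for S
    using f that by (auto simp: kalgfrm_sup_simps PiE_iff)
  have fk: "f ` compact_elements A \<subseteq> compact_elements B" and gk: "g ` compact_elements B \<subseteq> compact_elements D"
    and fs: "\<And>S. S \<subseteq> carrier A \<Longrightarrow> f (\<Squnion>\<^bsub>A\<^esub>S) = \<Squnion>\<^bsub>B\<^esub>(f ` S)"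
    and gs: "\<And>S. S \<subseteq> carrier B \<Longrightarrow> g (\<Squnion>\<^bsub>B\<^esub>S) = \<Squnion>\<^bsub>D\<^esub>(g ` S)"
    using f g by (simp_all add: kalgfrm_sup_simps)
  have "compose (carrier A) g f (\<Squnion>\<^bsub>A\<^esub>S) = \<Squnion>\<^bsub>D\<^esub>(compose (carrier A) g f ` S)" if "S \<subseteq> carrier A" for S
    unfolding fS[OF that] compose_eq[OF A.sup_closed[OF that]] fs[OF that] by (rule gs[OF fB[OF that]])
  moreover have "compose (carrier A) g f ` compact_elements A \<subseteq> compact_elements D"
    unfolding fS[OF compact_elements_carrier] using fk gk by blast
  moreover have "compose (carrier A) g f \<in> carrier A \<rightarrow>\<^sub>E carrier D"
    using f g by (auto simp: kalgfrm_sup_simps compose_def PiE_iff)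
  ultimately show "compose (carrier A) g f \<in> hom kalgfrm_sup A D"
    by (simp add: kalgfrm_sup_simps)
qed (auto simp: kalgfrm_sup_simps kalgfrm_sup_def)

lemma order_invariant_kalgfrm_sup: "order_invariant kalgfrm_sup kalgfrm_sup"
  unfolding order_invariant_def
proof (intro conjI allI impI; elim conjE)
  show "A' \<in> obj kalgfrm_sup" if "A \<in> obj kalgfrm_sup" "order_iso A A' e" "eq A' = (=)"
    for A :: "'a gorder" and A' :: "'b gorder" and e
    using compact_algebraic_frame_transport that by (auto simp: kalgfrm_sup_simps)
next
  fix A B :: "'a gorder" and A' B' :: "'b gorder" and e d f f'
  assume ob: "A \<in> obj kalgfrm_sup" "B \<in> obj kalgfrm_sup" "A' \<in> obj kalgfrm_sup" "B' \<in> obj kalgfrm_sup"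
    and iso: "order_iso A A' e" "order_iso B B' d" and f: "f \<in> hom kalgfrm_sup A B"
    and f': "f' \<in> carrier A' \<rightarrow>\<^sub>E carrier B'" and nat: "\<forall>x\<in>carrier A. f' (e x) = d (f x)"
  interpret A: compact_frame A using ob by unfold_locales (simp add: kalgfrm_sup_simps)
  interpret B: compact_frame B using ob by unfold_locales (simp add: kalgfrm_sup_simps)
  interpret A': compact_frame A' using ob by unfold_locales (simp add: kalgfrm_sup_simps)
  interpret B': compact_frame B' using ob by unfold_locales (simp add: kalgfrm_sup_simps)
  interpret e: complete_order_isomorphism A A' e by unfold_locales (use iso A'.eq_is_equal in auto)
  interpret d: complete_order_isomorphism B B' d by unfold_locales (use iso B'.eq_is_equal in auto)
  have fE: "f \<in> carrier A \<rightarrow> carrier B" and fS: "\<And>S. S \<subseteq> carrier A \<Longrightarrow> f (\<Squnion>\<^bsub>A\<^esub>S) = \<Squnion>\<^bsub>B\<^esub>(f ` S)"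
    and fk: "f ` compact_elements A \<subseteq> compact_elements B"
    using f by (auto simp: kalgfrm_sup_simps)
  have "f' (\<Squnion>\<^bsub>A'\<^esub>S') = \<Squnion>\<^bsub>B'\<^esub>(f' ` S')" if S': "S' \<subseteq> carrier A'" for S'
  proof -
    obtain S where S: "S \<subseteq> carrier A" "S' = e ` S" using S' by (rule e.subsets)
    have "f' (\<Squnion>\<^bsub>A'\<^esub>S') = f' (e (\<Squnion>\<^bsub>A\<^esub>S))" using S e.map_Sup by simp
    also have "\<dots> = d (\<Squnion>\<^bsub>B\<^esub>(f ` S))" using nat S fS by simp
    also have "\<dots> = \<Squnion>\<^bsub>B'\<^esub>(d ` f ` S)" using S fE by (intro d.map_Sup) auto
    also have "d ` f ` S = f' ` S'" using nat S by (auto simp: image_iff subset_iff)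
    finally show ?thesis .
  qed
  moreover have "f' ` compact_elements A' \<subseteq> compact_elements B'"
    using nat fk A.compact_carrier by (auto simp: e.compact_elements_target d.compact_elements_target)
  ultimately show "f' \<in> hom kalgfrm_sup A' B'" using f' by (simp add: kalgfrm_sup_simps)
qed


section \<open>Filters\<close>

lemma filter_frame_simps [simp]:
  "carrier (filter_frame M) = mfilters M" "le (filter_frame M) = (\<subseteq>)" "eq (filter_frame M) = (=)"
  by (simp_all add: filter_frame_def)

lemma partial_order_filter_frame: "partial_order (filter_frame M)"
  by (rule partial_orderI) auto

context bounded_distributive_semilattice
begin

lemma
  assumes "G \<in> mfilters M"
  shows filter_carrier: "G \<subseteq> carrier M"
    and filter_up: "\<lbrakk>a \<in> G; b \<in> carrier M; a \<sqsubseteq> b\<rbrakk> \<Longrightarrow> b \<in> G"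
    and filter_meet: "\<lbrakk>a \<in> G; b \<in> G\<rbrakk> \<Longrightarrow> a \<sqinter> b \<in> G"
    and filter_top: "\<top> \<in> G"
proof -
  show "G \<subseteq> carrier M" "\<lbrakk>a \<in> G; b \<in> carrier M; a \<sqsubseteq> b\<rbrakk> \<Longrightarrow> b \<in> G" "\<lbrakk>a \<in> G; b \<in> G\<rbrakk> \<Longrightarrow> a \<sqinter> b \<in> G"
    using assms by (auto simp: mfilters_def)
  obtain a where "a \<in> G" using assms by (auto simp: mfilters_def)
  then show "\<top> \<in> G" using assms by (auto simp: mfilters_def)
qed

lemma filterI:
  assumes "G \<subseteq> carrier M" "\<top> \<in> G" "\<And>a b. \<lbrakk>a \<in> G; b \<in> carrier M; a \<sqsubseteq> b\<rbrakk> \<Longrightarrow> b \<in> G"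
    "\<And>a b. \<lbrakk>a \<in> G; b \<in> G\<rbrakk> \<Longrightarrow> a \<sqinter> b \<in> G"
  shows "G \<in> mfilters M"
  using assms by (auto simp: mfilters_def)

lemma carrier_filter: "carrier M \<in> mfilters M"
  by (rule filterI) auto

lemma Inter_filter:
  assumes "\<G> \<subseteq> mfilters M" "\<G> \<noteq> {}"
  shows "\<Inter>\<G> \<in> mfilters M"
proof (rule filterI)
  have G: "G \<in> mfilters M" if "G \<in> \<G>" for G using assms that by blast
  show "\<Inter>\<G> \<subseteq> carrier M" using assms(2) filter_carrier[OF G] by blast
  show "\<top> \<in> \<Inter>\<G>" using filter_top[OF G] by blast
  show "b \<in> \<Inter>\<G>" if "a \<in> \<Inter>\<G>" "b \<in> carrier M" "a \<sqsubseteq> b" for a b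
    using filter_up[OF G _ that(2,3)] that(1) by blast
  show "a \<sqinter> b \<in> \<Inter>\<G>" if "a \<in> \<Inter>\<G>" "b \<in> \<Inter>\<G>" for a b
    using filter_meet[OF G] that by blast
qed

lemma complete_lattice_filter_frame: "complete_lattice (filter_frame M)"
proof -
  interpret F: partial_order "filter_frame M" by (rule partial_order_filter_frame)
  show ?thesis
  proof (rule F.complete_lattice_criterion1)
    show "\<exists>g. greatest (filter_frame M) g (carrier (filter_frame M))"
      using carrier_filter filter_carrier by (auto simp: greatest_def)
    fix A assume "A \<subseteq> carrier (filter_frame M)" "A \<noteq> {}"
    then have "greatest (filter_frame M) (\<Inter>A) (Lower (filter_frame M) A)"
      using Inter_filter[of A] by (auto simp: greatest_def Lower_def)
    then show "\<exists>i. greatest (filter_frame M) i (Lower (filter_frame M) A)" ..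
  qed
qed

sublocale filters: complete_lattice "filter_frame M"
  by (rule complete_lattice_filter_frame)

lemma filters_meet: "\<lbrakk>G \<in> mfilters M; H \<in> mfilters M\<rbrakk> \<Longrightarrow> G \<sqinter>\<^bsub>filter_frame M\<^esub> H = G \<inter> H"
  using Inter_filter[of "{G, H}"] by (intro filters.meet_eqI) auto

lemma filters_top: "\<top>\<^bsub>filter_frame M\<^esub> = carrier M"
  using carrier_filter filter_carrier by (intro filters.top_eqI) auto

lemma Sup_filter: "\<S> \<subseteq> mfilters M \<Longrightarrow> \<Squnion>\<^bsub>filter_frame M\<^esub>\<S> \<in> mfilters M"
  using filters.sup_closed by simp

lemma Sup_filter_upper: "\<lbrakk>\<S> \<subseteq> mfilters M; G \<in> \<S>\<rbrakk> \<Longrightarrow> G \<subseteq> \<Squnion>\<^bsub>filter_frame M\<^esub>\<S>"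
  using filters.sup_upper by simp

lemma Sup_filter_least:
  "\<lbrakk>\<S> \<subseteq> mfilters M; H \<in> mfilters M; \<And>G. G \<in> \<S> \<Longrightarrow> G \<subseteq> H\<rbrakk> \<Longrightarrow> \<Squnion>\<^bsub>filter_frame M\<^esub>\<S> \<subseteq> H"
  using filters.sup_least by simp

lemma up_set_filter: "a \<in> carrier M \<Longrightarrow> up_set M a \<in> mfilters M"
  by (rule filterI) (auto simp: up_set_def intro: le_trans meet_le)

lemma up_set_subset_iff: "\<lbrakk>a \<in> carrier M; G \<in> mfilters M\<rbrakk> \<Longrightarrow> up_set M a \<subseteq> G \<longleftrightarrow> a \<in> G"
  using filter_up by (auto simp: up_set_def)

lemma filter_contains_lower_bound:
  assumes G: "G \<in> mfilters M" and "finite A" "A \<subseteq> G"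
  shows "\<exists>c\<in>G. \<forall>a\<in>A. c \<sqsubseteq> a"
  using assms(2,3)
proof (induction A)
  case empty
  then show ?case using filter_top[OF G] by blast
next
  case (insert x A)
  then obtain c where c: "c \<in> G" "\<forall>a\<in>A. c \<sqsubseteq> a" by blast
  have "x \<in> carrier M" "c \<in> carrier M" "A \<subseteq> carrier M" using insert c filter_carrier[OF G] by auto
  then have "\<forall>a\<in>insert x A. x \<sqinter> c \<sqsubseteq> a" using c by (auto simp: meet_left intro: le_trans[of _ c] meet_right)
  then show ?case using c insert.prems filter_meet[OF G] by blast
qed

text \<open>The elements that lie in the join of finitely many members of \<open>\<S>\<close> form a filter.\<close>

lemma Sup_filter_finite:
  assumes S: "\<S> \<subseteq> mfilters M" and a: "a \<in> \<Squnion>\<^bsub>filter_frame M\<^esub>\<S>"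
  shows "\<exists>\<T>. finite \<T> \<and> \<T> \<subseteq> \<S> \<and> a \<in> \<Squnion>\<^bsub>filter_frame M\<^esub>\<T>"
proof -
  let ?J = "\<lambda>\<T>. \<Squnion>\<^bsub>filter_frame M\<^esub>\<T>"
  define H where "H = {b. \<exists>\<T>. finite \<T> \<and> \<T> \<subseteq> \<S> \<and> b \<in> ?J \<T>}"
  have J: "?J \<T> \<in> mfilters M" if "\<T> \<subseteq> \<S>" for \<T> using that S Sup_filter by blast
  have mono: "?J \<T> \<subseteq> ?J \<U>" if "\<T> \<subseteq> \<U>" "\<U> \<subseteq> \<S>" for \<T> \<U>
  proof (rule Sup_filter_least)
    show "G \<subseteq> ?J \<U>" if "G \<in> \<T>" for G
      using that \<open>\<T> \<subseteq> \<U>\<close> \<open>\<U> \<subseteq> \<S>\<close> S by (intro Sup_filter_upper) auto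
  qed (use that S J in auto)
  have "H \<in> mfilters M"
  proof (rule filterI)
    show "H \<subseteq> carrier M" using J filter_carrier by (auto simp: H_def)
    show "\<top> \<in> H" unfolding H_def using filter_top[OF J[of "{}"]] by blast
    show "b \<in> H" if "a \<in> H" "b \<in> carrier M" "a \<sqsubseteq> b" for a b
      using that filter_up[OF J] unfolding H_def by blast
    fix a b assume "a \<in> H" "b \<in> H"
    then obtain \<T> \<U> where *: "finite \<T>" "\<T> \<subseteq> \<S>" "a \<in> ?J \<T>" "finite \<U>" "\<U> \<subseteq> \<S>" "b \<in> ?J \<U>"
      unfolding H_def by blast
    then have "a \<in> ?J (\<T> \<union> \<U>)" "b \<in> ?J (\<T> \<union> \<U>)" using mono[of _ "\<T> \<union> \<U>"] by blast+
    then have "a \<sqinter> b \<in> ?J (\<T> \<union> \<U>)" using filter_meet[OF J] * by blast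
    then show "a \<sqinter> b \<in> H" unfolding H_def using * by blast
  qed
  moreover have "G \<subseteq> H" if "G \<in> \<S>" for G
    using that S Sup_filter_upper[of "{G}" G] unfolding H_def by (auto intro!: exI[of _ "{G}"])
  ultimately have "?J \<S> \<subseteq> H" using S by (intro Sup_filter_least)
  then show ?thesis using a unfolding H_def by blast
qed

text \<open>A compact filter lies in the join of finitely many principal filters generated by its elements;
  a lower bound of the generators inside the filter then generates it.\<close>

lemma compact_elements_filter_frame: "compact_elements (filter_frame M) = up_set M ` carrier M"
proof (intro subset_antisym subsetI)
  fix G assume "G \<in> compact_elements (filter_frame M)"
  then have G: "G \<in> mfilters M" and w: "way_below (filter_frame M) G G"
    by (auto simp: compact_elements_def)
  have S: "up_set M ` G \<subseteq> mfilters M" using filter_carrier[OF G] up_set_filter by blast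
  have "G \<subseteq> \<Squnion>\<^bsub>filter_frame M\<^esub>(up_set M ` G)"
  proof
    fix a assume a: "a \<in> G"
    then have "up_set M a \<subseteq> \<Squnion>\<^bsub>filter_frame M\<^esub>(up_set M ` G)"
      by (intro Sup_filter_upper[OF S]) blast
    then show "a \<in> \<Squnion>\<^bsub>filter_frame M\<^esub>(up_set M ` G)"
      using a filter_carrier[OF G] up_set_subset_iff[OF _ Sup_filter[OF S]] by blast
  qed
  with w S obtain \<T> where T: "finite \<T>" "\<T> \<subseteq> up_set M ` G" "G \<subseteq> \<Squnion>\<^bsub>filter_frame M\<^esub>\<T>"
    by (elim way_belowE[where S = "up_set M ` G"]) simp_all
  obtain A where A: "finite A" "A \<subseteq> G" "\<T> = up_set M ` A"
    using finite_subset_image[OF T(1,2)] by blast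
  obtain c where c: "c \<in> G" "\<forall>a\<in>A. c \<sqsubseteq> a"
    using filter_contains_lower_bound[OF G A(1,2)] by blast
  have cM: "c \<in> carrier M" using c filter_carrier[OF G] by blast
  have "\<Squnion>\<^bsub>filter_frame M\<^esub>\<T> \<subseteq> up_set M c"
  proof (rule Sup_filter_least)
    show "H \<subseteq> up_set M c" if H: "H \<in> \<T>" for H
    proof -
      obtain x where "x \<in> A" "H = up_set M x" using H A by blast
      then show ?thesis
        using A c cM filter_carrier[OF G] le_trans[of c x] by (auto simp: up_set_def subset_iff)
    qed
  qed (use S T(2) up_set_filter[OF cM] in auto)
  then have "G = up_set M c" using T(3) c up_set_subset_iff[OF cM G] by blast
  then show "G \<in> up_set M ` carrier M" using cM by blast
next
  fix G assume "G \<in> up_set M ` carrier M"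
  then obtain a where a: "a \<in> carrier M" "G = up_set M a" by blast
  have "\<exists>\<T>. finite \<T> \<and> \<T> \<subseteq> \<S> \<and> G \<subseteq> \<Squnion>\<^bsub>filter_frame M\<^esub>\<T>"
    if S: "\<S> \<subseteq> mfilters M" "G \<subseteq> \<Squnion>\<^bsub>filter_frame M\<^esub>\<S>" for \<S>
  proof -
    have "a \<in> \<Squnion>\<^bsub>filter_frame M\<^esub>\<S>" using S a by (auto simp: up_set_def)
    from Sup_filter_finite[OF S(1) this] obtain \<T> where
      T: "finite \<T>" "\<T> \<subseteq> \<S>" "a \<in> \<Squnion>\<^bsub>filter_frame M\<^esub>\<T>" by blast
    then have "G \<subseteq> \<Squnion>\<^bsub>filter_frame M\<^esub>\<T>"
      using a S up_set_subset_iff[OF a(1) Sup_filter[of \<T>]] by blast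
    with T show ?thesis by blast
  qed
  then show "G \<in> compact_elements (filter_frame M)"
    using a up_set_filter by (auto simp: compact_elements_def way_below_def)
qed

text \<open>Distributivity of \<open>M\<close> enters only here. Given \<open>G\<close> and the join \<open>N\<close> of the filters \<open>G \<inter> H\<close>, the
  elements all of whose upper bounds in \<open>G\<close> lie in \<open>N\<close> form a filter: an upper bound of \<open>a \<sqinter> b\<close> is
  a meet of upper bounds of \<open>a\<close> and \<open>b\<close>, which again lie in \<open>G\<close>.\<close>

lemma filter_frame_distrib:
  assumes G: "G \<in> mfilters M" and S: "\<S> \<subseteq> mfilters M"
  shows "G \<inter> \<Squnion>\<^bsub>filter_frame M\<^esub>\<S> = \<Squnion>\<^bsub>filter_frame M\<^esub>((\<inter>) G ` \<S>)"
proof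
  let ?N = "\<Squnion>\<^bsub>filter_frame M\<^esub>((\<inter>) G ` \<S>)"
  have GS: "(\<inter>) G ` \<S> \<subseteq> mfilters M" using Inter_filter[of "{G, _}"] G S by auto
  note N = Sup_filter[OF GS]
  show "?N \<subseteq> G \<inter> \<Squnion>\<^bsub>filter_frame M\<^esub>\<S>"
    using GS S Sup_filter_upper[OF S] Inter_filter[of "{G, \<Squnion>\<^bsub>filter_frame M\<^esub>\<S>}"] G Sup_filter[OF S]
    by (intro Sup_filter_least) auto
  define H where "H = {y \<in> carrier M. \<forall>x\<in>G. y \<sqsubseteq> x \<longrightarrow> x \<in> ?N}"
  have "H \<in> mfilters M"
  proof (rule filterI)
    show "\<top> \<in> H"
    proof -
      have "x \<in> ?N" if "x \<in> G" "\<top> \<sqsubseteq> x" for x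
        using that filter_top[OF N] filter_up[OF N] filter_carrier[OF G] by blast
      then show ?thesis by (simp add: H_def)
    qed
    show "b \<in> H" if "a \<in> H" "b \<in> carrier M" "a \<sqsubseteq> b" for a b
      using that filter_carrier[OF G] le_trans[of a b] unfolding H_def by blast
    fix a b assume a: "a \<in> H" and b: "b \<in> H"
    have aM: "a \<in> carrier M" "b \<in> carrier M" using a b by (auto simp: H_def)
    have "x \<in> ?N" if x: "x \<in> G" "a \<sqinter> b \<sqsubseteq> x" for x
    proof -
      have xM: "x \<in> carrier M" using x filter_carrier[OF G] by blast
      obtain a' b' where ab: "a' \<in> carrier M" "b' \<in> carrier M" "a \<sqsubseteq> a'" "b \<sqsubseteq> b'" "a' \<sqinter> b' = x"
        using distributive[OF aM xM x(2)] by blast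
      then have "x \<sqsubseteq> a'" "x \<sqsubseteq> b'" using meet_left meet_right by blast+
      then have "a' \<in> G" "b' \<in> G" using filter_up[OF G x(1)] ab by auto
      then have "a' \<in> ?N" "b' \<in> ?N" using a b ab unfolding H_def by blast+
      then show ?thesis using filter_meet[OF N] ab by blast
    qed
    then show "a \<sqinter> b \<in> H" using aM by (simp add: H_def)
  qed (auto simp: H_def)
  moreover have "F \<subseteq> H" if F: "F \<in> \<S>" for F
  proof
    fix y assume y: "y \<in> F"
    have FM: "F \<in> mfilters M" using F S by blast
    have "x \<in> ?N" if "x \<in> G" "y \<sqsubseteq> x" for x
    proof -
      have "x \<in> G \<inter> F" using that filter_up[OF FM y] filter_carrier[OF G] by blast
      moreover have "G \<inter> F \<subseteq> ?N" using F by (intro Sup_filter_upper[OF GS]) blast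
      ultimately show ?thesis by blast
    qed
    then show "y \<in> H" using y filter_carrier[OF FM] unfolding H_def by blast
  qed
  ultimately have "\<Squnion>\<^bsub>filter_frame M\<^esub>\<S> \<subseteq> H" using S by (intro Sup_filter_least)
  then show "G \<inter> \<Squnion>\<^bsub>filter_frame M\<^esub>\<S> \<subseteq> ?N"
    using filter_carrier[OF G] unfolding H_def by blast
qed

lemma compact_algebraic_frame_filter_frame: "compact_algebraic_frame (filter_frame M)"
  unfolding compact_algebraic_frame_def
proof (intro conjI ballI allI impI)
  show "complete_lattice (filter_frame M)" by (rule complete_lattice_filter_frame)
  have "carrier M = up_set M \<bottom>" by (auto simp: up_set_def)
  then show "\<top>\<^bsub>filter_frame M\<^esub> \<in> compact_elements (filter_frame M)"
    unfolding filters_top compact_elements_filter_frame by blast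
  fix G assume "G \<in> carrier (filter_frame M)"
  then have G: "G \<in> mfilters M" by simp
  show "\<exists>S. S \<subseteq> compact_elements (filter_frame M) \<and> G = \<Squnion>\<^bsub>filter_frame M\<^esub>S"
  proof (intro exI conjI)
    show "up_set M ` G \<subseteq> compact_elements (filter_frame M)"
      unfolding compact_elements_filter_frame using filter_carrier[OF G] by blast
    have S: "up_set M ` G \<subseteq> mfilters M" using filter_carrier[OF G] up_set_filter by blast
    show "G = \<Squnion>\<^bsub>filter_frame M\<^esub>(up_set M ` G)"
    proof (rule filters.sup_eqI[symmetric])
      fix H assume H: "H \<in> carrier (filter_frame M)"
        "\<And>x. x \<in> up_set M ` G \<Longrightarrow> x \<sqsubseteq>\<^bsub>filter_frame M\<^esub> H"
      have "a \<in> H" if "a \<in> G" for a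
        using H up_set_subset_iff[of a H] that filter_carrier[OF G] by auto
      then show "G \<sqsubseteq>\<^bsub>filter_frame M\<^esub> H" by auto
    next
      show "K \<sqsubseteq>\<^bsub>filter_frame M\<^esub> G" if K: "K \<in> up_set M ` G" for K
      proof -
        obtain x where "x \<in> G" "K = up_set M x" using K by blast
        then show ?thesis using up_set_subset_iff[of x G] G filter_carrier[OF G] by auto
      qed
    qed (use G S in auto)
  qed
  fix S assume "S \<subseteq> carrier (filter_frame M)"
  then have S: "S \<subseteq> mfilters M" by simp
  have "(\<lambda>H. G \<sqinter>\<^bsub>filter_frame M\<^esub> H) ` S = (\<inter>) G ` S"
    using S filters_meet[OF G] by (intro image_cong) auto
  then show "G \<sqinter>\<^bsub>filter_frame M\<^esub> \<Squnion>\<^bsub>filter_frame M\<^esub>S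
      = \<Squnion>\<^bsub>filter_frame M\<^esub>((\<lambda>H. G \<sqinter>\<^bsub>filter_frame M\<^esub> H) ` S)"
    using filters_meet[OF G Sup_filter[OF S]] filter_frame_distrib[OF G S] by simp
qed

end

lemma functor_F_simps [simp]:
  "on_ob functor_F M = filter_frame M"
  "on_hom functor_F M N \<alpha> = (\<lambda>G\<in>mfilters M. {b \<in> carrier N. \<exists>a\<in>G. \<alpha> a \<sqsubseteq>\<^bsub>N\<^esub> b})"
  by (simp_all add: functor_F_def)

locale bdms_morphism = M: bounded_distributive_semilattice M + N: bounded_distributive_semilattice N
  for M N :: "'a gorder" and \<alpha> :: "'a \<Rightarrow> 'a" +
  assumes hom: "\<alpha> \<in> hom bdms M N"
begin

lemma closed: "a \<in> carrier M \<Longrightarrow> \<alpha> a \<in> carrier N"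
  and meet: "\<lbrakk>a \<in> carrier M; b \<in> carrier M\<rbrakk> \<Longrightarrow> \<alpha> (a \<sqinter>\<^bsub>M\<^esub> b) = \<alpha> a \<sqinter>\<^bsub>N\<^esub> \<alpha> b"
  and top: "\<alpha> \<top>\<^bsub>M\<^esub> = \<top>\<^bsub>N\<^esub>"
  using hom by (auto simp: bdms_simps)

lemma mono: "\<lbrakk>a \<in> carrier M; b \<in> carrier M; a \<sqsubseteq>\<^bsub>M\<^esub> b\<rbrakk> \<Longrightarrow> \<alpha> a \<sqsubseteq>\<^bsub>N\<^esub> \<alpha> b"
proof -
  assume *: "a \<in> carrier M" "b \<in> carrier M" "a \<sqsubseteq>\<^bsub>M\<^esub> b"
  then have "a \<sqinter>\<^bsub>M\<^esub> b = a" by (intro M.meet_eqI) auto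
  then show ?thesis using meet[OF *(1,2)] N.meet_right[of "\<alpha> a" "\<alpha> b"] closed * by simp
qed

abbreviation extend where "extend G \<equiv> {b \<in> carrier N. \<exists>a\<in>G. \<alpha> a \<sqsubseteq>\<^bsub>N\<^esub> b}"

lemma extend_filter:
  assumes G: "G \<in> mfilters M"
  shows "extend G \<in> mfilters N"
proof (rule N.filterI)
  show "\<top>\<^bsub>N\<^esub> \<in> extend G" using M.filter_top[OF G] by (auto intro!: bexI[of _ "\<top>\<^bsub>M\<^esub>"] simp: top)
  show "d \<in> extend G" if c: "c \<in> extend G" and d: "d \<in> carrier N" "c \<sqsubseteq>\<^bsub>N\<^esub> d" for c d
  proof -
    obtain a where "a \<in> G" "\<alpha> a \<sqsubseteq>\<^bsub>N\<^esub> c" "c \<in> carrier N" using c by blast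
    then show ?thesis
      using d N.le_trans[of "\<alpha> a" c d] closed[of a] M.filter_carrier[OF G] by blast
  qed
  fix c d assume "c \<in> extend G" "d \<in> extend G"
  then obtain a b where ab: "a \<in> G" "b \<in> G" "\<alpha> a \<sqsubseteq>\<^bsub>N\<^esub> c" "\<alpha> b \<sqsubseteq>\<^bsub>N\<^esub> d" "c \<in> carrier N" "d \<in> carrier N" by blast
  have c: "a \<in> carrier M" "b \<in> carrier M" using ab M.filter_carrier[OF G] by auto
  have "\<alpha> (a \<sqinter>\<^bsub>M\<^esub> b) \<sqsubseteq>\<^bsub>N\<^esub> c"
    by (rule N.le_trans[of _ "\<alpha> a"]) (use ab c closed mono[of "a \<sqinter>\<^bsub>M\<^esub> b" a] M.meet_left in simp_all)
  moreover have "\<alpha> (a \<sqinter>\<^bsub>M\<^esub> b) \<sqsubseteq>\<^bsub>N\<^esub> d"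
    by (rule N.le_trans[of _ "\<alpha> b"]) (use ab c closed mono[of "a \<sqinter>\<^bsub>M\<^esub> b" b] M.meet_right in simp_all)
  ultimately have "\<alpha> (a \<sqinter>\<^bsub>M\<^esub> b) \<sqsubseteq>\<^bsub>N\<^esub> c \<sqinter>\<^bsub>N\<^esub> d" using c ab closed by (intro N.meet_le) auto
  then show "c \<sqinter>\<^bsub>N\<^esub> d \<in> extend G" using ab M.filter_meet[OF G ab(1,2)] by auto
qed auto

lemma extend_up_set:
  assumes a: "a \<in> carrier M"
  shows "extend (up_set M a) = up_set N (\<alpha> a)"
proof (intro subset_antisym subsetI)
  fix b assume "b \<in> extend (up_set M a)"
  then obtain c where c: "b \<in> carrier N" "c \<in> carrier M" "a \<sqsubseteq>\<^bsub>M\<^esub> c" "\<alpha> c \<sqsubseteq>\<^bsub>N\<^esub> b" by (auto simp: up_set_def)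
  then have "\<alpha> a \<sqsubseteq>\<^bsub>N\<^esub> b" using N.le_trans[of "\<alpha> a" "\<alpha> c" b] mono[of a c] a closed by blast
  with c show "b \<in> up_set N (\<alpha> a)" by (simp add: up_set_def)
qed (use a in \<open>auto simp: up_set_def\<close>)

lemma subset_extend: "G \<in> mfilters M \<Longrightarrow> a \<in> G \<Longrightarrow> \<alpha> a \<in> extend G"
  using closed[of a] M.filter_carrier[of G] N.le_refl[of "\<alpha> a"] by blast

text \<open>The elements that \<open>\<alpha>\<close> maps into the join on the right form a filter.\<close>

lemma extend_Sup:
  assumes S: "\<S> \<subseteq> mfilters M"
  shows "extend (\<Squnion>\<^bsub>filter_frame M\<^esub>\<S>) = \<Squnion>\<^bsub>filter_frame N\<^esub>(extend ` \<S>)"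
proof
  let ?N = "\<Squnion>\<^bsub>filter_frame N\<^esub>(extend ` \<S>)"
  have ES: "extend ` \<S> \<subseteq> mfilters N" using S extend_filter by blast
  note N = N.Sup_filter[OF ES]
  show "?N \<subseteq> extend (\<Squnion>\<^bsub>filter_frame M\<^esub>\<S>)"
    using M.Sup_filter_upper[OF S] extend_filter[OF M.Sup_filter[OF S]]
    by (intro N.Sup_filter_least[OF ES]) blast+
  have "{a \<in> carrier M. \<alpha> a \<in> ?N} \<in> mfilters M"
  proof (rule M.filterI)
    show "b \<in> {a \<in> carrier M. \<alpha> a \<in> ?N}" if "a \<in> {a \<in> carrier M. \<alpha> a \<in> ?N}" "b \<in> carrier M" "a \<sqsubseteq>\<^bsub>M\<^esub> b" for a b
      using N.filter_up[OF N, of "\<alpha> a" "\<alpha> b"] mono[of a b] closed that by simp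
    show "a \<sqinter>\<^bsub>M\<^esub> b \<in> {a \<in> carrier M. \<alpha> a \<in> ?N}"
      if "a \<in> {a \<in> carrier M. \<alpha> a \<in> ?N}" "b \<in> {a \<in> carrier M. \<alpha> a \<in> ?N}" for a b
      using N.filter_meet[OF N, of "\<alpha> a" "\<alpha> b"] meet[of a b] that by simp
  qed (use N.filter_top[OF N] top in auto)
  moreover have "G \<subseteq> {a \<in> carrier M. \<alpha> a \<in> ?N}" if "G \<in> \<S>" for G
    using that S N.Sup_filter_upper[OF ES, of "extend G"] subset_extend M.filter_carrier by blast
  ultimately have "\<Squnion>\<^bsub>filter_frame M\<^esub>\<S> \<subseteq> {a \<in> carrier M. \<alpha> a \<in> ?N}"
    using S by (intro M.Sup_filter_least)
  then show "extend (\<Squnion>\<^bsub>filter_frame M\<^esub>\<S>) \<subseteq> ?N" using N.filter_up[OF N] by blast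
qed

lemma functor_F_hom: "on_hom functor_F M N \<alpha> \<in> hom kalgfrm_sup (filter_frame M) (filter_frame N)"
proof -
  have "on_hom functor_F M N \<alpha> ` compact_elements (filter_frame M) \<subseteq> compact_elements (filter_frame N)"
    unfolding M.compact_elements_filter_frame N.compact_elements_filter_frame
    using extend_up_set M.up_set_filter closed by auto
  moreover have "on_hom functor_F M N \<alpha> (\<Squnion>\<^bsub>filter_frame M\<^esub>S)
      = \<Squnion>\<^bsub>filter_frame N\<^esub>(on_hom functor_F M N \<alpha> ` S)" if S: "S \<subseteq> mfilters M" for S
  proof -
    have "on_hom functor_F M N \<alpha> ` S = extend ` S" using S by (intro image_cong) auto
    then show ?thesis using extend_Sup[OF S] M.Sup_filter[OF S] by simp
  qed
  ultimately show ?thesis using extend_filter by (auto simp: kalgfrm_sup_simps)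
qed

lemma functor_F_top_iff:
  "on_hom functor_F M N \<alpha> \<top>\<^bsub>filter_frame M\<^esub> = \<top>\<^bsub>filter_frame N\<^esub> \<longleftrightarrow> \<alpha> \<bottom>\<^bsub>M\<^esub> = \<bottom>\<^bsub>N\<^esub>"
proof
  assume "on_hom functor_F M N \<alpha> \<top>\<^bsub>filter_frame M\<^esub> = \<top>\<^bsub>filter_frame N\<^esub>"
  then have "extend (carrier M) = carrier N"
    by (simp add: M.filters_top N.filters_top M.carrier_filter)
  then obtain a where a: "a \<in> carrier M" "\<alpha> a \<sqsubseteq>\<^bsub>N\<^esub> \<bottom>\<^bsub>N\<^esub>" using N.bottom_closed by blast
  then have "\<alpha> \<bottom>\<^bsub>M\<^esub> \<sqsubseteq>\<^bsub>N\<^esub> \<bottom>\<^bsub>N\<^esub>" using mono[of "\<bottom>\<^bsub>M\<^esub>" a] closed by (auto intro: N.le_trans[of _ "\<alpha> a"])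
  then show "\<alpha> \<bottom>\<^bsub>M\<^esub> = \<bottom>\<^bsub>N\<^esub>" using closed by (auto intro: N.le_antisym)
next
  assume "\<alpha> \<bottom>\<^bsub>M\<^esub> = \<bottom>\<^bsub>N\<^esub>"
  then have "extend (carrier M) = carrier N"
    by (auto intro!: bexI[of _ "\<bottom>\<^bsub>M\<^esub>"])
  then show "on_hom functor_F M N \<alpha> \<top>\<^bsub>filter_frame M\<^esub> = \<top>\<^bsub>filter_frame N\<^esub>"
    by (simp add: M.filters_top N.filters_top M.carrier_filter)
qed

end

lemma bdms_obj: "M \<in> obj bdms \<longleftrightarrow> bounded_distributive_semilattice M"
  by (simp add: bdms_simps bounded_distributive_semilattice_def)

lemma kalgfrm_sup_obj: "L \<in> obj kalgfrm_sup \<longleftrightarrow> compact_frame L"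
  by (simp add: kalgfrm_sup_simps compact_frame_def)

lemma bdms_morphismI:
  "\<lbrakk>M \<in> obj bdms; N \<in> obj bdms; \<alpha> \<in> hom bdms M N\<rbrakk> \<Longrightarrow> bdms_morphism M N \<alpha>"
  by (simp add: bdms_morphism_def bdms_morphism_axioms_def bdms_obj)

lemma is_functor_F: "is_functor bdms kalgfrm_sup functor_F"
  unfolding is_functor_def
proof (intro conjI ballI)
  show "category bdms" "category kalgfrm_sup"
    using order_category_category order_category_bdms order_category_kalgfrm_sup by auto
  fix M :: "'a gorder" assume M: "M \<in> obj bdms"
  then interpret M: bounded_distributive_semilattice M by (simp add: bdms_obj)
  show "on_ob functor_F M \<in> obj kalgfrm_sup"
    using M.compact_algebraic_frame_filter_frame by (simp add: kalgfrm_sup_simps)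
  show "on_hom functor_F M M (ide bdms M) = ide kalgfrm_sup (on_ob functor_F M)"
    unfolding functor_F_simps kalgfrm_sup_simps filter_frame_simps
  proof (rule restrict_ext)
    fix G assume G: "G \<in> mfilters M"
    show "{b \<in> carrier M. \<exists>a\<in>G. ide bdms M a \<sqsubseteq>\<^bsub>M\<^esub> b} = G"
    proof -
      have "ide bdms M a = a" if "a \<in> G" for a
        using that M.filter_carrier[OF G] by (auto simp: bdms_simps)
      then have "{b \<in> carrier M. \<exists>a\<in>G. ide bdms M a \<sqsubseteq>\<^bsub>M\<^esub> b} = {b \<in> carrier M. \<exists>a\<in>G. a \<sqsubseteq>\<^bsub>M\<^esub> b}"
        by simp
      also have "\<dots> = G"
        using M.filter_carrier[OF G] M.filter_up[OF G] M.le_refl by blast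
      finally show ?thesis .
    qed
  qed
  fix N \<alpha> assume N: "N \<in> obj bdms" and \<alpha>: "\<alpha> \<in> hom bdms M N"
  interpret \<alpha>: bdms_morphism M N \<alpha> using M N \<alpha> by (rule bdms_morphismI)
  show "on_hom functor_F M N \<alpha> \<in> hom kalgfrm_sup (on_ob functor_F M) (on_ob functor_F N)"
    using \<alpha>.functor_F_hom by simp
  fix P \<beta> assume P: "P \<in> obj bdms" and \<beta>: "\<beta> \<in> hom bdms N P"
  interpret \<beta>: bdms_morphism N P \<beta> using N P \<beta> by (rule bdms_morphismI)
  show "on_hom functor_F M P (cmp bdms M N P \<beta> \<alpha>)
      = cmp kalgfrm_sup (on_ob functor_F M) (on_ob functor_F N) (on_ob functor_F P)
          (on_hom functor_F N P \<beta>) (on_hom functor_F M N \<alpha>)"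
    unfolding functor_F_simps kalgfrm_sup_simps filter_frame_simps compose_def
  proof (rule restrict_ext)
    fix G assume G: "G \<in> mfilters M"
    have "{b \<in> carrier P. \<exists>a\<in>G. cmp bdms M N P \<beta> \<alpha> a \<sqsubseteq>\<^bsub>P\<^esub> b} = \<beta>.extend (\<alpha>.extend G)"
    proof (intro subset_antisym subsetI)
      fix b assume "b \<in> {b \<in> carrier P. \<exists>a\<in>G. cmp bdms M N P \<beta> \<alpha> a \<sqsubseteq>\<^bsub>P\<^esub> b}"
      then obtain a where a: "b \<in> carrier P" "a \<in> G" "cmp bdms M N P \<beta> \<alpha> a \<sqsubseteq>\<^bsub>P\<^esub> b" by blast
      then have "\<beta> (\<alpha> a) \<sqsubseteq>\<^bsub>P\<^esub> b" "\<alpha> a \<in> \<alpha>.extend G"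
        using M.filter_carrier[OF G] \<alpha>.subset_extend[OF G] by (auto simp: bdms_simps compose_def split: if_splits)
      with a show "b \<in> \<beta>.extend (\<alpha>.extend G)" by blast
    next
      fix b assume "b \<in> \<beta>.extend (\<alpha>.extend G)"
      then obtain c a where *: "b \<in> carrier P" "c \<in> carrier N" "\<beta> c \<sqsubseteq>\<^bsub>P\<^esub> b" "a \<in> G" "\<alpha> a \<sqsubseteq>\<^bsub>N\<^esub> c" by blast
      then have a: "a \<in> carrier M" using M.filter_carrier[OF G] by blast
      then have "\<beta> (\<alpha> a) \<sqsubseteq>\<^bsub>P\<^esub> b"
        using * \<beta>.mono[of "\<alpha> a" c] \<alpha>.closed \<beta>.closed by (auto intro: \<beta>.N.le_trans[of _ "\<beta> c"])
      then show "b \<in> {b \<in> carrier P. \<exists>a\<in>G. cmp bdms M N P \<beta> \<alpha> a \<sqsubseteq>\<^bsub>P\<^esub> b}"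
        using * a by (auto simp: bdms_simps compose_def)
    qed
    then show "{b \<in> carrier P. \<exists>a\<in>G. cmp bdms M N P \<beta> \<alpha> a \<sqsubseteq>\<^bsub>P\<^esub> b}
        = (\<lambda>G\<in>mfilters N. \<beta>.extend G) ((\<lambda>G\<in>mfilters M. \<alpha>.extend G) G)"
      using G \<alpha>.extend_filter[OF G] by simp
  qed
qed


section \<open>Compact elements\<close>

lemma functor_K_simps [simp]:
  "carrier (on_ob functor_K L) = compact_elements L"
  "le (on_ob functor_K L) = (\<lambda>x y. y \<sqsubseteq>\<^bsub>L\<^esub> x)" "eq (on_ob functor_K L) = eq L"
  "on_hom functor_K L\<^sub>1 L\<^sub>2 \<alpha> = restrict \<alpha> (compact_elements L\<^sub>1)"
  by (simp_all add: functor_K_def)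

context compact_frame
begin

sublocale compacts: partial_order "on_ob functor_K L"
  by (rule partial_orderI) (auto simp: eq_is_equal compact_carrier intro: le_antisym le_trans)

lemma compacts_meet:
  "\<lbrakk>k \<in> compact_elements L; l \<in> compact_elements L\<rbrakk> \<Longrightarrow> k \<sqinter>\<^bsub>on_ob functor_K L\<^esub> l = k \<squnion> l"
  by (rule compacts.meet_eqI) (auto simp: join_compact compact_carrier join_left join_right intro: join_le)

lemma compacts_top: "\<top>\<^bsub>on_ob functor_K L\<^esub> = \<bottom>"
  by (rule compacts.top_eqI) (auto simp: bottom_compact compact_carrier)

lemma compacts_bottom: "\<bottom>\<^bsub>on_ob functor_K L\<^esub> = \<top>"
  by (rule compacts.bottom_eqI) (auto simp: top_compact compact_carrier)

lemma meet_join_distrib: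
  assumes "a \<in> carrier L" "b \<in> carrier L" "c \<in> carrier L"
  shows "a \<sqinter> (b \<squnion> c) = (a \<sqinter> b) \<squnion> (a \<sqinter> c)"
  using meet_Sup[of a "{b, c}"] assms by (simp add: join_def)

text \<open>The frame law splits \<open>c\<close> into the compact elements below \<open>c \<sqinter> a\<close> and below \<open>c \<sqinter> b\<close>, and compactness
  selects finitely many of them. This is distributivity of the dual semilattice.\<close>

lemma compact_split:
  assumes a: "a \<in> carrier L" and b: "b \<in> carrier L" and c: "c \<in> compact_elements L" and le: "c \<sqsubseteq> a \<squnion> b"
  obtains a' b' where "a' \<in> compact_elements L" "b' \<in> compact_elements L" "a' \<sqsubseteq> a" "b' \<sqsubseteq> b" "a' \<squnion> b' = c"
proof -
  note cL = compact_carrier[OF c]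
  define A where "A = {k \<in> compact_elements L. k \<sqsubseteq> c \<sqinter> a}"
  define B where "B = {k \<in> compact_elements L. k \<sqsubseteq> c \<sqinter> b}"
  have AB: "A \<union> B \<subseteq> carrier L" using compact_carrier by (auto simp: A_def B_def)
  have "c = c \<sqinter> (a \<squnion> b)" using cL a b le by (intro meet_eqI[symmetric]) auto
  also have "\<dots> = \<Squnion>A \<squnion> \<Squnion>B"
    using meet_join_distrib[OF cL a b] compacts_below[of "c \<sqinter> a"] compacts_below[of "c \<sqinter> b"] cL a b
    by (simp add: A_def B_def)
  also have "\<dots> \<sqsubseteq> \<Squnion>(A \<union> B)"
    using AB by (intro join_le Sup_mono) auto
  finally obtain T where T: "finite T" "T \<subseteq> A \<union> B" "c \<sqsubseteq> \<Squnion>T"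
    using compact_cover[OF c AB] by blast
  define a' where "a' = \<Squnion>(T \<inter> A)"
  define b' where "b' = \<Squnion>(T \<inter> B)"
  have k: "a' \<in> compact_elements L" "b' \<in> compact_elements L"
    unfolding a'_def b'_def using T by (auto intro!: finite_Sup_compact simp: A_def B_def)
  note kL = compact_carrier[OF k(1)] compact_carrier[OF k(2)]
  have le': "a' \<sqsubseteq> c \<sqinter> a" "b' \<sqsubseteq> c \<sqinter> b"
    unfolding a'_def b'_def using AB a b cL by (auto intro!: sup_least simp: A_def B_def)
  have TL: "T \<inter> A \<subseteq> carrier L" "T \<inter> B \<subseteq> carrier L" using AB by auto
  have "t \<sqsubseteq> a' \<squnion> b'" if "t \<in> T" for t
  proof -
    have t: "t \<in> carrier L" using that T AB by blast
    from that T(2) consider "t \<in> T \<inter> A" | "t \<in> T \<inter> B" by blast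
    then show ?thesis
    proof cases
      case 1
      then have "t \<sqsubseteq> a'" unfolding a'_def by (rule sup_upper[OF TL(1)])
      then show ?thesis using t kL join_left by (blast intro: le_trans join_closed)
    next
      case 2
      then have "t \<sqsubseteq> b'" unfolding b'_def by (rule sup_upper[OF TL(2)])
      then show ?thesis using t kL join_right by (blast intro: le_trans join_closed)
    qed
  qed
  then have "\<Squnion>T \<sqsubseteq> a' \<squnion> b'" using T AB kL by (intro sup_least) auto
  then have "c \<sqsubseteq> a' \<squnion> b'"
    by (rule le_trans[OF T(3)]) (use T AB kL cL in \<open>auto intro!: sup_closed\<close>)
  moreover have le: "a' \<sqsubseteq> c" "b' \<sqsubseteq> c" "a' \<sqsubseteq> a" "b' \<sqsubseteq> b"
    using le' kL cL a b meet_left meet_right by (meson le_trans meet_closed)+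
  then have "a' \<squnion> b' \<sqsubseteq> c" using kL cL by (intro join_le)
  ultimately have "a' \<squnion> b' = c" using kL cL by (intro le_antisym) auto
  then show thesis using that k le by blast
qed

lemma bounded_distributive_compacts: "bounded_distributive_meet_semilattice (on_ob functor_K L)"
  unfolding bounded_distributive_meet_semilattice_def
proof (intro conjI ballI impI)
  let ?K = "on_ob functor_K L"
  show "lower_semilattice ?K"
  proof
    fix k l assume "k \<in> carrier ?K" "l \<in> carrier ?K"
    then have "greatest ?K (k \<squnion> l) (Lower ?K {k, l})"
      by (auto simp: greatest_def Lower_def join_compact compact_carrier join_left join_right
          intro: join_le)
    then show "\<exists>s. greatest ?K s (Lower ?K {k, l})" ..
  qed
  show "\<exists>t. greatest ?K t (carrier ?K)"
    using bottom_compact compact_carrier by (intro exI[of _ "\<bottom>"]) (auto simp: greatest_def)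
  show "\<exists>z. least ?K z (carrier ?K)"
    using top_compact compact_carrier by (intro exI[of _ "\<top>"]) (auto simp: least_def)
  fix a b c assume *: "a \<in> carrier ?K" "b \<in> carrier ?K" "c \<in> carrier ?K" "a \<sqinter>\<^bsub>?K\<^esub> b \<sqsubseteq>\<^bsub>?K\<^esub> c"
  then have "a \<in> carrier L" "b \<in> carrier L" "c \<in> compact_elements L" "c \<sqsubseteq> a \<squnion> b"
    by (auto simp: compacts_meet compact_carrier)
  then obtain a' b' where "a' \<in> compact_elements L" "b' \<in> compact_elements L"
    "a' \<sqsubseteq> a" "b' \<sqsubseteq> b" "a' \<squnion> b' = c"
    by (rule compact_split)
  then show "\<exists>a'\<in>carrier ?K. \<exists>b'\<in>carrier ?K. a \<sqsubseteq>\<^bsub>?K\<^esub> a' \<and> b \<sqsubseteq>\<^bsub>?K\<^esub> b' \<and> a' \<sqinter>\<^bsub>?K\<^esub> b' = c"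
    by (intro bexI[of _ a'] bexI[of _ b']) (auto simp: compacts_meet)
qed

end

locale frame_morphism = L: compact_frame L + M: compact_frame M
  for L M :: "'a gorder" and \<alpha> :: "'a \<Rightarrow> 'a" +
  assumes hom: "\<alpha> \<in> hom kalgfrm_sup L M"
begin

lemma closed: "a \<in> carrier L \<Longrightarrow> \<alpha> a \<in> carrier M"
  and Sup: "S \<subseteq> carrier L \<Longrightarrow> \<alpha> (\<Squnion>\<^bsub>L\<^esub>S) = \<Squnion>\<^bsub>M\<^esub>(\<alpha> ` S)"
  and compact: "k \<in> compact_elements L \<Longrightarrow> \<alpha> k \<in> compact_elements M"
  using hom by (auto simp: kalgfrm_sup_simps)

lemma join: "\<lbrakk>a \<in> carrier L; b \<in> carrier L\<rbrakk> \<Longrightarrow> \<alpha> (a \<squnion>\<^bsub>L\<^esub> b) = \<alpha> a \<squnion>\<^bsub>M\<^esub> \<alpha> b"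
  using Sup[of "{a, b}"] by (simp add: join_def)

lemma bottom: "\<alpha> \<bottom>\<^bsub>L\<^esub> = \<bottom>\<^bsub>M\<^esub>"
  using Sup[of "{}"] L.weak_sup_empty M.weak_sup_empty by (simp add: L.eq_is_equal M.eq_is_equal)

lemma mono: 
  assumes "a \<in> carrier L" "b \<in> carrier L" "a \<sqsubseteq>\<^bsub>L\<^esub> b"
  shows "\<alpha> a \<sqsubseteq>\<^bsub>M\<^esub> \<alpha> b"
proof -
  have "a \<squnion>\<^bsub>L\<^esub> b = b" unfolding join_def using assms by (intro L.sup_eqI) auto
  then have "\<alpha> a \<squnion>\<^bsub>M\<^esub> \<alpha> b = \<alpha> b" using join assms by metis
  then show ?thesis using M.join_left[of "\<alpha> a" "\<alpha> b"] assms closed by simp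
qed

lemma functor_K_hom: "on_hom functor_K L M \<alpha> \<in> hom bdms (on_ob functor_K L) (on_ob functor_K M)"
  using compact by (auto simp: bdms_simps L.compacts_meet M.compacts_meet L.compacts_top M.compacts_top
      L.join_compact join L.compact_carrier L.bottom_compact bottom)

lemma functor_K_bottom_iff:
  "on_hom functor_K L M \<alpha> \<bottom>\<^bsub>on_ob functor_K L\<^esub> = \<bottom>\<^bsub>on_ob functor_K M\<^esub> \<longleftrightarrow> \<alpha> \<top>\<^bsub>L\<^esub> = \<top>\<^bsub>M\<^esub>"
  by (simp add: L.compacts_bottom M.compacts_bottom L.top_compact)

end

lemma frame_morphismI:
  "\<lbrakk>L \<in> obj kalgfrm_sup; M \<in> obj kalgfrm_sup; \<alpha> \<in> hom kalgfrm_sup L M\<rbrakk> \<Longrightarrow> frame_morphism L M \<alpha>"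
  by (simp add: frame_morphism_def frame_morphism_axioms_def kalgfrm_sup_obj)

lemma is_functor_K: "is_functor kalgfrm_sup bdms functor_K"
  unfolding is_functor_def
proof (intro conjI ballI)
  show "category bdms" "category kalgfrm_sup"
    using order_category_category order_category_bdms order_category_kalgfrm_sup by auto
  fix L :: "'a gorder" assume L: "L \<in> obj kalgfrm_sup"
  then interpret L: compact_frame L by (simp add: kalgfrm_sup_obj)
  show "on_ob functor_K L \<in> obj bdms"
    using L.bounded_distributive_compacts by (simp add: bdms_simps)
  show "on_hom functor_K L L (ide kalgfrm_sup L) = ide bdms (on_ob functor_K L)"
    unfolding functor_K_simps bdms_simps kalgfrm_sup_simps
    by (rule restrict_ext) (use L.compact_carrier in auto)
  fix M \<alpha> assume M: "M \<in> obj kalgfrm_sup" and \<alpha>: "\<alpha> \<in> hom kalgfrm_sup L M"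
  interpret \<alpha>: frame_morphism L M \<alpha> using L M \<alpha> by (rule frame_morphismI)
  show "on_hom functor_K L M \<alpha> \<in> hom bdms (on_ob functor_K L) (on_ob functor_K M)"
    by (rule \<alpha>.functor_K_hom)
  fix N \<beta>
  show "on_hom functor_K L N (cmp kalgfrm_sup L M N \<beta> \<alpha>)
      = cmp bdms (on_ob functor_K L) (on_ob functor_K M) (on_ob functor_K N)
          (on_hom functor_K M N \<beta>) (on_hom functor_K L M \<alpha>)"
    unfolding functor_K_simps bdms_simps kalgfrm_sup_simps compose_def
    by (rule restrict_ext) (use L.compact_carrier \<alpha>.compact in auto)
qed


section \<open>Filters and compact elements are mutually inverse\<close>

lemma natural_order_iso_KF: "natural_order_iso bdms (functor_K \<circ>\<^sub>F functor_F) up_set"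
  unfolding natural_order_iso_def
proof (intro conjI ballI)
  fix M :: "'a gorder" assume M: "M \<in> obj bdms"
  then interpret M: bounded_distributive_semilattice M by (simp add: bdms_obj)
  have le: "up_set M b \<subseteq> up_set M a \<longleftrightarrow> a \<sqsubseteq>\<^bsub>M\<^esub> b" if "a \<in> carrier M" "b \<in> carrier M" for a b
    using that M.up_set_subset_iff M.up_set_filter by (auto simp: up_set_def)
  then have "inj_on (up_set M) (carrier M)"
    by (intro inj_onI) (metis M.le_antisym order_refl)
  then show "order_iso M (on_ob (functor_K \<circ>\<^sub>F functor_F) M) (up_set M)"
    using le by (auto simp: order_iso_def bij_betw_def M.compact_elements_filter_frame)
  fix N \<alpha> a assume "N \<in> obj bdms" "\<alpha> \<in> hom bdms M N" and a: "a \<in> carrier M"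
  then interpret \<alpha>: bdms_morphism M N \<alpha> using M by (intro bdms_morphismI)
  show "on_hom (functor_K \<circ>\<^sub>F functor_F) M N \<alpha> (up_set M a) = up_set N (\<alpha> a)"
    using a \<alpha>.extend_up_set[OF a] M.up_set_filter by (simp add: M.compact_elements_filter_frame)
qed

definition compacts_below_set :: "'a gorder \<Rightarrow> 'a \<Rightarrow> 'a set" where
  "compacts_below_set L a = {k \<in> compact_elements L. k \<sqsubseteq>\<^bsub>L\<^esub> a}"

context compact_frame
begin

lemma compacts_below_filter:
  assumes "a \<in> carrier L"
  shows "compacts_below_set L a \<in> mfilters (on_ob functor_K L)"
  using assms bottom_compact compact_carrier
  by (auto simp: mfilters_def compacts_below_set_def compacts_meet join_compact
      intro: le_trans join_le)

lemma finite_Sup_in_ideal: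
  assumes G: "G \<in> mfilters (on_ob functor_K L)" and "finite T" "T \<subseteq> G"
  shows "\<Squnion>T \<in> G"
  using assms(2,3)
proof (induction T)
  case empty
  obtain a where "a \<in> G" using G by (auto simp: mfilters_def)
  moreover have "\<Squnion>{} = \<bottom>" using weak_sup_empty by (simp add: eq_is_equal)
  ultimately show ?case using G bottom_compact compact_carrier by (auto simp: mfilters_def)
next
  case (insert x T)
  have GK: "G \<subseteq> compact_elements L" using G by (auto simp: mfilters_def)
  then have c: "x \<in> carrier L" "T \<subseteq> carrier L" "x \<in> compact_elements L" "\<Squnion>T \<in> compact_elements L"
    using insert compact_carrier by auto
  then have "\<Squnion>(insert x T) = x \<squnion> \<Squnion>T" using weak_sup_insert[of x T] by (simp add: eq_is_equal)
  also have "\<dots> = x \<sqinter>\<^bsub>on_ob functor_K L\<^esub> \<Squnion>T" using c by (simp add: compacts_meet)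
  also have "\<dots> \<in> G" using G insert by (simp add: mfilters_def)
  finally show ?case .
qed

text \<open>Filters of the dual of the compact elements are ideals of compact elements. A compact element
  below the join of an ideal is below a finite join, which belongs to the ideal.\<close>

lemma compacts_below_Sup:
  assumes G: "G \<in> mfilters (on_ob functor_K L)"
  shows "compacts_below_set L (\<Squnion>G) = G"
proof (intro subset_antisym subsetI)
  have GK: "G \<subseteq> compact_elements L" using G by (auto simp: mfilters_def)
  then have GL: "G \<subseteq> carrier L" using compact_carrier by blast
  show "k \<in> compacts_below_set L (\<Squnion>G)" if "k \<in> G" for k
    using that GK GL by (auto simp: compacts_below_set_def intro: sup_upper)
  fix k assume "k \<in> compacts_below_set L (\<Squnion>G)"
  then have k: "k \<in> compact_elements L" "k \<sqsubseteq> \<Squnion>G" by (auto simp: compacts_below_set_def)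
  then obtain T where "finite T" "T \<subseteq> G" "k \<sqsubseteq> \<Squnion>T" using compact_cover GL by metis
  moreover from this have "\<Squnion>T \<in> G" using finite_Sup_in_ideal G by blast
  ultimately show "k \<in> G" using G k by (auto simp: mfilters_def)
qed

lemma order_iso_compacts_below:
  "order_iso L (filter_frame (on_ob functor_K L)) (compacts_below_set L)"
proof -
  have le: "compacts_below_set L a \<subseteq> compacts_below_set L b \<longleftrightarrow> a \<sqsubseteq> b"
    if ab: "a \<in> carrier L" "b \<in> carrier L" for a b
  proof
    assume "compacts_below_set L a \<subseteq> compacts_below_set L b"
    then show "a \<sqsubseteq> b"
      unfolding compacts_below_set_def using compact_below[OF ab] by blast
  qed (use ab compact_carrier in \<open>auto simp: compacts_below_set_def intro: le_trans\<close>)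
  moreover have "inj_on (compacts_below_set L) (carrier L)"
    using le by (intro inj_onI) (metis le_antisym order_refl)
  moreover have "compacts_below_set L ` carrier L = mfilters (on_ob functor_K L)"
  proof (intro subset_antisym subsetI)
    fix G assume G: "G \<in> mfilters (on_ob functor_K L)"
    then have "G \<subseteq> carrier L" using compact_carrier by (auto simp: mfilters_def)
    then show "G \<in> compacts_below_set L ` carrier L"
      using compacts_below_Sup[OF G] by (metis image_eqI sup_closed)
  qed (use compacts_below_filter in auto)
  ultimately show ?thesis by (simp add: order_iso_def bij_betw_def)
qed

end

lemma natural_order_iso_FK: "natural_order_iso kalgfrm_sup (functor_F \<circ>\<^sub>F functor_K) compacts_below_set"
  unfolding natural_order_iso_def
proof (intro conjI ballI)
  fix L :: "'a gorder" assume L: "L \<in> obj kalgfrm_sup"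
  then interpret L: compact_frame L by (simp add: kalgfrm_sup_obj)
  show "order_iso L (on_ob (functor_F \<circ>\<^sub>F functor_K) L) (compacts_below_set L)"
    using L.order_iso_compacts_below by simp
  fix M \<alpha> a assume "M \<in> obj kalgfrm_sup" "\<alpha> \<in> hom kalgfrm_sup L M" and a: "a \<in> carrier L"
  then interpret \<alpha>: frame_morphism L M \<alpha> using L by (intro frame_morphismI)
  let ?B = "compacts_below_set L a"
  have BL: "?B \<subseteq> carrier L" using L.compact_carrier by (auto simp: compacts_below_set_def)
  have "{l \<in> compact_elements M. \<exists>k\<in>?B. l \<sqsubseteq>\<^bsub>M\<^esub> \<alpha> k} = compacts_below_set M (\<alpha> a)"
  proof (intro subset_antisym subsetI)
    fix l assume "l \<in> {l \<in> compact_elements M. \<exists>k\<in>?B. l \<sqsubseteq>\<^bsub>M\<^esub> \<alpha> k}"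
    then obtain k where k: "k \<in> ?B" "l \<in> compact_elements M" "l \<sqsubseteq>\<^bsub>M\<^esub> \<alpha> k" by blast
    have kL: "k \<in> carrier L" "k \<sqsubseteq>\<^bsub>L\<^esub> a" using k BL by (auto simp: compacts_below_set_def)
    then have "l \<sqsubseteq>\<^bsub>M\<^esub> \<alpha> a"
      using \<alpha>.M.le_trans[OF k(3) \<alpha>.mono[OF kL(1) a kL(2)]] k kL a \<alpha>.closed \<alpha>.M.compact_carrier
      by blast
    with k show "l \<in> compacts_below_set M (\<alpha> a)" by (simp add: compacts_below_set_def)
  next
    fix l assume "l \<in> compacts_below_set M (\<alpha> a)"
    then have l: "l \<in> compact_elements M" "l \<sqsubseteq>\<^bsub>M\<^esub> \<alpha> a" by (auto simp: compacts_below_set_def)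
    have "\<alpha> a = \<Squnion>\<^bsub>M\<^esub>(\<alpha> ` ?B)"
      using \<alpha>.Sup[OF BL] L.compacts_below[OF a] by (simp add: compacts_below_set_def)
    with l have "l \<sqsubseteq>\<^bsub>M\<^esub> \<Squnion>\<^bsub>M\<^esub>(\<alpha> ` ?B)" by simp
    moreover have "\<alpha> ` ?B \<subseteq> carrier M" using BL \<alpha>.closed by blast
    ultimately obtain T' where T': "finite T'" "T' \<subseteq> \<alpha> ` ?B" "l \<sqsubseteq>\<^bsub>M\<^esub> \<Squnion>\<^bsub>M\<^esub>T'"
      using \<alpha>.M.compact_cover[OF l(1)] by metis
    obtain T where T: "finite T" "T \<subseteq> ?B" "T' = \<alpha> ` T"
      using finite_subset_image[OF T'(1,2)] by blast
    have "\<Squnion>\<^bsub>L\<^esub>T \<in> ?B"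
      by (rule L.finite_Sup_in_ideal[OF L.compacts_below_filter[OF a] T(1,2)])
    moreover have "l \<sqsubseteq>\<^bsub>M\<^esub> \<alpha> (\<Squnion>\<^bsub>L\<^esub>T)" using T T' BL by (subst \<alpha>.Sup) auto
    ultimately show "l \<in> {l \<in> compact_elements M. \<exists>k\<in>?B. l \<sqsubseteq>\<^bsub>M\<^esub> \<alpha> k}" using l by blast
  qed
  moreover have "restrict \<alpha> (compact_elements L) k = \<alpha> k" if "k \<in> ?B" for k
    using that by (simp add: compacts_below_set_def)
  ultimately show "on_hom (functor_F \<circ>\<^sub>F functor_K) L M \<alpha> ?B = compacts_below_set M (\<alpha> a)"
    using L.compacts_below_filter[OF a] by (simp cong: bex_cong)
qed


section \<open>Generalized Priestley spaces\<close>

lemma compact_closed_cover: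
  assumes "compact_space T" "closedin T C" "\<And>U. U \<in> \<U> \<Longrightarrow> openin T U" "C \<subseteq> \<Union>\<U>"
  obtains \<V> where "finite \<V>" "\<V> \<subseteq> \<U>" "C \<subseteq> \<Union>\<V>"
  using closedin_compact_space[OF assms(1,2)] assms(3,4) that unfolding compactin_def by metis

lemma compact_closed_Inter:
  assumes T: "compact_space T" "closedin T C" and F: "\<And>F. F \<in> \<F> \<Longrightarrow> closedin T F" and CF: "C \<inter> \<Inter>\<F> = {}"
  obtains \<G> where "finite \<G>" "\<G> \<subseteq> \<F>" "C \<inter> \<Inter>\<G> = {}"
proof -
  have cover: "C \<subseteq> \<Union>((-) (topspace T) ` \<F>)"
    using CF closedin_subset[OF T(2)] by blast
  have opens: "openin T U" if "U \<in> (-) (topspace T) ` \<F>" for U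
    using that F by (auto simp: closedin_def)
  obtain \<V> where V: "finite \<V>" "\<V> \<subseteq> (-) (topspace T) ` \<F>" "C \<subseteq> \<Union>\<V>"
    by (rule compact_closed_cover[OF T opens cover])
  obtain \<G> where "\<G> \<subseteq> \<F>" "finite \<G>" "\<V> = (-) (topspace T) ` \<G>"
    using finite_subset_image[OF V(1,2)] by blast
  moreover from this V(3) have "C \<inter> \<Inter>\<G> = {}" by blast
  ultimately show thesis using that by blast
qed

locale priestley =
  fixes X :: "'a gps"
  assumes priestley: "priestley_space X"
begin

lemma compact: "compact_space (gps_top X)"
  using priestley by (simp add: priestley_space_def)

lemma
  shows ord_points: "(x, y) \<in> gps_ord X \<Longrightarrow> x \<in> points X \<and> y \<in> points X"
    and ord_refl: "x \<in> points X \<Longrightarrow> (x, x) \<in> gps_ord X"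
    and ord_trans: "(x, y) \<in> gps_ord X \<Longrightarrow> (y, z) \<in> gps_ord X \<Longrightarrow> (x, z) \<in> gps_ord X"
    and ord_antisym: "(x, y) \<in> gps_ord X \<Longrightarrow> (y, x) \<in> gps_ord X \<Longrightarrow> x = y"
  using priestley unfolding priestley_space_def partial_order_on_def preorder_on_def refl_on_def
  by (auto dest: transD antisymD)

lemma separation:
  assumes "x \<in> points X" "y \<in> points X" "(x, y) \<notin> gps_ord X"
  obtains U where "clopen_upset X U" "x \<in> U" "y \<notin> U"
  using priestley assms unfolding priestley_space_def by blast

lemma closed_principal_upset:
  assumes x: "x \<in> points X"
  shows "closedin (gps_top X) (gps_ord X `` {x})"
proof -
  have "gps_ord X `` {x} = \<Inter>{U. clopen_upset X U \<and> x \<in> U}"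
  proof (intro subset_antisym subsetI)
    fix y assume y: "y \<in> \<Inter>{U. clopen_upset X U \<and> x \<in> U}"
    have "clopen_upset X (points X)"
      using ord_points by (auto simp: clopen_upset_def upset_def)
    then have "y \<in> points X" using x y by blast
    then show "y \<in> gps_ord X `` {x}" using separation[OF x, of y] y by blast
  qed (auto simp: clopen_upset_def upset_def)
  moreover have "clopen_upset X (points X)"
    using ord_points by (auto simp: clopen_upset_def upset_def)
  ultimately show ?thesis
    using x by (auto intro!: closedin_Inter simp: clopen_upset_def)
qed

lemma finite_chain_greatest:
  assumes "finite C" "C \<noteq> {}" "C \<subseteq> points X" "\<And>a b. a \<in> C \<Longrightarrow> b \<in> C \<Longrightarrow> (a, b) \<in> gps_ord X \<or> (b, a) \<in> gps_ord X"
  shows "\<exists>m\<in>C. \<forall>a\<in>C. (a, m) \<in> gps_ord X"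
  using assms
proof (induction rule: finite_ne_induct)
  case (singleton x)
  then show ?case using ord_refl by auto
next
  case (insert x F)
  then obtain m where m: "m \<in> F" "\<forall>a\<in>F. (a, m) \<in> gps_ord X" by blast
  from insert.prems m have "(x, m) \<in> gps_ord X \<or> (m, x) \<in> gps_ord X" by blast
  then show ?case
  proof
    assume "(x, m) \<in> gps_ord X"
    then show ?thesis using m by blast
  next
    assume "(m, x) \<in> gps_ord X"
    then have "\<forall>a\<in>insert x F. (a, x) \<in> gps_ord X"
      using m ord_trans ord_refl insert.prems by blast
    then show ?thesis by blast
  qed
qed

text \<open>A chain in a closed set has an upper bound there, because by compactness the closed principal
  upsets of its members have a common point.\<close>

lemma exists_maximal_point:
  assumes F: "closedin (gps_top X) F" and x: "x \<in> F"
  obtains y where "y \<in> maximal_points X F" "(x, y) \<in> gps_ord X"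
proof -
  define A where "A = {a \<in> F. (x, a) \<in> gps_ord X}"
  define P where "P a b \<longleftrightarrow> (a, b) \<in> gps_ord X" for a b
  have Fp: "F \<subseteq> points X" by (rule closedin_subset[OF F])
  have Ap: "A \<subseteq> points X" using Fp by (auto simp: A_def)
  have xA: "x \<in> A" using x Fp ord_refl by (auto simp: A_def)
  have "\<exists>m\<in>A. \<forall>a\<in>A. P m a \<longrightarrow> a = m"
  proof (rule predicate_Zorn)
    show "partial_order_on A (relation_of P A)"
      using Ap ord_refl ord_trans ord_antisym
      by (auto simp: partial_order_on_def preorder_on_def refl_on_def relation_of_def P_def
          intro!: transI antisymI)
    fix C assume "C \<in> Chains (relation_of P A)"
    then have C: "C \<subseteq> A" "\<And>a b. a \<in> C \<Longrightarrow> b \<in> C \<Longrightarrow> (a, b) \<in> gps_ord X \<or> (b, a) \<in> gps_ord X"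
      by (auto simp: Chains_def relation_of_def P_def)
    show "\<exists>u\<in>A. \<forall>a\<in>C. P a u"
    proof (cases "C = {}")
      case False
      have "F \<inter> \<Inter>((\<lambda>a. gps_ord X `` {a}) ` C) \<noteq> {}"
      proof
        assume "F \<inter> \<Inter>((\<lambda>a. gps_ord X `` {a}) ` C) = {}"
        moreover have "closedin (gps_top X) H" if "H \<in> (\<lambda>a. gps_ord X `` {a}) ` C" for H
          using that C(1) Ap closed_principal_upset by blast
        ultimately obtain \<G> where G: "finite \<G>" "\<G> \<subseteq> (\<lambda>a. gps_ord X `` {a}) ` C" "F \<inter> \<Inter>\<G> = {}"
          using compact_closed_Inter[OF compact F] by metis
        then obtain B where B: "B \<subseteq> C" "finite B" "\<G> = (\<lambda>a. gps_ord X `` {a}) ` B"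
          using finite_subset_image[OF G(1,2)] by blast
        then have "B \<noteq> {}" using G(3) x by auto
        then obtain m where "m \<in> B" "\<forall>a\<in>B. (a, m) \<in> gps_ord X"
          using finite_chain_greatest[of B] B C Ap by (meson subset_trans subsetD)
        then have "m \<in> F \<inter> \<Inter>\<G>" using B C by (auto simp: A_def)
        then show False using G(3) by blast
      qed
      then obtain u where u: "u \<in> F" "\<forall>a\<in>C. (a, u) \<in> gps_ord X" by blast
      then have "u \<in> A" using False C ord_trans by (auto simp: A_def)
      then show ?thesis using u by (auto simp: P_def)
    qed (use xA in auto)
  qed
  then obtain m where "m \<in> A" "\<forall>a\<in>A. (m, a) \<in> gps_ord X \<longrightarrow> a = m" by (auto simp: P_def)
  then have "m \<in> maximal_points X F" "(x, m) \<in> gps_ord X"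
    using ord_trans by (auto simp: maximal_points_def A_def)
  then show thesis by (rule that)
qed

end

lemma directed_by_inclusionD:
  "\<lbrakk>directed_by_inclusion \<U>; U \<in> \<U>; V \<in> \<U>\<rbrakk> \<Longrightarrow> \<exists>W\<in>\<U>. U \<subseteq> W \<and> V \<subseteq> W"
  by (simp add: directed_by_inclusion_def)

locale gps_space =
  fixes X :: "'a gps"
  assumes gps: "generalized_priestley_space X"
begin

sublocale priestley X
  by unfold_locales (use gps in \<open>simp add: generalized_priestley_space_def\<close>)

lemma core_points: "gps_core X \<subseteq> points X"
  using gps by (simp add: generalized_priestley_space_def)

lemma core_meets_open:
  assumes "openin (gps_top X) U" "x \<in> U"
  obtains y where "y \<in> gps_core X" "y \<in> U"
proof -
  have "gps_top X closure_of gps_core X = points X"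
    using gps by (simp add: generalized_priestley_space_def)
  then have "gps_core X \<inter> U \<noteq> {}"
    using assms unfolding dense_intersects_open by blast
  then show thesis using that by blast
qed

lemma below_core:
  assumes "x \<in> points X"
  obtains y where "y \<in> gps_core X" "(x, y) \<in> gps_ord X"
proof -
  have "\<forall>x\<in>points X. \<exists>y\<in>gps_core X. (x, y) \<in> gps_ord X"
    using gps unfolding generalized_priestley_space_def by (elim conjE)
  then show thesis using assms that by blast
qed

lemma core_iff: "x \<in> points X \<Longrightarrow> x \<in> gps_core X \<longleftrightarrow> directed_by_inclusion (admissible_missing X x)"
  using gps by (simp add: generalized_priestley_space_def)

lemma ord_iff: "\<lbrakk>x \<in> points X; y \<in> points X\<rbrakk> \<Longrightarrow>
    (x, y) \<in> gps_ord X \<longleftrightarrow> (\<forall>U\<in>admissible X. x \<in> U \<longrightarrow> y \<in> U)"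
  using gps by (simp add: generalized_priestley_space_def)

lemma
  assumes "U \<in> admissible X"
  shows admissible_open: "openin (gps_top X) U" and admissible_closed: "closedin (gps_top X) U"
    and admissible_upset: "upset X U"
    and admissible_up: "\<lbrakk>x \<in> U; (x, y) \<in> gps_ord X\<rbrakk> \<Longrightarrow> y \<in> U"
    and admissible_points: "U \<subseteq> points X"
  using assms by (auto simp: admissible_def clopen_upset_def upset_def)

lemma points_admissible: "points X \<in> admissible X"
  using ord_points by (auto simp: admissible_def clopen_upset_def upset_def maximal_points_def)

lemma empty_admissible: "{} \<in> admissible X"
proof -
  have "x \<in> gps_core X" if x: "x \<in> maximal_points X (points X)" for x
  proof -
    have "x \<in> points X" using x by (simp add: maximal_points_def)
    then obtain y where "y \<in> gps_core X" "(x, y) \<in> gps_ord X" by (rule below_core)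
    then show ?thesis using x core_points by (auto simp: maximal_points_def)
  qed
  then show ?thesis by (auto simp: admissible_def clopen_upset_def upset_def)
qed

text \<open>A maximal point of a union of complements is maximal in the complement that contains it.\<close>

lemma Int_admissible:
  assumes U: "U \<in> admissible X" and V: "V \<in> admissible X"
  shows "U \<inter> V \<in> admissible X"
proof -
  have "maximal_points X (points X - U \<inter> V)
      \<subseteq> maximal_points X (points X - U) \<union> maximal_points X (points X - V)"
    by (auto simp: maximal_points_def)
  then show ?thesis
    using U V unfolding admissible_def clopen_upset_def upset_def by blast
qed

lemma finite_Inter_admissible:
  assumes "finite \<U>" "\<U> \<subseteq> admissible X"
  shows "points X \<inter> \<Inter>\<U> \<in> admissible X"
  using assms
proof (induction \<U>)
  case empty
  then show ?case using points_admissible by simp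
next
  case (insert U \<U>)
  then have "U \<inter> (points X \<inter> \<Inter>\<U>) \<in> admissible X"
    using Int_admissible[of U "points X \<inter> \<Inter>\<U>"] by blast
  moreover have "points X \<inter> \<Inter>(insert U \<U>) = U \<inter> (points X \<inter> \<Inter>\<U>)" by blast
  ultimately show ?case by metis
qed

text \<open>Directedness at a core point in finitary form. This is how core points are used: a finite union
  of admissible sets, which need not be admissible, is replaced by a larger admissible set.\<close>

lemma core_upper_bound:
  assumes y: "y \<in> gps_core X" and "finite \<U>" "\<U> \<subseteq> admissible X" "\<And>U. U \<in> \<U> \<Longrightarrow> y \<notin> U"
  shows "\<exists>W\<in>admissible X. y \<notin> W \<and> \<Union>\<U> \<subseteq> W"
  using assms(2-)
proof (induction \<U>)
  case empty
  then show ?case using empty_admissible by auto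
next
  case (insert U \<U>)
  then obtain W where W: "W \<in> admissible X" "y \<notin> W" "\<Union>\<U> \<subseteq> W" by auto
  have "directed_by_inclusion (admissible_missing X y)"
    using y core_iff core_points by blast
  moreover have "U \<in> admissible_missing X y" "W \<in> admissible_missing X y"
    using W insert.prems by (auto simp: admissible_missing_def)
  ultimately have "\<exists>Z\<in>admissible_missing X y. U \<subseteq> Z \<and> W \<subseteq> Z"
    by (rule directed_by_inclusionD)
  then obtain Z where "Z \<in> admissible_missing X y" "U \<subseteq> Z" "W \<subseteq> Z" by blast
  then have "Z \<in> admissible X" "y \<notin> Z" "\<Union>(insert U \<U>) \<subseteq> Z"
    using W(3) by (simp add: admissible_missing_def, simp add: admissible_missing_def, blast)
  then show ?case by blast
qed

lemma compact_cover:
  assumes "closedin (gps_top X) C" "\<U> \<subseteq> admissible X" "C \<subseteq> \<Union>\<U>"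
  obtains \<V> where "finite \<V>" "\<V> \<subseteq> \<U>" "C \<subseteq> \<Union>\<V>"
  using compact_closed_cover[OF compact assms(1), of \<U>] assms admissible_open that
  by (metis subsetD)

lemma compact_Inter:
  assumes "closedin (gps_top X) C" "\<U> \<subseteq> admissible X" "C \<inter> \<Inter>\<U> = {}"
  obtains \<V> where "finite \<V>" "\<V> \<subseteq> \<U>" "C \<inter> \<Inter>\<V> = {}"
  using compact_closed_Inter[OF compact assms(1), of \<U>] assms admissible_closed that
  by (metis subsetD)

end

section \<open>The category of generalized Priestley spaces\<close>

lemma rel_box_mono: "U \<subseteq> V \<Longrightarrow> rel_box X R U \<subseteq> rel_box X R V"
  by (auto simp: rel_box_def)

lemma gps_simps:
  "obj gps = {X. generalized_priestley_space X}"
  "hom gps X Y = {R. R \<subseteq> points X \<times> points Y \<and>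
     (\<forall>x\<in>points X. \<forall>y\<in>points Y. (x, y) \<notin> R \<longrightarrow> (\<exists>U\<in>admissible Y. R `` {x} \<subseteq> U \<and> y \<notin> U)) \<and>
     (\<forall>U\<in>admissible Y. rel_box X R U \<in> admissible X)}"
  "ide gps X = gps_ord X"
  "cmp gps X Y Z S R = {(x, z). x \<in> points X \<and> z \<in> points Z \<and>
     (\<forall>U\<in>admissible Z. x \<in> rel_box X R (rel_box Y S U) \<longrightarrow> z \<in> U)}"
  by (simp_all add: gps_def)

lemma gps_obj: "X \<in> obj gps \<longleftrightarrow> gps_space X"
  by (simp add: gps_simps gps_space_def)

lemma gps_homI:
  assumes "R \<subseteq> points X \<times> points Y"
    and "\<And>x y. \<lbrakk>x \<in> points X; y \<in> points Y; (x, y) \<notin> R\<rbrakk> \<Longrightarrow> \<exists>U\<in>admissible Y. R `` {x} \<subseteq> U \<and> y \<notin> U"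
    and "\<And>U. U \<in> admissible Y \<Longrightarrow> rel_box X R U \<in> admissible X"
  shows "R \<in> hom gps X Y"
  using assms by (simp add: gps_simps)

lemma
  assumes "R \<in> hom gps X Y"
  shows gps_hom_points: "(x, y) \<in> R \<Longrightarrow> x \<in> points X \<and> y \<in> points Y"
    and gps_hom_box: "U \<in> admissible Y \<Longrightarrow> rel_box X R U \<in> admissible X"
    and gps_hom_iff: "\<lbrakk>x \<in> points X; y \<in> points Y\<rbrakk> \<Longrightarrow>
      (x, y) \<in> R \<longleftrightarrow> (\<forall>U\<in>admissible Y. x \<in> rel_box X R U \<longrightarrow> y \<in> U)"
proof -
  show "(x, y) \<in> R \<Longrightarrow> x \<in> points X \<and> y \<in> points Y" "U \<in> admissible Y \<Longrightarrow> rel_box X R U \<in> admissible X"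
    using assms by (auto simp: gps_simps)
  assume xy: "x \<in> points X" "y \<in> points Y"
  have "\<exists>U\<in>admissible Y. R `` {x} \<subseteq> U \<and> y \<notin> U" if "(x, y) \<notin> R"
    using assms xy that by (auto simp: gps_simps)
  then show "(x, y) \<in> R \<longleftrightarrow> (\<forall>U\<in>admissible Y. x \<in> rel_box X R U \<longrightarrow> y \<in> U)"
    using xy by (auto simp: rel_box_def)
qed

text \<open>All equations between morphisms are checked in this way: on box operators of admissible sets,
  composition is composition of functions.\<close>

lemma gps_hom_eqI:
  assumes "R \<in> hom gps X Y" "S \<in> hom gps X Y"
    and "\<And>U. U \<in> admissible Y \<Longrightarrow> rel_box X R U = rel_box X S U"
  shows "R = S"
proof -
  have "(x, y) \<in> R \<longleftrightarrow> (x, y) \<in> S" for x y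
    using assms(3) gps_hom_points[OF assms(1)] gps_hom_points[OF assms(2)]
      gps_hom_iff[OF assms(1)] gps_hom_iff[OF assms(2)] by metis
  then show ?thesis by auto
qed

lemma rel_box_ord:
  assumes "gps_space X" "upset X U"
  shows "rel_box X (gps_ord X) U = U"
proof -
  interpret gps_space X by fact
  show ?thesis using assms(2) ord_refl by (auto simp: rel_box_def upset_def)
qed

text \<open>Composition is defined so that its box operator should be the composite of the box operators;
  the content is that the box of the composite is no larger. If \<open>x\<close> is outside \<open>\<box>\<^sub>R \<box>\<^sub>S U\<close>, then also
  outside \<open>\<box>\<^sub>R \<box>\<^sub>S W\<close> for every subset \<open>W\<close> of \<open>U\<close>; hence no finite intersection
  of admissible \<open>V\<close> with \<open>x \<in> \<box>\<^sub>R \<box>\<^sub>S V\<close> is contained in \<open>U\<close>, and compactness yields a point \<open>z\<close> outside \<open>U\<close> that is common to all of them.\<close>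

lemma rel_box_cmp:
  assumes X: "gps_space X" and Y: "gps_space Y" and Z: "gps_space Z"
    and R: "R \<in> hom gps X Y" and S: "S \<in> hom gps Y Z" and U: "U \<in> admissible Z"
  shows "rel_box X (cmp gps X Y Z S R) U = rel_box X R (rel_box Y S U)"
proof
  interpret X: gps_space X by fact
  interpret Z: gps_space Z by fact
  let ?b = "\<lambda>U. rel_box X R (rel_box Y S U)"
  show "?b U \<subseteq> rel_box X (cmp gps X Y Z S R) U"
    using U by (auto simp: rel_box_def[of X "cmp gps X Y Z S R"] gps_simps(4)) (auto simp: rel_box_def)
  show "rel_box X (cmp gps X Y Z S R) U \<subseteq> ?b U"
  proof (rule subsetI, rule ccontr)
    fix x assume x: "x \<in> rel_box X (cmp gps X Y Z S R) U" and nx: "x \<notin> ?b U"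
    have xp: "x \<in> points X" using x by (simp add: rel_box_def)
    define \<V> where "\<V> = {V \<in> admissible Z. x \<in> ?b V}"
    have "(points Z - U) \<inter> \<Inter>\<V> \<noteq> {}"
    proof
      assume "(points Z - U) \<inter> \<Inter>\<V> = {}"
      then obtain \<W> where W: "finite \<W>" "\<W> \<subseteq> \<V>" "(points Z - U) \<inter> \<Inter>\<W> = {}"
        by (rule Z.compact_Inter[rotated 2])
          (use Z.admissible_open[OF U] in \<open>auto simp: \<V>_def openin_closedin_eq\<close>)
      have "points Z \<inter> \<Inter>\<W> \<subseteq> U" using W by blast
      then have "?b (points Z \<inter> \<Inter>\<W>) \<subseteq> ?b U" by (intro rel_box_mono)
      moreover have "x \<in> ?b (points Z \<inter> \<Inter>\<W>)"
        using W(2) xp gps_hom_points[OF R] gps_hom_points[OF S]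
        by (auto simp: rel_box_def \<V>_def subset_iff)
      ultimately show False using nx by blast
    qed
    then obtain z where z: "z \<in> points Z" "z \<notin> U" "\<And>V. V \<in> \<V> \<Longrightarrow> z \<in> V" by blast
    then have "(x, z) \<in> cmp gps X Y Z S R" using xp by (auto simp: gps_simps(4) \<V>_def)
    then show False using x z by (auto simp: rel_box_def)
  qed
qed

lemma gps_ide_hom:
  assumes "gps_space X"
  shows "gps_ord X \<in> hom gps X X"
proof (rule gps_homI)
  interpret gps_space X by fact
  show "gps_ord X \<subseteq> points X \<times> points X" using ord_points by auto
  show "rel_box X (gps_ord X) U \<in> admissible X" if "U \<in> admissible X" for U
    using that rel_box_ord[OF assms admissible_upset[OF that]] by simp
  fix x y assume "x \<in> points X" "y \<in> points X" "(x, y) \<notin> gps_ord X"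
  then obtain U where U: "U \<in> admissible X" "x \<in> U" "y \<notin> U" using ord_iff by blast
  then have "gps_ord X `` {x} \<subseteq> U" using admissible_up by blast
  then show "\<exists>U\<in>admissible X. gps_ord X `` {x} \<subseteq> U \<and> y \<notin> U" using U by blast
qed

lemma gps_cmp_hom:
  assumes "gps_space X" "gps_space Y" "gps_space Z" and R: "R \<in> hom gps X Y" and S: "S \<in> hom gps Y Z"
  shows "cmp gps X Y Z S R \<in> hom gps X Z"
proof (rule gps_homI)
  show "cmp gps X Y Z S R \<subseteq> points X \<times> points Z" by (auto simp: gps_simps(4))
  note box = rel_box_cmp[OF assms]
  show "rel_box X (cmp gps X Y Z S R) U \<in> admissible X" if "U \<in> admissible Z" for U
    unfolding box[OF that] by (intro gps_hom_box[OF R] gps_hom_box[OF S] that)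
  fix x z assume x: "x \<in> points X" and "z \<in> points Z" "(x, z) \<notin> cmp gps X Y Z S R"
  then obtain U where U: "U \<in> admissible Z" "x \<in> rel_box X R (rel_box Y S U)" "z \<notin> U"
    unfolding gps_simps(4) by blast
  then have "x \<in> rel_box X (cmp gps X Y Z S R) U" using box by simp
  then show "\<exists>U\<in>admissible Z. cmp gps X Y Z S R `` {x} \<subseteq> U \<and> z \<notin> U"
    using U by (auto simp: rel_box_def[of X "cmp gps X Y Z S R"])
qed

lemma category_gps: "category gps"
  unfolding category_def gps_obj gps_simps(3)
proof (intro conjI ballI)
  fix X Y :: "'a gps" and R assume X: "X \<in> obj gps" and Y: "Y \<in> obj gps" and R: "R \<in> hom gps X Y"
  note gX = X[unfolded gps_obj] note gY = Y[unfolded gps_obj]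
  have up: "upset Z U" if "U \<in> admissible Z" for Z :: "'a gps" and U
    using that by (simp add: admissible_def clopen_upset_def)
  show "cmp gps X X Y R (gps_ord X) = R"
    by (rule gps_hom_eqI[OF gps_cmp_hom[OF gX gX gY gps_ide_hom[OF gX] R] R])
      (simp add: rel_box_cmp[OF gX gX gY gps_ide_hom[OF gX] R] rel_box_ord[OF gX] up gps_hom_box[OF R])
  show "cmp gps X Y Y (gps_ord Y) R = R"
    by (rule gps_hom_eqI[OF gps_cmp_hom[OF gX gY gY R gps_ide_hom[OF gY]] R])
      (simp add: rel_box_cmp[OF gX gY gY R gps_ide_hom[OF gY]] rel_box_ord[OF gY] up)
  fix Z S assume Z: "Z \<in> obj gps" and S: "S \<in> hom gps Y Z"
  note gZ = Z[unfolded gps_obj]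
  show RS: "cmp gps X Y Z S R \<in> hom gps X Z" by (rule gps_cmp_hom[OF gX gY gZ R S])
  fix W T assume W: "W \<in> obj gps" and T: "T \<in> hom gps Z W"
  note gW = W[unfolded gps_obj]
  have ST: "cmp gps Y Z W T S \<in> hom gps Y W" by (rule gps_cmp_hom[OF gY gZ gW S T])
  show "cmp gps X Z W T (cmp gps X Y Z S R) = cmp gps X Y W (cmp gps Y Z W T S) R"
    by (rule gps_hom_eqI[OF gps_cmp_hom[OF gX gZ gW RS T] gps_cmp_hom[OF gX gY gW R ST]])
      (simp add: rel_box_cmp[OF gX gZ gW RS T] rel_box_cmp[OF gX gY gW R ST]
        rel_box_cmp[OF gX gY gZ R S] rel_box_cmp[OF gY gZ gW S T] gps_hom_box[OF T])
qed (simp add: gps_ide_hom gps_obj)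


section \<open>Isomorphisms of generalized Priestley spaces\<close>

text \<open>Order and core can be recovered from the admissible sets, so a bijection matching admissible
  sets induces an isomorphism in the category; no homeomorphism has to be exhibited.\<close>

definition gps_iso :: "'a gps \<Rightarrow> 'b gps \<Rightarrow> ('a \<Rightarrow> 'b) \<Rightarrow> bool" where
  "gps_iso X Y f \<longleftrightarrow> bij_betw f (points X) (points Y) \<and>
     (\<forall>U. U \<subseteq> points X \<longrightarrow> (f ` U \<in> admissible Y \<longleftrightarrow> U \<in> admissible X))"

lemma gps_iso_comp:
  assumes "gps_iso X Y f" "gps_iso Y Z g"
  shows "gps_iso X Z (g \<circ> f)"
proof -
  have f: "bij_betw f (points X) (points Y)" and g: "bij_betw g (points Y) (points Z)"
    using assms by (auto simp: gps_iso_def)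
  have "(g \<circ> f) ` U \<in> admissible Z \<longleftrightarrow> U \<in> admissible X" if U: "U \<subseteq> points X" for U
  proof -
    have "f ` U \<subseteq> points Y" using f U by (auto simp: bij_betw_def)
    then show ?thesis using U assms unfolding image_comp[symmetric] gps_iso_def by blast
  qed
  then show ?thesis using bij_betw_trans[OF f g] by (simp add: gps_iso_def)
qed

locale gps_isomorphism = X: gps_space X + Y: gps_space Y
  for X Y :: "'a gps" +
  fixes f :: "'a \<Rightarrow> 'a"
  assumes iso: "gps_iso X Y f"
begin

lemma bij: "bij_betw f (points X) (points Y)"
  using iso by (simp add: gps_iso_def)

lemma closed: "x \<in> points X \<Longrightarrow> f x \<in> points Y"
  using bij by (auto simp: bij_betw_def)

lemma admissible_image: "U \<in> admissible X \<Longrightarrow> f ` U \<in> admissible Y"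
  using iso X.admissible_points[of U] by (simp add: gps_iso_def)

lemma admissible_cases:
  assumes "V \<in> admissible Y"
  obtains U where "U \<in> admissible X" "V = f ` U"
proof -
  have "V \<subseteq> f ` points X" using Y.admissible_points[OF assms] bij by (simp add: bij_betw_def)
  then obtain U where "U \<subseteq> points X" "V = f ` U" by (rule subset_imageE)
  then show thesis using that iso assms by (auto simp: gps_iso_def)
qed

lemma mem_image: "\<lbrakk>U \<subseteq> points X; x \<in> points X\<rbrakk> \<Longrightarrow> f x \<in> f ` U \<longleftrightarrow> x \<in> U"
  using bij by (auto simp: bij_betw_def dest: inj_onD)

lemma ord: 
  assumes "x \<in> points X" "y \<in> points X"
  shows "(f x, f y) \<in> gps_ord Y \<longleftrightarrow> (x, y) \<in> gps_ord X"
proof -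
  have "(\<forall>V\<in>admissible Y. f x \<in> V \<longrightarrow> f y \<in> V) \<longleftrightarrow> (\<forall>U\<in>admissible X. x \<in> U \<longrightarrow> y \<in> U)"
    using admissible_image mem_image X.admissible_points assms by (metis admissible_cases)
  then show ?thesis using assms by (simp add: X.ord_iff Y.ord_iff closed)
qed

definition to_rel where "to_rel = {(x, y). x \<in> points X \<and> (f x, y) \<in> gps_ord Y}"

definition from_rel where "from_rel = {(y, x). x \<in> points X \<and> (y, f x) \<in> gps_ord Y}"

lemma rel_box_to_rel:
  assumes U: "U \<in> admissible X"
  shows "rel_box X to_rel (f ` U) = U"
proof (intro subset_antisym subsetI)
  fix x assume x: "x \<in> rel_box X to_rel (f ` U)"
  then have xp: "x \<in> points X" by (simp add: rel_box_def)
  then have "(x, f x) \<in> to_rel" using Y.ord_refl closed by (simp add: to_rel_def)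
  then have "f x \<in> f ` U" using x by (auto simp: rel_box_def)
  then show "x \<in> U" using mem_image[OF X.admissible_points[OF U] xp] by blast
next
  fix x assume x: "x \<in> U"
  then have "y \<in> f ` U" if "(x, y) \<in> to_rel" for y
    using that Y.admissible_up[OF admissible_image[OF U]] by (auto simp: to_rel_def)
  then show "x \<in> rel_box X to_rel (f ` U)"
    using x X.admissible_points[OF U] by (auto simp: rel_box_def)
qed

lemma rel_box_from_rel:
  assumes U: "U \<in> admissible X"
  shows "rel_box Y from_rel U = f ` U"
proof (intro subset_antisym subsetI)
  fix y assume y: "y \<in> rel_box Y from_rel U"
  then have "y \<in> points Y" by (simp add: rel_box_def)
  then obtain x where x: "x \<in> points X" "y = f x" using bij by (auto simp: bij_betw_def)
  then have "(y, x) \<in> from_rel" using closed Y.ord_refl by (simp add: from_rel_def)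
  then show "y \<in> f ` U" using y x by (auto simp: rel_box_def)
next
  fix y assume "y \<in> f ` U"
  then obtain x where x: "x \<in> U" "y = f x" by blast
  then have xp: "x \<in> points X" using X.admissible_points[OF U] by blast
  have "z \<in> U" if "(y, z) \<in> from_rel" for z
    using that x xp ord X.admissible_up[OF U] by (auto simp: from_rel_def)
  then show "y \<in> rel_box Y from_rel U" using x xp closed by (auto simp: rel_box_def)
qed

lemma to_rel_hom: "to_rel \<in> hom gps X Y"
proof (rule gps_homI)
  show "to_rel \<subseteq> points X \<times> points Y" using Y.ord_points by (auto simp: to_rel_def)
  show "rel_box X to_rel V \<in> admissible X" if "V \<in> admissible Y" for V
    using that rel_box_to_rel by (auto elim: admissible_cases)
  fix x y assume *: "x \<in> points X" "y \<in> points Y" "(x, y) \<notin> to_rel"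
  then obtain V where "V \<in> admissible Y" "f x \<in> V" "y \<notin> V"
    using closed Y.ord_iff[of "f x" y] by (auto simp: to_rel_def)
  then show "\<exists>U\<in>admissible Y. to_rel `` {x} \<subseteq> U \<and> y \<notin> U"
    using Y.admissible_up by (auto simp: to_rel_def)
qed

lemma from_rel_hom: "from_rel \<in> hom gps Y X"
proof (rule gps_homI)
  show "from_rel \<subseteq> points Y \<times> points X" using Y.ord_points by (auto simp: from_rel_def)
  show "rel_box Y from_rel U \<in> admissible Y" if "U \<in> admissible X" for U
    using that rel_box_from_rel admissible_image by simp
  fix y x assume *: "y \<in> points Y" "x \<in> points X" "(y, x) \<notin> from_rel"
  then obtain V where V: "V \<in> admissible Y" "y \<in> V" "f x \<notin> V"
    using closed Y.ord_iff[of y "f x"] by (auto simp: from_rel_def)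
  then obtain U where U: "U \<in> admissible X" "V = f ` U" by (auto elim: admissible_cases)
  have "z \<in> U" if "(y, z) \<in> from_rel" for z
  proof -
    have z: "z \<in> points X" "(y, f z) \<in> gps_ord Y" using that by (auto simp: from_rel_def)
    then have "f z \<in> V" using V Y.admissible_up by blast
    then show ?thesis using U z mem_image[OF X.admissible_points] by blast
  qed
  then show "\<exists>U\<in>admissible X. from_rel `` {y} \<subseteq> U \<and> x \<notin> U" using U V by blast
qed

lemma from_to: "cmp gps X Y X from_rel to_rel = gps_ord X"
proof (rule gps_hom_eqI)
  note g = X.gps_space_axioms Y.gps_space_axioms
  show "cmp gps X Y X from_rel to_rel \<in> hom gps X X"
    by (rule gps_cmp_hom[OF g(1,2,1) to_rel_hom from_rel_hom])
  show "gps_ord X \<in> hom gps X X" by (rule gps_ide_hom[OF g(1)])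
  show "rel_box X (cmp gps X Y X from_rel to_rel) U = rel_box X (gps_ord X) U" if "U \<in> admissible X" for U
    using that rel_box_cmp[OF g(1,2,1) to_rel_hom from_rel_hom that] rel_box_ord[OF g(1)] X.admissible_upset
    by (simp add: rel_box_from_rel rel_box_to_rel)
qed

lemma to_from: "cmp gps Y X Y to_rel from_rel = gps_ord Y"
proof (rule gps_hom_eqI)
  note g = X.gps_space_axioms Y.gps_space_axioms
  show "cmp gps Y X Y to_rel from_rel \<in> hom gps Y Y"
    by (rule gps_cmp_hom[OF g(2,1,2) from_rel_hom to_rel_hom])
  show "gps_ord Y \<in> hom gps Y Y" by (rule gps_ide_hom[OF g(2)])
  fix V assume V: "V \<in> admissible Y"
  then obtain U where U: "U \<in> admissible X" "V = f ` U" by (rule admissible_cases)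
  show "rel_box Y (cmp gps Y X Y to_rel from_rel) V = rel_box Y (gps_ord Y) V"
    using U V rel_box_cmp[OF g(2,1,2) from_rel_hom to_rel_hom V] rel_box_ord[OF g(2)] Y.admissible_upset
    by (simp add: rel_box_from_rel rel_box_to_rel)
qed

end


section \<open>Renaming the points of a space\<close>

locale gps_renaming =
  fixes j :: "'a \<Rightarrow> 'b" and X :: "'a gps"
  assumes inj: "inj j"
begin

abbreviation "X' \<equiv> on_ob (gps_lift j) X"

lemma renamed_simps [simp]:
  "gps_ord X' = map_prod j j ` gps_ord X" "gps_core X' = j ` gps_core X"
  by (simp_all add: gps_lift_def)

lemma open_iff: "openin (gps_top X') V \<longleftrightarrow> (\<exists>U. openin (gps_top X) U \<and> V = j ` U)"
proof -
  have "inv j -` U \<inter> j ` points X = j ` U" if "openin (gps_top X) U" for U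
    using openin_subset[OF that] inj by (auto simp: image_iff)
  then show ?thesis unfolding gps_lift_def by (auto simp: openin_pullback_topology) metis
qed

lemma image_iff': "j x \<in> j ` U \<longleftrightarrow> x \<in> U"
  using inj by (simp add: inj_image_mem_iff)

lemma points_renamed [simp]: "points X' = j ` points X"
  using inj by (auto simp: gps_lift_def topspace_pullback_topology)

lemma open_image: "openin (gps_top X') (j ` U) \<longleftrightarrow> openin (gps_top X) U"
  using inj by (auto simp: open_iff inj_image_eq_iff)

lemma closed_image: "closedin (gps_top X') (j ` U) \<longleftrightarrow> closedin (gps_top X) U"
proof -
  have "points X' - j ` U = j ` (points X - U)" by (simp add: image_set_diff[OF inj])
  then show ?thesis unfolding closedin_def
    by (simp add: open_image inj_image_subset_iff[OF inj])
qed

lemma ord_image: "(j x, j y) \<in> gps_ord X' \<longleftrightarrow> (x, y) \<in> gps_ord X"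
  using inj by (auto simp: map_prod_def inj_eq)

lemma ord_cases:
  assumes "(u, v) \<in> gps_ord X'"
  obtains x y where "u = j x" "v = j y" "(x, y) \<in> gps_ord X"
  using assms by (auto simp: map_prod_def)

lemma upset_image: "upset X' (j ` U) \<longleftrightarrow> upset X U"
proof
  assume u: "upset X' (j ` U)"
  show "upset X U" unfolding upset_def
  proof (intro conjI allI impI; (elim conjE)?)
    show "U \<subseteq> points X" using u inj by (auto simp: upset_def inj_image_subset_iff)
    fix x y assume "x \<in> U" "(x, y) \<in> gps_ord X"
    then have "j x \<in> j ` U" "(j x, j y) \<in> gps_ord X'" by (auto simp: ord_image simp del: renamed_simps)
    then have "j y \<in> j ` U" using u unfolding upset_def by blast
    then show "y \<in> U" by (simp add: image_iff')
  qed
next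
  assume u: "upset X U"
  show "upset X' (j ` U)" unfolding upset_def
  proof (intro conjI allI impI; (elim conjE)?)
    show "j ` U \<subseteq> points X'" using u by (auto simp: upset_def)
    fix a b assume a: "a \<in> j ` U" and "(a, b) \<in> gps_ord X'"
    then obtain x y where "a = j x" "b = j y" "(x, y) \<in> gps_ord X" using ord_cases by blast
    then show "b \<in> j ` U" using a u by (auto simp: image_iff' upset_def)
  qed
qed

lemma clopen_upset_image: "clopen_upset X' (j ` U) \<longleftrightarrow> clopen_upset X U"
  by (simp add: clopen_upset_def open_image closed_image upset_image)

lemma maximal_points_image: "maximal_points X' (j ` S) = j ` maximal_points X S"
  using inj by (auto simp: maximal_points_def image_iff inj_eq simp flip: ord_image)

lemma admissible_image: "j ` U \<in> admissible X' \<longleftrightarrow> U \<in> admissible X"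
proof -
  have "points X' - j ` U = j ` (points X - U)" by (simp add: image_set_diff[OF inj])
  then have "maximal_points X' (points X' - j ` U) = j ` maximal_points X (points X - U)"
    using maximal_points_image by metis
  then show ?thesis unfolding admissible_def
    by (simp add: clopen_upset_image inj_image_subset_iff[OF inj])
qed

lemma admissible_renamed: "admissible X' = (`) j ` admissible X"
proof (intro subset_antisym subsetI)
  fix V assume V: "V \<in> admissible X'"
  then have "V \<subseteq> j ` points X" by (simp add: admissible_def clopen_upset_def upset_def)
  then obtain U where "V = j ` U" by (rule subset_imageE)
  then show "V \<in> (`) j ` admissible X" using V admissible_image by blast
qed (use admissible_image in auto)

lemma admissible_missing_renamed: "admissible_missing X' (j x) = (`) j ` admissible_missing X x"
proof -
  have "j x \<notin> j ` U \<longleftrightarrow> x \<notin> U" for U by (simp add: image_iff')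
  then show ?thesis unfolding admissible_missing_def admissible_renamed by blast
qed

lemma directed_image:
  "directed_by_inclusion ((`) j ` \<U>) \<longleftrightarrow> directed_by_inclusion \<U>"
  by (simp add: directed_by_inclusion_def inj_image_subset_iff[OF inj])

lemma gps_renamed:
  assumes "gps_space X"
  shows "gps_space X'"
proof -
  interpret gps_space X by fact
  show ?thesis unfolding gps_space_def generalized_priestley_space_def priestley_space_def
  proof (intro conjI ballI)
    have "continuous_map (gps_top X) (gps_top X') j"
    proof -
      have "{x \<in> points X. j x \<in> V} = U" if "openin (gps_top X) U" "V = j ` U" for U V
        using that openin_subset[OF that(1)] by (auto simp: image_iff')
      then show ?thesis unfolding continuous_map_def by (auto simp: open_iff)
    qed
    then have "compactin (gps_top X') (j ` points X)"
      using compact image_compactin unfolding compact_space_def by blast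
    then show "compact_space (gps_top X')" by (simp add: compact_space_def)
    show "partial_order_on (points X') (gps_ord X')"
      unfolding partial_order_on_def preorder_on_def
    proof (intro conjI)
      show "gps_ord X' \<subseteq> points X' \<times> points X'" using ord_points by auto
      show "refl_on (points X') (gps_ord X')"
        using ord_refl by (auto simp: refl_on_def ord_image simp del: renamed_simps)
      show "trans (gps_ord X')"
      proof (rule transI)
        fix a b c assume ab: "(a, b) \<in> gps_ord X'" and bc: "(b, c) \<in> gps_ord X'"
        obtain x y where 1: "a = j x" "b = j y" "(x, y) \<in> gps_ord X" using ab by (rule ord_cases)
        obtain y' z where 2: "b = j y'" "c = j z" "(y', z) \<in> gps_ord X" using bc by (rule ord_cases)
        have "y = y'" using 1 2 inj by (simp add: inj_eq)
        then have "(x, z) \<in> gps_ord X" using 1 2 ord_trans by blast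
        then show "(a, c) \<in> gps_ord X'" using 1 2 ord_image by blast
      qed
      show "antisym (gps_ord X')"
      proof (rule antisymI)
        fix a b assume ab: "(a, b) \<in> gps_ord X'" and ba: "(b, a) \<in> gps_ord X'"
        obtain x y where 1: "a = j x" "b = j y" "(x, y) \<in> gps_ord X" using ab by (rule ord_cases)
        then have "(y, x) \<in> gps_ord X" using ba ord_image by blast
        then show "a = b" using 1 ord_antisym by blast
      qed
    qed
    show "gps_core X' \<subseteq> points X'" using core_points by auto
    have "gps_core X' \<inter> V \<noteq> {}" if V: "openin (gps_top X') V" "V \<noteq> {}" for V
    proof -
      obtain U where U: "openin (gps_top X) U" "V = j ` U" using V open_iff by blast
      then obtain x where "x \<in> U" using V by blast
      with U(1) obtain y where "y \<in> gps_core X" "y \<in> U" by (rule core_meets_open)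
      then show ?thesis using U by auto
    qed
    then show "gps_top X' closure_of gps_core X' = points X'"
      using dense_intersects_open[of "gps_top X'" "gps_core X'"] by blast
  next
    fix a b assume "a \<in> points X'" "b \<in> points X'"
    then obtain x y where xy: "x \<in> points X" "y \<in> points X" "a = j x" "b = j y" by auto
    show "(a, b) \<notin> gps_ord X' \<longrightarrow> (\<exists>U. clopen_upset X' U \<and> a \<in> U \<and> b \<notin> U)"
    proof
      assume "(a, b) \<notin> gps_ord X'"
      then have "(x, y) \<notin> gps_ord X" using xy ord_image by blast
      with xy obtain U where "clopen_upset X U" "x \<in> U" "y \<notin> U" using separation[OF xy(1,2)] by blast
      then show "\<exists>U. clopen_upset X' U \<and> a \<in> U \<and> b \<notin> U"
        using xy clopen_upset_image[of U] image_iff' by blast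
    qed
    show "(a, b) \<in> gps_ord X' \<longleftrightarrow> (\<forall>U\<in>admissible X'. a \<in> U \<longrightarrow> b \<in> U)"
      using xy ord_iff[of x y] ord_image[of x y] by (simp add: admissible_renamed image_iff' del: renamed_simps)
  next
    fix a assume "a \<in> points X'"
    then obtain x where x: "x \<in> points X" "a = j x" by auto
    then obtain y where "y \<in> gps_core X" "(x, y) \<in> gps_ord X" by (elim below_core)
    then have "j y \<in> gps_core X'" "(a, j y) \<in> gps_ord X'" using x ord_image by auto
    then show "\<exists>y\<in>gps_core X'. (a, y) \<in> gps_ord X'" by blast
    show "a \<in> gps_core X' \<longleftrightarrow> directed_by_inclusion (admissible_missing X' a)"
      using x core_iff[of x] by (simp add: admissible_missing_renamed directed_image image_iff')
  qed
qed

lemma gps_iso_inv: "gps_iso X' X (inv j)"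
proof -
  have "bij_betw (inv j) (points X') (points X)"
    using inj by (simp add: bij_betw_def inj_on_def image_image)
  moreover have "inv j ` V \<in> admissible X \<longleftrightarrow> V \<in> admissible X'" if V: "V \<subseteq> points X'" for V
  proof -
    obtain U where U: "V = j ` U" using V unfolding points_renamed by (rule subset_imageE)
    then have "inv j ` V = U" using inj by (simp add: image_image)
    then show ?thesis using U admissible_image by simp
  qed
  ultimately show ?thesis by (simp add: gps_iso_def)
qed

end

lemma rel_box_renamed:
  assumes "inj j" and R: "R \<subseteq> points X \<times> points Y"
  shows "rel_box (on_ob (gps_lift j) X) (map_prod j j ` R) (j ` U) = j ` rel_box X R U"
proof -
  interpret gps_renaming j X by unfold_locales fact
  have "(map_prod j j ` R) `` {j x} = j ` (R `` {x})" for x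
    using inj by (force simp: inj_eq image_iff)
  then have "j x \<in> rel_box X' (map_prod j j ` R) (j ` U) \<longleftrightarrow> x \<in> rel_box X R U" for x
    by (simp add: rel_box_def image_iff' inj_image_subset_iff[OF inj])
  moreover have "rel_box X' (map_prod j j ` R) (j ` U) \<subseteq> j ` points X" by (auto simp: rel_box_def)
  ultimately show ?thesis by blast
qed

lemma gps_hom_renamed_iff:
  assumes j: "inj j" and R: "R \<subseteq> points X \<times> points Y"
  shows "map_prod j j ` R \<in> hom gps (on_ob (gps_lift j) X) (on_ob (gps_lift j) Y) \<longleftrightarrow> R \<in> hom gps X Y"
proof -
  interpret X: gps_renaming j X by unfold_locales fact
  interpret Y: gps_renaming j Y by unfold_locales fact
  have im: "(map_prod j j ` R) `` {j x} = j ` (R `` {x})" for x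
    using j by (force simp: inj_eq image_iff)
  have mem: "(j x, j y) \<in> map_prod j j ` R \<longleftrightarrow> (x, y) \<in> R" for x y
    using j by (auto simp: inj_eq)
  have "map_prod j j ` R \<subseteq> points X.X' \<times> points Y.X'" using R by auto
  then show ?thesis
    using R by (simp add: gps_simps(2) Y.admissible_renamed rel_box_renamed[OF j R] X.admissible_image
        im mem inj_image_subset_iff[OF j] inj_image_mem_iff[OF j])
qed

lemma fully_faithful_gps_lift:
  assumes j: "inj j"
  shows "fully_faithful (op_cat gps) (op_cat gps) (gps_lift j)"
proof -
  let ?J = "gps_lift j"
  have on_hom: "on_hom ?J X Y R = map_prod j j ` R" for X Y R by (simp add: gps_lift_def)
  have ren: "gps_renaming j" using j by (simp add: gps_renaming_def)
  have ob: "gps_space (on_ob ?J X)" if "gps_space X" for X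
    using gps_renaming.gps_renamed[OF ren that] .
  have pts: "R \<subseteq> points X \<times> points Y" if "R \<in> hom gps X Y" for X Y :: "'a gps" and R
    using that by (simp add: gps_simps)
  have hm: "map_prod j j ` R \<in> hom gps (on_ob ?J X) (on_ob ?J Y)" if "R \<in> hom gps X Y" for X Y R
    using gps_hom_renamed_iff[OF j pts[OF that]] that by simp
  have "is_functor (op_cat gps) (op_cat gps) ?J"
    unfolding is_functor_def op_cat_simps on_hom
  proof (intro conjI ballI)
    show "category (op_cat gps)" "category (op_cat gps)" by (intro category_op_cat category_gps)+
    fix Z :: "'a gps" assume Z: "Z \<in> obj gps"
    then show "on_ob ?J Z \<in> obj gps" using ob by (simp add: gps_obj)
    show "map_prod j j ` ide gps Z = ide gps (on_ob ?J Z)"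
      by (simp add: gps_simps gps_lift_def)
    fix Y S assume Y: "Y \<in> obj gps" and S: "S \<in> hom gps Y Z"
    show "map_prod j j ` S \<in> hom gps (on_ob ?J Y) (on_ob ?J Z)" by (rule hm[OF S])
    fix X R assume X: "X \<in> obj gps" and R: "R \<in> hom gps X Y"
    note g = X[unfolded gps_obj] Y[unfolded gps_obj] Z[unfolded gps_obj]
    note C = gps_cmp_hom[OF g R S]
    show "map_prod j j ` cmp gps X Y Z S R
        = cmp gps (on_ob ?J X) (on_ob ?J Y) (on_ob ?J Z) (map_prod j j ` S) (map_prod j j ` R)"
    proof (rule gps_hom_eqI[OF hm[OF C] gps_cmp_hom[OF ob[OF g(1)] ob[OF g(2)] ob[OF g(3)] hm[OF R] hm[OF S]]])
      fix V assume V: "V \<in> admissible (on_ob ?J Z)"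
      then obtain U where U: "U \<in> admissible Z" "V = j ` U"
        using gps_renaming.admissible_renamed[OF ren] by blast
      note V' = V[unfolded U(2)]
      show "rel_box (on_ob ?J X) (map_prod j j ` cmp gps X Y Z S R) V
          = rel_box (on_ob ?J X) (cmp gps (on_ob ?J X) (on_ob ?J Y) (on_ob ?J Z) (map_prod j j ` S) (map_prod j j ` R)) V"
        unfolding U(2) rel_box_cmp[OF ob[OF g(1)] ob[OF g(2)] ob[OF g(3)] hm[OF R] hm[OF S] V']
          rel_box_renamed[OF j pts[OF C]] rel_box_renamed[OF j pts[OF R]] rel_box_renamed[OF j pts[OF S]]
          rel_box_cmp[OF g R S U(1)] ..
    qed
  qed
  moreover have "bij_betw (on_hom ?J Y X) (hom gps X Y) (hom gps (on_ob ?J X) (on_ob ?J Y))"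
    for X Y :: "'a gps"
  proof (rule bij_betw_imageI)
    show "inj_on (on_hom ?J Y X) (hom gps X Y)"
      unfolding on_hom using j by (intro inj_onI) (simp add: inj_image_eq_iff prod.inj_map)
    show "on_hom ?J Y X ` hom gps X Y = hom gps (on_ob ?J X) (on_ob ?J Y)"
    proof (intro subset_antisym subsetI)
      fix Q assume Q: "Q \<in> hom gps (on_ob ?J X) (on_ob ?J Y)"
      define R where "R = {(x, y). (j x, j y) \<in> Q}"
      have QJ: "Q \<subseteq> j ` points X \<times> j ` points Y"
        using gps_hom_points[OF Q] gps_renaming.points_renamed[OF ren] by auto
      then have Q_eq: "Q = map_prod j j ` R" by (force simp: R_def)
      have "R \<subseteq> points X \<times> points Y"
        unfolding R_def using QJ inj_image_mem_iff[OF j] by blast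
      then have "R \<in> hom gps X Y" using Q Q_eq gps_hom_renamed_iff[OF j] by simp
      then show "Q \<in> on_hom ?J Y X ` hom gps X Y" using Q_eq on_hom by blast
    qed (use hm on_hom in auto)
  qed
  ultimately show ?thesis by (simp add: fully_faithful_def)
qed

definition natural_gps_iso where
  "natural_gps_iso T f \<longleftrightarrow>
     (\<forall>X\<in>obj gps. gps_iso X (on_ob T X) (f X)) \<and>
     (\<forall>X\<in>obj gps. \<forall>Y\<in>obj gps. \<forall>R\<in>hom gps X Y. \<forall>U\<in>admissible Y.
        rel_box (on_ob T X) (on_hom T Y X R) (f Y ` U) = f X ` rel_box X R U)"

text \<open>As for ordered sets, a family of bijections that match admissible sets replaces a natural
  isomorphism into the lifting functor. Naturality is checked on box operators.\<close>

lemma naturally_isomorphic_gps_lift: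
  assumes j: "inj j" and T: "is_functor (op_cat gps) (op_cat gps) T" and f: "natural_gps_iso T f"
  shows "naturally_isomorphic (op_cat gps) (op_cat gps) T (gps_lift j)"
proof -
  let ?J = "gps_lift j"
  have J: "is_functor (op_cat gps) (op_cat gps) ?J"
    using fully_faithful_gps_lift[OF j] by (simp add: fully_faithful_def)
  have ren: "gps_renaming j" using j by (simp add: gps_renaming_def)
  define g where "g X = f X \<circ> inv j" for X
  have iso: "gps_isomorphism (on_ob ?J X) (on_ob T X) (g X)" if X: "X \<in> obj gps" for X
  proof -
    have "gps_space (on_ob T X)" "gps_space (on_ob ?J X)"
      using functor_ob[OF T, of X] functor_ob[OF J, of X] X by (simp_all add: gps_obj)
    moreover have "gps_iso (on_ob ?J X) (on_ob T X) (g X)"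
      unfolding g_def using f X gps_renaming.gps_iso_inv[OF ren]
      by (auto simp: natural_gps_iso_def intro: gps_iso_comp)
    ultimately show ?thesis by (simp add: gps_isomorphism_def gps_isomorphism_axioms_def)
  qed
  define \<eta> where "\<eta> X = gps_isomorphism.to_rel (on_ob ?J X) (on_ob T X) (g X)" for X
  define \<theta> where "\<theta> X = gps_isomorphism.from_rel (on_ob ?J X) (on_ob T X) (g X)" for X
  have "inverse_natural_families (op_cat gps) (op_cat gps) T ?J \<eta> \<theta>"
    unfolding inverse_natural_families_def op_cat_simps gps_simps(3)
  proof (intro conjI ballI T J)
    fix Y :: "'a gps" assume Y: "Y \<in> obj gps"
    note iY = iso[OF Y]
    show "\<eta> Y \<in> hom gps (on_ob ?J Y) (on_ob T Y)" "\<theta> Y \<in> hom gps (on_ob T Y) (on_ob ?J Y)"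
      "cmp gps (on_ob T Y) (on_ob ?J Y) (on_ob T Y) (\<eta> Y) (\<theta> Y) = gps_ord (on_ob T Y)"
      "cmp gps (on_ob ?J Y) (on_ob T Y) (on_ob ?J Y) (\<theta> Y) (\<eta> Y) = gps_ord (on_ob ?J Y)"
      unfolding \<eta>_def \<theta>_def
      by (fact gps_isomorphism.to_rel_hom[OF iY] gps_isomorphism.from_rel_hom[OF iY]
          gps_isomorphism.to_from[OF iY] gps_isomorphism.from_to[OF iY])+
    fix X R assume X: "X \<in> obj gps" and R: "R \<in> hom gps X Y"
    note iX = iso[OF X]
    have TR: "on_hom T Y X R \<in> hom gps (on_ob T X) (on_ob T Y)"
      using functor_hom[OF T, of Y X R] X Y R by simp
    have JR: "on_hom ?J Y X R \<in> hom gps (on_ob ?J X) (on_ob ?J Y)"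
      using functor_hom[OF J, of Y X R] X Y R by simp
    have sp: "gps_space (on_ob ?J X)" "gps_space (on_ob T X)" "gps_space (on_ob ?J Y)" "gps_space (on_ob T Y)"
      using iX iY by (auto simp: gps_isomorphism_def)
    have \<eta>: "\<eta> X \<in> hom gps (on_ob ?J X) (on_ob T X)" "\<eta> Y \<in> hom gps (on_ob ?J Y) (on_ob T Y)"
      unfolding \<eta>_def using gps_isomorphism.to_rel_hom[OF iX] gps_isomorphism.to_rel_hom[OF iY] by auto
    have g: "g Z ` j ` U = f Z ` U" for Z U using j by (simp add: g_def image_image)
    have Rp: "R \<subseteq> points X \<times> points Y" using R by (simp add: gps_simps)
    show "cmp gps (on_ob ?J X) (on_ob T X) (on_ob T Y) (on_hom T Y X R) (\<eta> X)
        = cmp gps (on_ob ?J X) (on_ob ?J Y) (on_ob T Y) (\<eta> Y) (on_hom ?J Y X R)"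
    proof (rule gps_hom_eqI[OF gps_cmp_hom[OF sp(1,2,4) \<eta>(1) TR] gps_cmp_hom[OF sp(1,3,4) JR \<eta>(2)]])
      fix V assume V: "V \<in> admissible (on_ob T Y)"
      then obtain V' where V': "V' \<in> admissible (on_ob ?J Y)" "V = g Y ` V'"
        by (rule gps_isomorphism.admissible_cases[OF iY])
      then obtain U where U: "U \<in> admissible Y" "V' = j ` U"
        using gps_renaming.admissible_renamed[OF ren] by blast
      have VU: "V = f Y ` U" using V' U g by simp
      have bU: "rel_box X R U \<in> admissible X" by (rule gps_hom_box[OF R U(1)])
      have "rel_box (on_ob ?J X) (\<eta> X) (rel_box (on_ob T X) (on_hom T Y X R) V)
          = rel_box (on_ob ?J X) (\<eta> X) (g X ` j ` rel_box X R U)"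
        using f X Y R U(1) unfolding natural_gps_iso_def VU g by simp
      also have "\<dots> = j ` rel_box X R U"
        unfolding \<eta>_def using gps_isomorphism.rel_box_to_rel[OF iX] gps_renaming.admissible_image[OF ren] bU by blast
      also have "\<dots> = rel_box (on_ob ?J X) (on_hom ?J Y X R) (j ` U)"
        using rel_box_renamed[OF j Rp] by (simp add: gps_lift_def)
      also have "j ` U = rel_box (on_ob ?J Y) (\<eta> Y) V"
        unfolding \<eta>_def V'(2) using gps_isomorphism.rel_box_to_rel[OF iY V'(1)] U(2) by simp
      finally show "rel_box (on_ob ?J X) (cmp gps (on_ob ?J X) (on_ob T X) (on_ob T Y) (on_hom T Y X R) (\<eta> X)) V
          = rel_box (on_ob ?J X) (cmp gps (on_ob ?J X) (on_ob ?J Y) (on_ob T Y) (\<eta> Y) (on_hom ?J Y X R)) V"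
        unfolding rel_box_cmp[OF sp(1,2,4) \<eta>(1) TR V] rel_box_cmp[OF sp(1,3,4) JR \<eta>(2) V] .
    qed
  qed
  then show ?thesis unfolding naturally_isomorphic_iff by blast
qed


section \<open>Prime and pseudoprime elements\<close>

context compact_frame
begin

lemma finite_chain_max:
  assumes "finite T" "T \<noteq> {}" "T \<subseteq> carrier L" "\<And>x y. x \<in> T \<Longrightarrow> y \<in> T \<Longrightarrow> x \<sqsubseteq> y \<or> y \<sqsubseteq> x"
  shows "\<exists>m\<in>T. \<forall>x\<in>T. x \<sqsubseteq> m"
  using assms
proof (induction rule: finite_ne_induct)
  case (insert x T)
  then obtain m where m: "m \<in> T" "\<forall>y\<in>T. y \<sqsubseteq> m" by auto
  from insert.prems m consider "x \<sqsubseteq> m" | "m \<sqsubseteq> x" by blast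
  then show ?case
  proof cases
    case 1
    then show ?thesis using m by blast
  next
    case 2
    have "y \<sqsubseteq> x" if "y \<in> T" for y
      using le_trans[of y m x] m that 2 insert.prems by blast
    then show ?thesis using insert.prems by auto
  qed
qed auto

text \<open>An element that is maximal with respect to being above \<open>a\<close> and above no member of a
  down-directed family of compact elements is prime. The family will be a single compact element, or
  the principal ideals of finite meets.\<close>

lemma exists_prime:
  assumes a: "a \<in> carrier L" and F: "F \<subseteq> compact_elements L" "F \<noteq> {}"
    and dir: "\<And>c d. c \<in> F \<Longrightarrow> d \<in> F \<Longrightarrow> \<exists>e\<in>F. e \<sqsubseteq> c \<and> e \<sqsubseteq> d"
    and avoid: "\<And>c. c \<in> F \<Longrightarrow> \<not> c \<sqsubseteq> a"
  obtains q where "q \<in> prime_elements L" "a \<sqsubseteq> q" "\<And>c. c \<in> F \<Longrightarrow> \<not> c \<sqsubseteq> q"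
proof -
  define S where "S = {q \<in> carrier L. a \<sqsubseteq> q \<and> (\<forall>c\<in>F. \<not> c \<sqsubseteq> q)}"
  have aS: "a \<in> S" using a avoid by (auto simp: S_def)
  have FL: "c \<in> carrier L" if "c \<in> F" for c using that F compact_carrier by blast
  have "\<exists>m\<in>S. \<forall>x\<in>S. m \<sqsubseteq> x \<longrightarrow> x = m"
  proof (rule predicate_Zorn)
    show "partial_order_on S (relation_of (\<sqsubseteq>) S)"
      unfolding partial_order_on_def preorder_on_def
    proof (intro conjI)
      show "trans (relation_of (\<sqsubseteq>) S)"
        by (rule transI) (auto simp: relation_of_def S_def intro: le_trans)
      show "antisym (relation_of (\<sqsubseteq>) S)"
        by (rule antisymI) (auto simp: relation_of_def S_def)
    qed (auto simp: relation_of_def refl_on_def S_def)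
    fix C assume "C \<in> Chains (relation_of (\<sqsubseteq>) S)"
    then have C: "C \<subseteq> S" "\<And>x y. x \<in> C \<Longrightarrow> y \<in> C \<Longrightarrow> x \<sqsubseteq> y \<or> y \<sqsubseteq> x"
      by (auto simp: Chains_def relation_of_def)
    then have CL: "C \<subseteq> carrier L" by (auto simp: S_def)
    show "\<exists>u\<in>S. \<forall>x\<in>C. x \<sqsubseteq> u"
    proof (cases "C = {}")
      case False
      then obtain x where x: "x \<in> C" by blast
      have "a \<sqsubseteq> \<Squnion>C" using le_trans[of a x "\<Squnion>C"] x C CL a sup_upper[OF CL x] by (auto simp: S_def)
      moreover have "\<not> c \<sqsubseteq> \<Squnion>C" if c: "c \<in> F" for c
      proof
        assume "c \<sqsubseteq> \<Squnion>C"
        then obtain T where T: "finite T" "T \<subseteq> C" "c \<sqsubseteq> \<Squnion>T"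
          using compact_cover[of c C] c F CL by blast
        \<comment> \<open>The set \<open>T\<close> may be empty; with a member of the chain added it has a greatest element.\<close>
        define T' where "T' = insert x T"
        have T'C: "finite T'" "T' \<noteq> {}" "T' \<subseteq> C" using T x by (auto simp: T'_def)
        then obtain m where m: "m \<in> T'" "\<forall>y\<in>T'. y \<sqsubseteq> m"
        proof -
          have "T' \<subseteq> carrier L" "\<And>y z. y \<in> T' \<Longrightarrow> z \<in> T' \<Longrightarrow> y \<sqsubseteq> z \<or> z \<sqsubseteq> y"
            using T'C(3) CL C(2) by (blast, meson subsetD)
          from finite_chain_max[OF T'C(1,2) this] show thesis using that by blast
        qed
        have mL: "m \<in> carrier L" "T \<subseteq> carrier L" using m T'C T CL by auto
        have "\<Squnion>T \<sqsubseteq> m" using m mL by (intro sup_least) (auto simp: T'_def)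
        then have "c \<sqsubseteq> m" using le_trans[OF T(3)] FL[OF c] mL by simp
        then show False using m T'C C c by (auto simp: S_def)
      qed
      ultimately have "\<Squnion>C \<in> S" using CL by (simp add: S_def)
      then show ?thesis using sup_upper[OF CL] by blast
    qed (use aS in blast)
  qed
  then obtain q where q: "q \<in> S" "\<And>x. x \<in> S \<Longrightarrow> q \<sqsubseteq> x \<Longrightarrow> x = q" by blast
  then have qL: "q \<in> carrier L" and aq: "a \<sqsubseteq> q" and cq: "\<And>c. c \<in> F \<Longrightarrow> \<not> c \<sqsubseteq> q" by (auto simp: S_def)
  have above: "\<exists>c\<in>F. c \<sqsubseteq> q \<squnion> x" if x: "x \<in> carrier L" "\<not> x \<sqsubseteq> q" for x
  proof (rule ccontr)
    assume n: "\<not> (\<exists>c\<in>F. c \<sqsubseteq> q \<squnion> x)"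
    have "a \<sqsubseteq> q \<squnion> x" using le_trans[OF aq join_left[OF qL x(1)]] a qL x by simp
    then have "q \<squnion> x \<in> S" using n qL x by (simp add: S_def)
    then have "q \<squnion> x = q" using q(2) join_left[OF qL x(1)] by blast
    then show False using x join_right[OF qL x(1)] by simp
  qed
  have "q \<in> prime_elements L" unfolding prime_elements_def
  proof (intro CollectI conjI ballI impI)
    show "q \<in> carrier L" by (rule qL)
    show "q \<noteq> \<top>" using cq F(2) FL by auto
    fix x y assume xy: "x \<in> carrier L" "y \<in> carrier L" "x \<sqinter> y \<sqsubseteq> q"
    show "x \<sqsubseteq> q \<or> y \<sqsubseteq> q"
    proof (rule ccontr)
      assume "\<not> (x \<sqsubseteq> q \<or> y \<sqsubseteq> q)"
      then obtain c d where cd: "c \<in> F" "d \<in> F" "c \<sqsubseteq> q \<squnion> x" "d \<sqsubseteq> q \<squnion> y"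
        using above[OF xy(1)] above[OF xy(2)] by metis
      then obtain e where e: "e \<in> F" "e \<sqsubseteq> c" "e \<sqsubseteq> d" using dir by blast
      have eL: "e \<in> carrier L" using FL e by blast
      have "e \<sqsubseteq> q \<squnion> x" "e \<sqsubseteq> q \<squnion> y"
        using le_trans[OF e(2) cd(3)] le_trans[OF e(3) cd(4)] FL cd eL qL xy by simp_all
      then have "e \<sqsubseteq> (q \<squnion> x) \<sqinter> (q \<squnion> y)" using eL qL xy by (intro meet_le) auto
      also have "(q \<squnion> x) \<sqinter> (q \<squnion> y) = ((q \<squnion> x) \<sqinter> q) \<squnion> (y \<sqinter> (q \<squnion> x))"
        using meet_join_distrib[of "q \<squnion> x" q y] qL xy by (simp add: meet_comm)
      also have "y \<sqinter> (q \<squnion> x) = (y \<sqinter> q) \<squnion> (x \<sqinter> y)"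
        using meet_join_distrib[of y q x] qL xy by (simp add: meet_comm)
      finally have e': "e \<sqsubseteq> ((q \<squnion> x) \<sqinter> q) \<squnion> ((y \<sqinter> q) \<squnion> (x \<sqinter> y))" .
      have "((q \<squnion> x) \<sqinter> q) \<squnion> ((y \<sqinter> q) \<squnion> (x \<sqinter> y)) \<sqsubseteq> q"
        using qL xy meet_right[of "q \<squnion> x" q] meet_right[of y q] by (intro join_le) auto
      then have "e \<sqsubseteq> q" using le_trans[OF e'] eL qL xy by simp
      then show False using cq e by blast
    qed
  qed
  then show thesis using that aq cq by blast
qed

lemma exists_prime_above:
  assumes "a \<in> carrier L" "b \<in> carrier L" "\<not> b \<sqsubseteq> a"
  shows "\<exists>q\<in>prime_elements L. a \<sqsubseteq> q \<and> \<not> b \<sqsubseteq> q"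
proof -
  obtain c where c: "c \<in> compact_elements L" "c \<sqsubseteq> b" "\<not> c \<sqsubseteq> a"
    using compact_below[OF assms(2,1,3)] by blast
  obtain q where q: "q \<in> prime_elements L" "a \<sqsubseteq> q" "\<And>d. d \<in> {c} \<Longrightarrow> \<not> d \<sqsubseteq> q"
    by (rule exists_prime[OF assms(1), of "{c}"]) (use c compact_carrier in auto)
  have "q \<in> carrier L" using q by (simp add: prime_elements_def)
  then have "\<not> b \<sqsubseteq> q" using q(3)[of c] le_trans[OF c(2)] c(1) assms compact_carrier by blast
  then show ?thesis using q by blast
qed

lemma finite_meet_prime:
  assumes P: "\<top> \<notin> P" "\<And>x y. x \<in> carrier L \<Longrightarrow> y \<in> carrier L \<Longrightarrow> x \<sqinter> y \<in> P \<Longrightarrow> x \<in> P \<or> y \<in> P"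
    and A: "finite A" "A \<subseteq> carrier L" "\<Sqinter>A \<in> P"
  shows "\<exists>a\<in>A. a \<in> P"
  using A
proof (induction A)
  case empty
  then show ?case using P(1) weak_inf_empty by (simp add: eq_is_equal)
next
  case (insert x A)
  then have "\<Sqinter>(insert x A) = x \<sqinter> \<Sqinter>A" using weak_inf_insert[of x A] by (simp add: eq_is_equal)
  then show ?case using P(2)[of x "\<Sqinter>A"] insert by auto
qed

lemma prime_finite_meet:
  assumes p: "p \<in> prime_elements L" and A: "finite A" "A \<subseteq> carrier L" "\<Sqinter>A \<sqsubseteq> p"
  shows "\<exists>a\<in>A. a \<sqsubseteq> p"
proof -
  have pL: "p \<in> carrier L" "p \<noteq> \<top>" using p by (auto simp: prime_elements_def)
  then have "\<not> \<top> \<sqsubseteq> p" by (auto intro: le_antisym)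
  then have "\<exists>a\<in>A. a \<in> {x. x \<sqsubseteq> p}"
    using p A by (intro finite_meet_prime) (auto simp: prime_elements_def)
  then show ?thesis by simp
qed

lemma
  assumes "p \<in> pseudoprime_elements L"
  shows pseudoprime_carrier: "p \<in> carrier L"
    and pseudoprime_top: "\<not> \<top> \<sqsubseteq> p"
    and pseudoprime_finite_meet: "\<lbrakk>finite A; A \<subseteq> carrier L; k \<in> compact_elements L; \<Sqinter>A \<sqsubseteq> k; k \<sqsubseteq> p\<rbrakk>
      \<Longrightarrow> \<exists>a\<in>A. a \<sqsubseteq> p"
proof -
  show p: "p \<in> carrier L" using assms by (simp add: pseudoprime_elements_def)
  have "p \<noteq> \<top>" using assms by (simp add: pseudoprime_elements_def)
  then show top: "\<not> \<top> \<sqsubseteq> p" using p by (auto intro: le_antisym)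
  assume *: "finite A" "A \<subseteq> carrier L" "k \<in> compact_elements L" "\<Sqinter>A \<sqsubseteq> k" "k \<sqsubseteq> p"
  then have w: "way_below L (\<Sqinter>A) p" using way_below_iff_compact[of "\<Sqinter>A" p] p inf_closed by blast
  have "A \<noteq> {}"
  proof
    assume "A = {}"
    then have "\<Sqinter>A = \<top>" using weak_inf_empty by (simp add: eq_is_equal)
    then show False using * top le_trans[of \<top> k p] p compact_carrier by auto
  qed
  then show "\<exists>a\<in>A. a \<sqsubseteq> p" using assms w * by (simp add: pseudoprime_elements_def)
qed

lemma pseudoprimeI:
  assumes p: "p \<in> carrier L" "\<not> \<top> \<sqsubseteq> p"
    and "\<And>A k. \<lbrakk>finite A; A \<subseteq> carrier L; k \<in> compact_elements L; \<Sqinter>A \<sqsubseteq> k; k \<sqsubseteq> p\<rbrakk> \<Longrightarrow> \<exists>a\<in>A. a \<sqsubseteq> p"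
  shows "p \<in> pseudoprime_elements L"
  unfolding pseudoprime_elements_def
proof (intro CollectI conjI allI impI; (elim conjE)?)
  fix A assume "finite A" "A \<subseteq> carrier L" "way_below L (\<Sqinter>A) p"
  then show "\<exists>a\<in>A. a \<sqsubseteq> p" using way_below_iff_compact[of "\<Sqinter>A" p] p assms(3) by auto
qed (use p in auto)

lemma prime_pseudoprime: "prime_elements L \<subseteq> pseudoprime_elements L"
proof
  fix p assume p: "p \<in> prime_elements L"
  then have pL: "p \<in> carrier L" "p \<noteq> \<top>" by (auto simp: prime_elements_def)
  show "p \<in> pseudoprime_elements L"
  proof (rule pseudoprimeI)
    show "\<not> \<top> \<sqsubseteq> p" using pL by (auto intro: le_antisym)
    fix A k assume *: "finite A" "A \<subseteq> carrier L" "k \<in> compact_elements L" "\<Sqinter>A \<sqsubseteq> k" "k \<sqsubseteq> p"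
    have "\<Sqinter>A \<sqsubseteq> p" using le_trans[OF *(4,5)] * pL compact_carrier by simp
    then show "\<exists>a\<in>A. a \<sqsubseteq> p" by (rule prime_finite_meet[OF p *(1,2)])
  qed (rule pL)
qed

text \<open>The ideals of \<open>L\<close> are the filters of its order dual, so the results on filter frames apply to
  them.\<close>

lemma bounded_distributive_dual: "bounded_distributive_semilattice (inv_gorder L)"
proof
  show "bounded_distributive_meet_semilattice (inv_gorder L)"
    unfolding bounded_distributive_meet_semilattice_def
  proof (intro conjI ballI impI)
    interpret dual: partial_order "inv_gorder L" by (rule dual_order)
    show "lower_semilattice (inv_gorder L)"
      by unfold_locales (simp add: sup_of_two_exists)
    show "\<exists>t. greatest (inv_gorder L) t (carrier (inv_gorder L))"
      using bottom_least by auto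
    show "\<exists>z. least (inv_gorder L) z (carrier (inv_gorder L))"
      using top_greatest by auto
    fix a b c assume "a \<in> carrier (inv_gorder L)" "b \<in> carrier (inv_gorder L)"
      "c \<in> carrier (inv_gorder L)" "a \<sqinter>\<^bsub>inv_gorder L\<^esub> b \<sqsubseteq>\<^bsub>inv_gorder L\<^esub> c"
    then have *: "a \<in> carrier L" "b \<in> carrier L" "c \<in> carrier L" "c \<sqsubseteq> a \<squnion> b" by auto
    then have "(c \<sqinter> a) \<squnion> (c \<sqinter> b) = c \<sqinter> (a \<squnion> b)" by (simp add: meet_join_distrib)
    also have "\<dots> = c" using * by (intro meet_eqI) auto
    finally show "\<exists>a'\<in>carrier (inv_gorder L). \<exists>b'\<in>carrier (inv_gorder L).
      a \<sqsubseteq>\<^bsub>inv_gorder L\<^esub> a' \<and> b \<sqsubseteq>\<^bsub>inv_gorder L\<^esub> b' \<and> a' \<sqinter>\<^bsub>inv_gorder L\<^esub> b' = c"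
      using * by (intro bexI[of _ "c \<sqinter> a"] bexI[of _ "c \<sqinter> b"]) (auto simp: meet_right)
  qed
qed

abbreviation "ideals \<equiv> mfilters (inv_gorder L)"

lemma ideal_iff:
  "I \<in> ideals \<longleftrightarrow> I \<subseteq> carrier L \<and> \<bottom> \<in> I \<and> (\<forall>a\<in>I. \<forall>b\<in>carrier L. b \<sqsubseteq> a \<longrightarrow> b \<in> I) \<and>
     (\<forall>a\<in>I. \<forall>b\<in>I. a \<squnion> b \<in> I)"
proof -
  interpret dual: bounded_distributive_semilattice "inv_gorder L" by (rule bounded_distributive_dual)
  show ?thesis
    using dual.filter_top[of I] by (auto simp: mfilters_def)
qed

lemma finite_Sup_ideal:
  assumes "I \<in> ideals" "finite T" "T \<subseteq> I"
  shows "\<Squnion>T \<in> I"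
  using assms(2,3)
proof (induction T)
  case empty
  have "\<Squnion>{} = \<bottom>" using weak_sup_empty by (simp add: eq_is_equal)
  then show ?case using assms(1) unfolding ideal_iff by simp
next
  case (insert x T)
  then have "x \<in> carrier L" "T \<subseteq> carrier L" using assms(1) by (auto simp: ideal_iff)
  then have "\<Squnion>(insert x T) = x \<squnion> \<Squnion>T" using weak_sup_insert[of x T] by (simp add: eq_is_equal)
  then show ?case using insert assms(1) by (auto simp: ideal_iff)
qed

lemma compact_in_ideal:
  assumes I: "I \<in> ideals" and k: "k \<in> compact_elements L" "k \<sqsubseteq> \<Squnion>I"
  shows "k \<in> I"
proof -
  have "I \<subseteq> carrier L" using I by (simp add: ideal_iff)
  then obtain T where T: "finite T" "T \<subseteq> I" "k \<sqsubseteq> \<Squnion>T" using compact_cover k by metis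
  then have "\<Squnion>T \<in> I" using finite_Sup_ideal I by blast
  then show ?thesis using I T k compact_carrier unfolding ideal_iff by blast
qed

text \<open>A compact element below the join of an ideal belongs to the ideal, so primeness of the ideal
  applies to every finite meet that is way below the join.\<close>

lemma Sup_prime_ideal:
  assumes I: "I \<in> ideals" "\<top> \<notin> I"
    and prime: "\<And>x y. x \<in> carrier L \<Longrightarrow> y \<in> carrier L \<Longrightarrow> x \<sqinter> y \<in> I \<Longrightarrow> x \<in> I \<or> y \<in> I"
  shows "\<Squnion>I \<in> pseudoprime_elements L"
proof (rule pseudoprimeI)
  have IL: "I \<subseteq> carrier L" using I by (simp add: ideal_iff)
  show "\<Squnion>I \<in> carrier L" using IL by simp
  show "\<not> \<top> \<sqsubseteq> \<Squnion>I" using compact_in_ideal[OF I(1) top_compact] I(2) by blast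
  fix A k assume *: "finite A" "A \<subseteq> carrier L" "k \<in> compact_elements L" "\<Sqinter>A \<sqsubseteq> k" "k \<sqsubseteq> \<Squnion>I"
  have "k \<in> I" using compact_in_ideal[OF I(1)] * by blast
  then have "\<Sqinter>A \<in> I" using * I(1) by (auto simp: ideal_iff)
  then have "\<exists>a\<in>A. a \<in> I" using finite_meet_prime[OF I(2) prime] * by blast
  then show "\<exists>a\<in>A. a \<sqsubseteq> \<Squnion>I" using sup_upper[OF IL] by blast
qed

text \<open>The elements way below \<open>b\<close> form an ideal, and the elements above finite meets of members of \<open>A\<close>
  a filter disjoint from it. A prime ideal separates the two, and its join is the pseudoprime. The
  prime ideal comes from \<open>exists_prime\<close>, applied in the frame of ideals of \<open>L\<close>.\<close>

lemma exists_pseudoprime: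
  assumes b: "b \<in> carrier L" and A: "A \<subseteq> carrier L"
    and avoid: "\<And>A' k. \<lbrakk>finite A'; A' \<subseteq> A; k \<in> compact_elements L; k \<sqsubseteq> b\<rbrakk> \<Longrightarrow> \<not> \<Sqinter>A' \<sqsubseteq> k"
  obtains p where "p \<in> pseudoprime_elements L" "b \<sqsubseteq> p"
    "\<And>a. a \<in> A \<Longrightarrow> a \<in> compact_elements L \<Longrightarrow> \<not> a \<sqsubseteq> p"
proof -
  interpret dual: bounded_distributive_semilattice "inv_gorder L" by (rule bounded_distributive_dual)
  let ?I = "filter_frame (inv_gorder L)"
  interpret I: compact_frame ?I
    using dual.compact_algebraic_frame_filter_frame by (rule compact_frame.intro)
  let ?d = "up_set (inv_gorder L)"
  have d: "?d x = {y \<in> carrier L. y \<sqsubseteq> x}" for x by (simp add: up_set_def)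
  define B where "B = {x \<in> carrier L. \<exists>k\<in>compact_elements L. x \<sqsubseteq> k \<and> k \<sqsubseteq> b}"
  have B: "B \<in> ideals" unfolding ideal_iff
  proof (intro conjI ballI impI)
    show "\<bottom> \<in> B" using bottom_compact b by (auto simp: B_def intro!: bexI[of _ \<bottom>])
    fix x assume x: "x \<in> B"
    then obtain k where k: "x \<in> carrier L" "k \<in> compact_elements L" "x \<sqsubseteq> k" "k \<sqsubseteq> b"
      by (auto simp: B_def)
    show "y \<in> B" if "y \<in> carrier L" "y \<sqsubseteq> x" for y
      using le_trans[OF that(2) k(3)] that k compact_carrier by (auto simp: B_def)
    fix y assume y: "y \<in> B"
    then obtain l where l: "y \<in> carrier L" "l \<in> compact_elements L" "y \<sqsubseteq> l" "l \<sqsubseteq> b"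
      by (auto simp: B_def)
    have kl: "k \<in> carrier L" "l \<in> carrier L" using k l compact_carrier by auto
    have "x \<sqsubseteq> k \<squnion> l" "y \<sqsubseteq> k \<squnion> l"
      using le_trans[OF k(3) join_left[OF kl]] le_trans[OF l(3) join_right[OF kl]] k l kl by simp_all
    then have "x \<squnion> y \<sqsubseteq> k \<squnion> l" using k l kl by (intro join_le) auto
    moreover have "k \<squnion> l \<sqsubseteq> b" using k l kl b by (intro join_le) auto
    ultimately show "x \<squnion> y \<in> B" using k l join_compact[OF k(2) l(2)] by (auto simp: B_def)
  qed (auto simp: B_def)
  \<comment> \<open>The empty meet contributes the principal ideal of \<open>\<top>\<close>, which makes the prime ideal proper.\<close>
  define F where "F = {?d (\<Sqinter>A') |A'. finite A' \<and> A' \<subseteq> A}"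
  obtain Q where Q: "Q \<in> prime_elements ?I" "B \<subseteq> Q" "\<And>c. c \<in> F \<Longrightarrow> \<not> c \<subseteq> Q"
  proof (rule I.exists_prime[of B F])
    show "B \<in> carrier ?I" using B by simp
    show "F \<subseteq> compact_elements ?I"
      using A inf_closed by (auto simp: F_def dual.compact_elements_filter_frame)
    show "F \<noteq> {}" by (auto simp: F_def)
    fix c assume "c \<in> F"
    then obtain A' where A': "finite A'" "A' \<subseteq> A" "c = ?d (\<Sqinter>A')" by (auto simp: F_def)
    then have "\<Sqinter>A' \<in> c" using A by (auto simp: d)
    moreover have "\<Sqinter>A' \<notin> B" using avoid[OF A'(1,2)] by (auto simp: B_def)
    ultimately show "\<not> c \<sqsubseteq>\<^bsub>?I\<^esub> B" by auto
    fix e assume "e \<in> F"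
    then obtain A'' where A'': "finite A''" "A'' \<subseteq> A" "e = ?d (\<Sqinter>A'')" by (auto simp: F_def)
    have sub: "A' \<subseteq> carrier L" "A'' \<subseteq> carrier L" "A' \<union> A'' \<subseteq> carrier L" using A' A'' A by auto
    have le: "\<Sqinter>(A' \<union> A'') \<sqsubseteq> \<Sqinter>A'" "\<Sqinter>(A' \<union> A'') \<sqsubseteq> \<Sqinter>A''"
      using sub inf_lower[OF sub(3)] by (auto intro!: inf_greatest)
    have "y \<sqsubseteq> \<Sqinter>A'" "y \<sqsubseteq> \<Sqinter>A''" if "y \<in> ?d (\<Sqinter>(A' \<union> A''))" for y
      using that le_trans[OF _ le(1), of y] le_trans[OF _ le(2), of y] sub by (auto simp: d)
    then have "?d (\<Sqinter>(A' \<union> A'')) \<subseteq> c" "?d (\<Sqinter>(A' \<union> A'')) \<subseteq> e"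
      unfolding A'(3) A''(3) by (auto simp: d)
    then show "\<exists>g\<in>F. g \<sqsubseteq>\<^bsub>?I\<^esub> c \<and> g \<sqsubseteq>\<^bsub>?I\<^esub> e"
      using A' A'' unfolding F_def by (intro bexI[of _ "?d (\<Sqinter>(A' \<union> A''))"]) auto
  qed (use that in auto)
  have QI: "Q \<in> ideals" and Qtop: "Q \<noteq> carrier L"
    using Q(1) dual.filters_top by (auto simp: prime_elements_def)
  have QL: "Q \<subseteq> carrier L" using QI by (simp add: ideal_iff)
  have "\<top> \<notin> Q" using QI Qtop by (auto simp: ideal_iff)
  moreover have "x \<in> Q \<or> y \<in> Q" if xy: "x \<in> carrier L" "y \<in> carrier L" "x \<sqinter> y \<in> Q" for x y
  proof -
    have dxy: "?d x \<in> ideals" "?d y \<in> ideals" using dual.up_set_filter xy by auto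
    have "z \<in> Q" if "z \<in> ?d x \<inter> ?d y" for z
    proof -
      have "z \<sqsubseteq> x \<sqinter> y" "z \<in> carrier L" using that xy by (auto simp: d intro!: meet_le)
      then show ?thesis using QI xy unfolding ideal_iff by blast
    qed
    then have "?d x \<sqinter>\<^bsub>?I\<^esub> ?d y \<subseteq> Q" using dual.filters_meet[OF dxy] by auto
    then have "?d x \<subseteq> Q \<or> ?d y \<subseteq> Q" using Q(1) dxy by (simp add: prime_elements_def)
    then show ?thesis using xy by (auto simp: d)
  qed
  ultimately have "\<Squnion>Q \<in> pseudoprime_elements L" by (rule Sup_prime_ideal[OF QI])
  moreover have "b \<sqsubseteq> \<Squnion>Q"
  proof -
    have "k \<sqsubseteq> \<Squnion>Q" if "k \<in> {k \<in> compact_elements L. k \<sqsubseteq> b}" for k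
    proof -
      have "k \<in> B" using that compact_carrier[of k] le_refl[of k] unfolding B_def by blast
      then show ?thesis using Q(2) sup_upper[OF QL] by blast
    qed
    then have "\<Squnion>{k \<in> compact_elements L. k \<sqsubseteq> b} \<sqsubseteq> \<Squnion>Q"
      using QL compact_carrier by (intro sup_least) auto
    then show ?thesis using compacts_below[OF b] by simp
  qed
  moreover have "\<not> a \<sqsubseteq> \<Squnion>Q" if "a \<in> A" "a \<in> compact_elements L" for a
  proof
    assume "a \<sqsubseteq> \<Squnion>Q"
    then have "a \<in> Q" using compact_in_ideal[OF QI] that by blast
    moreover have "\<Sqinter>{a} = a" using compact_carrier[OF that(2)] by simp
    ultimately have "?d (\<Sqinter>{a}) \<subseteq> Q" using QI by (auto simp: d ideal_iff)
    moreover have "?d (\<Sqinter>{a}) \<in> F" using that unfolding F_def by blast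
    ultimately show False using Q(3) by blast
  qed
  ultimately show thesis using that by blast
qed

end


section \<open>The space of pseudoprime elements\<close>

text \<open>Alexander's subbase theorem gives compactness of the topology on \<open>P\<close> with the traces of \<open>\<B>\<close> as
  subbase, and every open set of the subspace is open in that topology.\<close>

lemma compact_space_subtopology_generated_by:
  assumes P: "P \<subseteq> \<Union>\<B>"
    and cover: "\<And>\<C>. \<lbrakk>\<C> \<subseteq> \<B>; P \<subseteq> \<Union>\<C>\<rbrakk> \<Longrightarrow> \<exists>\<C>'. finite \<C>' \<and> \<C>' \<subseteq> \<C> \<and> P \<subseteq> \<Union>\<C>'"
  shows "compact_space (subtopology (topology_generated_by \<B>) P)"
proof -
  define T where "T = topology (arbitrary union_of (finite intersection_of (\<lambda>x. x \<in> \<B>) relative_to P))"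
  have T: "compact_space T"
    by (rule Alexander_subbase_alt[OF P cover T_def[symmetric]])
  have basis: "openin T (B \<inter> P)" if "B \<in> \<B>" for B
  proof -
    have "(finite intersection_of (\<lambda>x. x \<in> \<B>)) B"
      using that by (simp add: finite_intersection_of_inc)
    then have "((finite intersection_of (\<lambda>x. x \<in> \<B>)) relative_to P) (P \<inter> B)"
      by (rule relative_to_inc)
    then show ?thesis
      unfolding T_def openin_subbase by (simp add: Int_commute arbitrary_union_of_inc)
  qed
  have "openin T (V \<inter> P)" if "generate_topology_on \<B> V" for V
    using that
  proof induction
    case (Int a b)
    have "a \<inter> b \<inter> P = (a \<inter> P) \<inter> (b \<inter> P)" by blast
    then show ?case using Int.IH by (metis openin_Int)
  next
    case (UN K)
    have "\<Union>K \<inter> P = \<Union>((\<lambda>k. k \<inter> P) ` K)" by blast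
    then show ?case using UN.IH by (metis (no_types, lifting) imageE openin_Union)
  qed (use basis in auto)
  then have "openin T S" if "openin (subtopology (topology_generated_by \<B>) P) S" for S
    using that by (auto simp: openin_subtopology openin_topology_generated_by_iff)
  moreover have "topspace T = topspace (subtopology (topology_generated_by \<B>) P)"
    using P by (simp add: T_def Int_absorb1 inf_absorb2)
  ultimately show ?thesis
    using T unfolding compact_space_def compactin_def by auto
qed

context compact_frame
begin

abbreviation "pp \<equiv> pseudoprime_space L"

lemma pp_points [simp]: "points pp = pseudoprime_elements L"
proof -
  have "carrier L = up_set L \<bottom>" by (auto simp: up_set_def)
  then have "carrier L \<in> up_set L ` compact_elements L \<union> (\<lambda>l. carrier L - up_set L l) ` compact_elements L"
    using bottom_compact by blast
  then have "pseudoprime_elements L \<subseteq> \<Union>(up_set L ` compact_elements L \<union> (\<lambda>l. carrier L - up_set L l) ` compact_elements L)"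
    using pseudoprime_carrier by (meson UnionI subsetI)
  then show ?thesis
    unfolding pseudoprime_space_def
    by (simp only: gps.simps topspace_subtopology topology_generated_by_topspace inf_absorb2)
qed

lemma pp_ord [simp]:
  "gps_ord pp = {(p, q). p \<in> pseudoprime_elements L \<and> q \<in> pseudoprime_elements L \<and> p \<sqsubseteq> q}"
  and pp_core [simp]: "gps_core pp = prime_elements L"
  by (simp_all add: pseudoprime_space_def)

text \<open>The map \<open>a \<mapsto> pp_hull a\<close> will be the isomorphism from \<open>L\<close> to \<open>\<V>\<^sup>a(\<Y>(L))\<close>.\<close>

definition "pp_hull a = up_set L a \<inter> pseudoprime_elements L"

lemma mem_hull: "p \<in> pp_hull a \<longleftrightarrow> p \<in> pseudoprime_elements L \<and> a \<sqsubseteq> p"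
  using pseudoprime_carrier by (auto simp: pp_hull_def up_set_def)

lemma hull_subset: "pp_hull a \<subseteq> pseudoprime_elements L"
  by (simp add: pp_hull_def)

lemma open_hull:
  assumes "k \<in> compact_elements L"
  shows "openin (gps_top pp) (pp_hull k)" "openin (gps_top pp) (pseudoprime_elements L - pp_hull k)"
proof -
  let ?B = "up_set L ` compact_elements L \<union> (\<lambda>l. carrier L - up_set L l) ` compact_elements L"
  have "openin (topology_generated_by ?B) (up_set L k)"
    "openin (topology_generated_by ?B) (carrier L - up_set L k)"
    using assms by (auto intro!: topology_generated_by_Basis)
  moreover have "pseudoprime_elements L - pp_hull k = (carrier L - up_set L k) \<inter> pseudoprime_elements L"
    using pseudoprime_carrier by (auto simp: pp_hull_def)
  ultimately show "openin (gps_top pp) (pp_hull k)" "openin (gps_top pp) (pseudoprime_elements L - pp_hull k)"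
    by (auto simp: pseudoprime_space_def pp_hull_def openin_subtopology)
qed

lemma closed_hull: "k \<in> compact_elements L \<Longrightarrow> closedin (gps_top pp) (pp_hull k)"
  using open_hull hull_subset by (simp add: closedin_def)

text \<open>A cover by subbasic sets consists of the upsets of the \<open>k\<close> in a set \<open>A\<close> and the complements of the
  upsets of the \<open>l\<close> in a set \<open>B\<close>. A pseudoprime above \<open>\<Squnion>B\<close> and above no \<open>k \<in> A\<close> is not covered, and
  \<open>exists_pseudoprime\<close> provides one unless finitely many of the sets cover.\<close>

lemma compact_pp: "compact_space (gps_top pp)"
proof -
  let ?P = "pseudoprime_elements L"
  let ?B = "up_set L ` compact_elements L \<union> (\<lambda>l. carrier L - up_set L l) ` compact_elements L"
  have "\<exists>\<C>'. finite \<C>' \<and> \<C>' \<subseteq> \<C> \<and> ?P \<subseteq> \<Union>\<C>'" if C: "\<C> \<subseteq> ?B" "?P \<subseteq> \<Union>\<C>" for \<C>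
  proof (rule ccontr)
    assume none: "\<not> (\<exists>\<C>'. finite \<C>' \<and> \<C>' \<subseteq> \<C> \<and> ?P \<subseteq> \<Union>\<C>')"
    define A where "A = {k \<in> compact_elements L. up_set L k \<in> \<C>}"
    define B where "B = {l \<in> compact_elements L. carrier L - up_set L l \<in> \<C>}"
    have AL: "A \<subseteq> carrier L" and BL: "B \<subseteq> carrier L" using compact_carrier by (auto simp: A_def B_def)
    have witness: "\<exists>p\<in>?P. (\<forall>k\<in>A'. \<not> k \<sqsubseteq> p) \<and> (\<forall>l\<in>B'. l \<sqsubseteq> p)"
      if "finite A'" "A' \<subseteq> A" "finite B'" "B' \<subseteq> B" for A' B'
    proof -
      let ?C' = "up_set L ` A' \<union> (\<lambda>l. carrier L - up_set L l) ` B'"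
      have "finite ?C'" "?C' \<subseteq> \<C>" using that by (auto simp: A_def B_def)
      then have "\<not> ?P \<subseteq> \<Union>?C'" using none by meson
      then obtain p where p: "p \<in> ?P" "p \<notin> \<Union>?C'" by (meson subsetI)
      have pL: "p \<in> carrier L" by (rule pseudoprime_carrier[OF p(1)])
      have "\<not> k \<sqsubseteq> p" if "k \<in> A'" for k using p(2) that pL by (auto simp: up_set_def)
      moreover have "l \<sqsubseteq> p" if "l \<in> B'" for l using p(2) that pL by (auto simp: up_set_def)
      ultimately show ?thesis using p(1) by blast
    qed
    obtain p where p: "p \<in> ?P" "\<Squnion>B \<sqsubseteq> p" "\<And>a. a \<in> A \<Longrightarrow> a \<in> compact_elements L \<Longrightarrow> \<not> a \<sqsubseteq> p"
    proof (rule exists_pseudoprime[of "\<Squnion>B" A])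
      fix A' k assume A': "finite A'" "A' \<subseteq> A" and k: "k \<in> compact_elements L" "k \<sqsubseteq> \<Squnion>B"
      obtain B' where B': "finite B'" "B' \<subseteq> B" "k \<sqsubseteq> \<Squnion>B'" using compact_cover[OF k(1) BL k(2)] .
      obtain p where p: "p \<in> ?P" "\<forall>k\<in>A'. \<not> k \<sqsubseteq> p" "\<forall>l\<in>B'. l \<sqsubseteq> p"
        using witness[OF A' B'(1,2)] by blast
      have pL: "p \<in> carrier L" and B'L: "B' \<subseteq> carrier L" using pseudoprime_carrier p B' BL by auto
      have "\<Squnion>B' \<sqsubseteq> p" using p pL B'L by (intro sup_least) auto
      then have "k \<sqsubseteq> p" using le_trans[OF B'(3)] k compact_carrier pL B'L by simp
      then show "\<not> \<Sqinter>A' \<sqsubseteq> k"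
        using pseudoprime_finite_meet[OF p(1) A'(1) _ k(1)] p(2) A' AL by blast
    qed (use AL BL that in auto)
    have pL: "p \<in> carrier L" using pseudoprime_carrier p by blast
    obtain V where V: "V \<in> \<C>" "p \<in> V" using C p by blast
    then consider k where "k \<in> A" "V = up_set L k" | l where "l \<in> B" "V = carrier L - up_set L l"
      using C(1) by (auto simp: A_def B_def)
    then show False
    proof cases
      case 1
      then show ?thesis using p(3) V by (auto simp: up_set_def A_def)
    next
      case 2
      then have "l \<sqsubseteq> p" using le_trans[OF sup_upper[OF BL] p(2)] BL pL by auto
      then show ?thesis using 2 V pL by (auto simp: up_set_def)
    qed
  qed
  moreover have "?P \<subseteq> \<Union>?B"
    using pp_points by (auto simp: pseudoprime_space_def)
  ultimately show ?thesis
    unfolding pseudoprime_space_def by (simp add: compact_space_subtopology_generated_by)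
qed

lemma hull_upset: "upset pp (pp_hull a)" if "a \<in> carrier L"
  using that pseudoprime_carrier by (auto simp: upset_def mem_hull intro: le_trans)

lemma priestley_pp: "priestley pp"
proof
  show "priestley_space pp" unfolding priestley_space_def
  proof (intro conjI ballI impI)
    show "compact_space (gps_top pp)" by (rule compact_pp)
    show "partial_order_on (points pp) (gps_ord pp)"
      using pseudoprime_carrier
      by (auto simp: partial_order_on_def preorder_on_def refl_on_def intro!: transI antisymI
          intro: le_trans le_antisym)
    fix p q assume p: "p \<in> points pp" and q: "q \<in> points pp" and n: "(p, q) \<notin> gps_ord pp"
    have pq: "p \<in> carrier L" "q \<in> carrier L" "\<not> p \<sqsubseteq> q"
      using p q n pseudoprime_carrier by auto
    obtain k where k: "k \<in> compact_elements L" "k \<sqsubseteq> p" "\<not> k \<sqsubseteq> q" using compact_below[OF pq] by blast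
    have "clopen_upset pp (pp_hull k)"
      using k open_hull closed_hull hull_upset compact_carrier by (simp add: clopen_upset_def)
    then show "\<exists>U. clopen_upset pp U \<and> p \<in> U \<and> q \<notin> U" using k p by (auto simp: mem_hull)
  qed
qed

lemma pp_below_prime:
  assumes "p \<in> pseudoprime_elements L"
  obtains q where "q \<in> prime_elements L" "p \<sqsubseteq> q"
  using exists_prime_above[OF pseudoprime_carrier[OF assms] top_closed pseudoprime_top[OF assms]] that by blast

lemma hull_admissible:
  assumes k: "k \<in> compact_elements L"
  shows "pp_hull k \<in> admissible pp"
proof -
  have kL: "k \<in> carrier L" by (rule compact_carrier[OF k])
  have "p \<in> prime_elements L" if p: "p \<in> maximal_points pp (points pp - pp_hull k)" for p
  proof -
    have pp: "p \<in> pseudoprime_elements L" "\<not> k \<sqsubseteq> p"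
      and max: "\<And>q. q \<in> pseudoprime_elements L \<Longrightarrow> \<not> k \<sqsubseteq> q \<Longrightarrow> p \<sqsubseteq> q \<Longrightarrow> q = p"
      using p by (auto simp: maximal_points_def mem_hull)
    obtain q where "q \<in> prime_elements L" "p \<sqsubseteq> q" "\<not> k \<sqsubseteq> q"
      using exists_prime_above[OF pseudoprime_carrier[OF pp(1)] kL pp(2)] by blast
    then show ?thesis using max prime_pseudoprime by blast
  qed
  then show ?thesis
    using open_hull[OF k] closed_hull[OF k] hull_upset[OF kL] by (auto simp: admissible_def clopen_upset_def)
qed

text \<open>Conversely, let \<open>m\<close> be the meet of an admissible set \<open>U\<close>. A maximal point \<open>q\<close> of the complement is
  prime, and compactness of \<open>U\<close> bounds \<open>m\<close> from below by a finite meet of elements not below \<open>q\<close>;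
  so \<open>m\<close> is below no point outside \<open>U\<close>. Compactness of the complement then replaces \<open>m\<close> by a compact
  element.\<close>

lemma admissible_hull:
  assumes U: "U \<in> admissible pp"
  shows "\<exists>k\<in>compact_elements L. U = pp_hull k"
proof -
  interpret priestley pp by (rule priestley_pp)
  have clU: "closedin (gps_top pp) U" and opU: "openin (gps_top pp) U" and upU: "upset pp U"
    using U by (auto simp: admissible_def clopen_upset_def)
  have clU': "closedin (gps_top pp) (points pp - U)" using opU by (simp add: openin_closedin_eq)
  have UP: "U \<subseteq> pseudoprime_elements L" using upU by (simp add: upset_def)
  then have UL: "U \<subseteq> carrier L" using pseudoprime_carrier by blast
  define m where "m = \<Sqinter>U"
  have mL: "m \<in> carrier L" using UL by (simp add: m_def)
  have "\<not> m \<sqsubseteq> p" if p: "p \<in> points pp - U" for p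
  proof
    assume mp: "m \<sqsubseteq> p"
    obtain q where qmax: "q \<in> maximal_points pp (points pp - U)" and pq: "(p, q) \<in> gps_ord pp"
      by (rule exists_maximal_point[OF clU' p])
    have q: "q \<in> prime_elements L" using qmax U by (auto simp: admissible_def)
    have qL: "q \<in> carrier L" "p \<in> carrier L" "p \<sqsubseteq> q" using pq pseudoprime_carrier by auto
    have mq: "m \<sqsubseteq> q" using le_trans[OF mp qL(3)] mL qL by blast
    define \<U> where "\<U> = pp_hull ` {k \<in> compact_elements L. \<not> k \<sqsubseteq> q}"
    have "U \<subseteq> \<Union>\<U>"
    proof
      fix x assume x: "x \<in> U"
      have "\<not> x \<sqsubseteq> q"
      proof
        assume "x \<sqsubseteq> q"
        then have "(x, q) \<in> gps_ord pp" using x UP q prime_pseudoprime by auto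
        then have "q \<in> U" using x upU unfolding upset_def by blast
        then show False using qmax by (simp add: maximal_points_def)
      qed
      then obtain k where "k \<in> compact_elements L" "k \<sqsubseteq> x" "\<not> k \<sqsubseteq> q"
        using compact_below[of x q] x UL qL by blast
      then show "x \<in> \<Union>\<U>" using x UP by (auto simp: \<U>_def mem_hull)
    qed
    moreover have "openin (gps_top pp) V" if "V \<in> \<U>" for V using that open_hull by (auto simp: \<U>_def)
    ultimately obtain \<V> where V: "finite \<V>" "\<V> \<subseteq> \<U>" "U \<subseteq> \<Union>\<V>"
      using compact_closed_cover[OF compact clU] by metis
    obtain A where A: "A \<subseteq> {k \<in> compact_elements L. \<not> k \<sqsubseteq> q}" "finite A" "\<V> = pp_hull ` A"
      using finite_subset_image[OF V(1) V(2)[unfolded \<U>_def]] by blast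
    have AL: "A \<subseteq> carrier L" using A compact_carrier by blast
    have "\<Sqinter>A \<sqsubseteq> m" unfolding m_def
    proof (rule inf_greatest[OF UL])
      fix x assume x: "x \<in> U"
      then obtain k where k: "k \<in> A" "x \<in> pp_hull k" using V A by blast
      then show "\<Sqinter>A \<sqsubseteq> x"
        using le_trans[OF inf_lower[OF AL k(1)], of x] subsetD[OF UL x] subsetD[OF AL k(1)] AL
        by (simp add: mem_hull)
    qed (use AL in auto)
    then have "\<Sqinter>A \<sqsubseteq> q" using le_trans[OF _ mq] AL mL qL by simp
    then show False using prime_finite_meet[OF q A(2) AL] A(1) by blast
  qed
  note m_below = this
  define \<U> where "\<U> = (\<lambda>k. pseudoprime_elements L - pp_hull k) ` {k \<in> compact_elements L. k \<sqsubseteq> m}"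
  have "points pp - U \<subseteq> \<Union>\<U>"
  proof
    fix p assume p: "p \<in> points pp - U"
    then have "p \<in> carrier L" using pseudoprime_carrier by simp
    then obtain k where "k \<in> compact_elements L" "k \<sqsubseteq> m" "\<not> k \<sqsubseteq> p"
      using compact_below[OF mL _ m_below[OF p]] by blast
    then show "p \<in> \<Union>\<U>" using p by (auto simp: \<U>_def mem_hull)
  qed
  moreover have "openin (gps_top pp) V" if "V \<in> \<U>" for V using that open_hull by (auto simp: \<U>_def)
  ultimately obtain \<V> where V: "finite \<V>" "\<V> \<subseteq> \<U>" "points pp - U \<subseteq> \<Union>\<V>"
    using compact_closed_cover[OF compact clU'] by metis
  obtain A where A: "A \<subseteq> {k \<in> compact_elements L. k \<sqsubseteq> m}" "finite A"
    "\<V> = (\<lambda>k. pseudoprime_elements L - pp_hull k) ` A"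
    using finite_subset_image[OF V(1) V(2)[unfolded \<U>_def]] by blast
  have AK: "A \<subseteq> compact_elements L" and AL: "A \<subseteq> carrier L" using A compact_carrier by auto
  have k: "\<Squnion>A \<in> compact_elements L" by (rule finite_Sup_compact[OF A(2) AK])
  have km: "\<Squnion>A \<sqsubseteq> m" using A AL mL by (intro sup_least) auto
  have "U = pp_hull (\<Squnion>A)"
  proof (intro subset_antisym subsetI)
    fix x assume x: "x \<in> U"
    then have "m \<sqsubseteq> x" unfolding m_def by (rule inf_lower[OF UL])
    then have "\<Squnion>A \<sqsubseteq> x" using le_trans[OF km] AL mL x UL by auto
    then show "x \<in> pp_hull (\<Squnion>A)" using x UP by (auto simp: mem_hull)
  next
    fix x assume x: "x \<in> pp_hull (\<Squnion>A)"
    show "x \<in> U"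
    proof (rule ccontr)
      assume "x \<notin> U"
      then have "x \<in> \<Union>\<V>" using V x by (auto simp: mem_hull)
      then obtain l where l: "l \<in> A" "\<not> l \<sqsubseteq> x" using A x by (auto simp: mem_hull)
      have "l \<sqsubseteq> x" using le_trans[OF sup_upper[OF AL l(1)], of x] x l AL pseudoprime_carrier by (auto simp: mem_hull)
      then show False using l by blast
    qed
  qed
  then show ?thesis using k by blast
qed

lemma admissible_pp: "admissible pp = pp_hull ` compact_elements L"
  using hull_admissible admissible_hull by blast

lemma hull_subset_iff:
  assumes a: "a \<in> carrier L" and b: "b \<in> carrier L"
  shows "pp_hull a \<subseteq> pp_hull b \<longleftrightarrow> b \<sqsubseteq> a"
proof
  assume sub: "pp_hull a \<subseteq> pp_hull b"
  show "b \<sqsubseteq> a"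
  proof (rule ccontr)
    assume "\<not> b \<sqsubseteq> a"
    then obtain q where "q \<in> prime_elements L" "a \<sqsubseteq> q" "\<not> b \<sqsubseteq> q" using exists_prime_above[OF a b] by blast
    then have "q \<in> pp_hull a" "q \<notin> pp_hull b" using prime_pseudoprime by (auto simp: mem_hull)
    then show False using sub by blast
  qed
next
  assume "b \<sqsubseteq> a"
  then show "pp_hull a \<subseteq> pp_hull b" using a b le_trans[of b a] pseudoprime_carrier by (auto simp: mem_hull)
qed

lemma hull_Sup:
  assumes S: "S \<subseteq> carrier L"
  shows "pp_hull (\<Squnion>S) = pseudoprime_elements L \<inter> \<Inter>(pp_hull ` S)"
proof -
  have "\<Squnion>S \<sqsubseteq> p \<longleftrightarrow> (\<forall>a\<in>S. a \<sqsubseteq> p)" if "p \<in> pseudoprime_elements L" for p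
    using that S pseudoprime_carrier[OF that] sup_upper[OF S] le_trans[of _ "\<Squnion>S" p] by (auto intro: sup_least)
  then show ?thesis by (auto simp: mem_hull)
qed

lemma gps_space_pp: "gps_space pp"
proof
  interpret priestley pp by (rule priestley_pp)
  show "generalized_priestley_space pp" unfolding generalized_priestley_space_def
  proof (intro conjI ballI)
    show "priestley_space pp" by (rule priestley)
    show "gps_core pp \<subseteq> points pp" using prime_pseudoprime by simp
    \<comment> \<open>A basic open set that contains a pseudoprime \<open>p\<close> is given by finitely many \<open>l\<close> not below \<open>p\<close>
      and a compact \<open>k\<close> below \<open>p\<close>. The meet of the \<open>l\<close> is not below \<open>k\<close>, so a prime separates them.\<close>
    have "prime_elements L \<inter> S \<noteq> {}" if S: "openin (gps_top pp) S" "S \<noteq> {}" for S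
    proof -
      let ?B = "up_set L ` compact_elements L \<union> (\<lambda>l. carrier L - up_set L l) ` compact_elements L"
      obtain V where V: "generate_topology_on ?B V" "S = V \<inter> pseudoprime_elements L"
        using S(1) by (auto simp: pseudoprime_space_def openin_subtopology openin_topology_generated_by_iff)
      have basic: "\<exists>k A. k \<in> compact_elements L \<and> finite A \<and> A \<subseteq> carrier L \<and> k \<sqsubseteq> p \<and> (\<forall>l\<in>A. \<not> l \<sqsubseteq> p) \<and>
          (\<forall>q\<in>pseudoprime_elements L. k \<sqsubseteq> q \<and> (\<forall>l\<in>A. \<not> l \<sqsubseteq> q) \<longrightarrow> q \<in> V)"
        if "p \<in> V" "p \<in> pseudoprime_elements L" for p
        using V(1) that
      proof (induction arbitrary: p)
        case (Int a b)
        from Int.IH(1)[of p] Int.prems obtain k A where k: "k \<in> compact_elements L" "finite A"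
          "A \<subseteq> carrier L" "k \<sqsubseteq> p" "\<forall>l\<in>A. \<not> l \<sqsubseteq> p"
          "\<forall>q\<in>pseudoprime_elements L. k \<sqsubseteq> q \<and> (\<forall>l\<in>A. \<not> l \<sqsubseteq> q) \<longrightarrow> q \<in> a" by blast
        from Int.IH(2)[of p] Int.prems obtain k' A' where k': "k' \<in> compact_elements L" "finite A'"
          "A' \<subseteq> carrier L" "k' \<sqsubseteq> p" "\<forall>l\<in>A'. \<not> l \<sqsubseteq> p"
          "\<forall>q\<in>pseudoprime_elements L. k' \<sqsubseteq> q \<and> (\<forall>l\<in>A'. \<not> l \<sqsubseteq> q) \<longrightarrow> q \<in> b" by blast
        have kL: "k \<in> carrier L" "k' \<in> carrier L" using k k' compact_carrier by auto
        have "k \<sqsubseteq> q \<and> k' \<sqsubseteq> q" if "q \<in> pseudoprime_elements L" "k \<squnion> k' \<sqsubseteq> q" for q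
          using le_trans[OF join_left[OF kL] that(2)] le_trans[OF join_right[OF kL] that(2)]
            kL pseudoprime_carrier[OF that(1)] by simp
        moreover have "k \<squnion> k' \<sqsubseteq> p" using k k' kL pseudoprime_carrier Int.prems by (intro join_le) auto
        ultimately show ?case using k k' join_compact[OF k(1) k'(1)]
          by (intro exI[of _ "k \<squnion> k'"] exI[of _ "A \<union> A'"]) auto
      next
        case (UN K)
        then obtain a where a: "a \<in> K" "p \<in> a" by blast
        from UN.IH[OF a UN.prems(2)] a(1) show ?case by (meson UnionI)
      next
        case (Basis s)
        then consider k where "k \<in> compact_elements L" "s = up_set L k"
          | l where "l \<in> compact_elements L" "s = carrier L - up_set L l" by blast
        then show ?case
        proof cases
          case 1
          then show ?thesis using Basis.prems pseudoprime_carrier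
            by (intro exI[of _ k] exI[of _ "{}"]) (auto simp: up_set_def)
        next
          case 2
          then show ?thesis using Basis.prems pseudoprime_carrier bottom_compact compact_carrier
            by (intro exI[of _ \<bottom>] exI[of _ "{l}"]) (auto simp: up_set_def)
        qed
      qed auto
      obtain p where p: "p \<in> V" "p \<in> pseudoprime_elements L" using S V by blast
      from basic[OF p] obtain k A where k: "k \<in> compact_elements L" "finite A" "A \<subseteq> carrier L"
        "k \<sqsubseteq> p" "\<forall>l\<in>A. \<not> l \<sqsubseteq> p"
        and VkA: "\<forall>q\<in>pseudoprime_elements L. k \<sqsubseteq> q \<and> (\<forall>l\<in>A. \<not> l \<sqsubseteq> q) \<longrightarrow> q \<in> V" by blast
      have "\<not> \<Sqinter>A \<sqsubseteq> k" using pseudoprime_finite_meet[OF p(2) k(2,3,1)] k by blast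
      then obtain q where q: "q \<in> prime_elements L" "k \<sqsubseteq> q" "\<not> \<Sqinter>A \<sqsubseteq> q"
        using exists_prime_above[of k "\<Sqinter>A"] k compact_carrier by auto
      have qL: "q \<in> carrier L" using q by (simp add: prime_elements_def)
      have "\<not> l \<sqsubseteq> q" if l: "l \<in> A" for l
        using le_trans[OF inf_lower[OF k(3) l], of q] q(3) l k(3) qL by auto
      then have "q \<in> V" using VkA q prime_pseudoprime by blast
      then show ?thesis using V q prime_pseudoprime by blast
    qed
    then show "gps_top pp closure_of gps_core pp = points pp"
      unfolding dense_intersects_open by simp
    fix p assume p: "p \<in> points pp"
    then have pP: "p \<in> pseudoprime_elements L" by simp
    have pL: "p \<in> carrier L" by (rule pseudoprime_carrier[OF pP])
    obtain q where "q \<in> prime_elements L" "p \<sqsubseteq> q" using pP by (rule pp_below_prime)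
    then show "\<exists>q\<in>gps_core pp. (p, q) \<in> gps_ord pp" using pP prime_pseudoprime by auto
    have missing: "admissible_missing pp p = pp_hull ` {k \<in> compact_elements L. \<not> k \<sqsubseteq> p}"
      using pP by (auto simp: admissible_missing_def admissible_pp mem_hull)
    have "pp_hull \<top> \<in> admissible_missing pp p"
      using missing top_compact pseudoprime_top[OF pP] by blast
    then have nonempty: "admissible_missing pp p \<noteq> {}" by blast
    show "p \<in> gps_core pp \<longleftrightarrow> directed_by_inclusion (admissible_missing pp p)"
    proof
      assume prime: "p \<in> gps_core pp"
      show "directed_by_inclusion (admissible_missing pp p)" unfolding directed_by_inclusion_def
      proof (intro conjI ballI nonempty)
        fix U V assume "U \<in> admissible_missing pp p" "V \<in> admissible_missing pp p"
        then obtain k l where kl: "k \<in> compact_elements L" "l \<in> compact_elements L"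
          "\<not> k \<sqsubseteq> p" "\<not> l \<sqsubseteq> p" "U = pp_hull k" "V = pp_hull l" unfolding missing by blast
        note klL = compact_carrier[OF kl(1)] compact_carrier[OF kl(2)]
        have "\<not> k \<sqinter> l \<sqsubseteq> p" using prime kl klL by (auto simp: prime_elements_def)
        then obtain n where n: "n \<in> compact_elements L" "n \<sqsubseteq> k \<sqinter> l" "\<not> n \<sqsubseteq> p"
          using compact_below[of "k \<sqinter> l" p] pL klL meet_closed[OF klL] by blast
        note nL = compact_carrier[OF n(1)]
        have "n \<sqsubseteq> k" "n \<sqsubseteq> l"
          using le_trans[OF n(2) meet_left[OF klL]] le_trans[OF n(2) meet_right[OF klL]] nL klL by simp_all
        then have "U \<subseteq> pp_hull n" "V \<subseteq> pp_hull n" using kl klL nL hull_subset_iff by auto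
        moreover have "pp_hull n \<in> admissible_missing pp p" unfolding missing using n by blast
        ultimately show "\<exists>W\<in>admissible_missing pp p. U \<subseteq> W \<and> V \<subseteq> W"
          by (intro bexI[of _ "pp_hull n"] conjI)
      qed
    next
      assume dir: "directed_by_inclusion (admissible_missing pp p)"
      have "a \<sqsubseteq> p \<or> b \<sqsubseteq> p" if ab: "a \<in> carrier L" "b \<in> carrier L" "a \<sqinter> b \<sqsubseteq> p" for a b
      proof (rule ccontr)
        assume n: "\<not> (a \<sqsubseteq> p \<or> b \<sqsubseteq> p)"
        obtain k where k: "k \<in> compact_elements L" "k \<sqsubseteq> a" "\<not> k \<sqsubseteq> p"
          using compact_below[of a p] ab pL n by blast
        obtain l where l: "l \<in> compact_elements L" "l \<sqsubseteq> b" "\<not> l \<sqsubseteq> p"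
          using compact_below[of b p] ab pL n by blast
        note klL = compact_carrier[OF k(1)] compact_carrier[OF l(1)]
        have "pp_hull k \<in> admissible_missing pp p" "pp_hull l \<in> admissible_missing pp p"
          unfolding missing using k l by auto
        then have "\<exists>W\<in>admissible_missing pp p. pp_hull k \<subseteq> W \<and> pp_hull l \<subseteq> W"
          by (rule directed_by_inclusionD[OF dir])
        then obtain n where n: "n \<in> compact_elements L" "\<not> n \<sqsubseteq> p" "pp_hull k \<subseteq> pp_hull n" "pp_hull l \<subseteq> pp_hull n"
          unfolding missing by blast
        note nL = compact_carrier[OF n(1)]
        have "n \<sqsubseteq> k" "n \<sqsubseteq> l" using n hull_subset_iff klL nL by auto
        then have "n \<sqsubseteq> a" "n \<sqsubseteq> b" using le_trans[of n k a] le_trans[of n l b] k l klL nL ab by auto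
        then have "n \<sqsubseteq> a \<sqinter> b" using nL ab by (intro meet_le) auto
        then have "n \<sqsubseteq> p" using le_trans[of n "a \<sqinter> b" p] ab nL pL by simp
        then show False using n by blast
      qed
      moreover have "p \<noteq> \<top>" using pseudoprime_top[OF pP] pL by auto
      ultimately show "p \<in> gps_core pp" using pL by (simp add: prime_elements_def)
    qed
    fix q assume "q \<in> points pp"
    then have qP: "q \<in> pseudoprime_elements L" by simp
    have qL: "q \<in> carrier L" by (rule pseudoprime_carrier[OF qP])
    show "(p, q) \<in> gps_ord pp \<longleftrightarrow> (\<forall>U\<in>admissible pp. p \<in> U \<longrightarrow> q \<in> U)"
    proof
      assume "(p, q) \<in> gps_ord pp"
      then show "\<forall>U\<in>admissible pp. p \<in> U \<longrightarrow> q \<in> U"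
        using pL qL le_trans[of _ p q] compact_carrier by (auto simp: admissible_pp mem_hull)
    next
      assume r: "\<forall>U\<in>admissible pp. p \<in> U \<longrightarrow> q \<in> U"
      have "p \<sqsubseteq> q"
      proof (rule ccontr)
        assume "\<not> p \<sqsubseteq> q"
        then obtain k where "k \<in> compact_elements L" "k \<sqsubseteq> p" "\<not> k \<sqsubseteq> q"
          using compact_below[OF pL qL] by blast
        then show False using r pP by (auto simp: admissible_pp mem_hull)
      qed
      then show "(p, q) \<in> gps_ord pp" using pP qP by simp
    qed
  qed
qed

end


section \<open>From frames to spaces\<close>

lemma functor_Y_simps [simp]:
  "on_ob functor_Y L = pseudoprime_space L"
  "on_hom functor_Y L M \<alpha> = {(p, q). p \<in> pseudoprime_elements M \<and> q \<in> pseudoprime_elements L \<and>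
     right_adjoint L M \<alpha> p \<sqsubseteq>\<^bsub>L\<^esub> q}"
  by (simp_all add: functor_Y_def)

context frame_morphism
begin

lemma right_adjoint_galois:
  "right_adjoint L M \<alpha> \<in> extensional (carrier M) \<and>
   galois_connection \<lparr>orderA = L, orderB = M, lower = \<alpha>, upper = right_adjoint L M \<alpha>\<rparr>"
proof -
  let ?g = "\<lambda>r. \<lparr>orderA = L, orderB = M, lower = \<alpha>, upper = r\<rparr>"
  define r where "r = (\<lambda>b\<in>carrier M. \<Squnion>\<^bsub>L\<^esub>{a \<in> carrier L. \<alpha> a \<sqsubseteq>\<^bsub>M\<^esub> b})"
  have rL: "r b \<in> carrier L" if "b \<in> carrier M" for b
    using that unfolding r_def by (auto intro: L.sup_closed)
  have "\<alpha> a \<sqsubseteq>\<^bsub>M\<^esub> b \<longleftrightarrow> a \<sqsubseteq>\<^bsub>L\<^esub> r b" if ab: "a \<in> carrier L" "b \<in> carrier M" for a b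
  proof
    assume "\<alpha> a \<sqsubseteq>\<^bsub>M\<^esub> b"
    then show "a \<sqsubseteq>\<^bsub>L\<^esub> r b" using ab unfolding r_def by (auto intro: L.sup_upper)
  next
    assume a: "a \<sqsubseteq>\<^bsub>L\<^esub> r b"
    let ?S = "{a \<in> carrier L. \<alpha> a \<sqsubseteq>\<^bsub>M\<^esub> b}"
    have S: "?S \<subseteq> carrier L" by blast
    have "\<alpha> (r b) = \<Squnion>\<^bsub>M\<^esub>(\<alpha> ` ?S)" using ab Sup[OF S] by (simp add: r_def)
    also have "\<dots> \<sqsubseteq>\<^bsub>M\<^esub> b" using ab closed by (intro M.sup_least) auto
    finally have "\<alpha> (r b) \<sqsubseteq>\<^bsub>M\<^esub> b" .
    moreover have "\<alpha> a \<sqsubseteq>\<^bsub>M\<^esub> \<alpha> (r b)" by (rule mono[OF ab(1) rL[OF ab(2)] a])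
    ultimately show "\<alpha> a \<sqsubseteq>\<^bsub>M\<^esub> b" using M.le_trans[of "\<alpha> a" "\<alpha> (r b)" b] closed rL ab by blast
  qed
  then have "galois_connection (?g r)"
    using rL closed L.partial_order_axioms M.partial_order_axioms
    by (simp add: galois_connection_def galois_connection_axioms_def connection_def)
  moreover have "r \<in> extensional (carrier M)" by (simp add: r_def)
  moreover have "r' = s" if r': "r' \<in> extensional (carrier M)" "galois_connection (?g r')"
    and s: "s \<in> extensional (carrier M)" "galois_connection (?g s)" for r' s
  proof (rule extensionalityI[OF r'(1) s(1)])
    fix b assume b: "b \<in> carrier M"
    have c: "r' b \<in> carrier L" "s b \<in> carrier L"
      using connection.upper_closed[OF galois_connection.axioms(1)[OF r'(2)], of b]
        connection.upper_closed[OF galois_connection.axioms(1)[OF s(2)], of b] b by auto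
    have "a \<sqsubseteq>\<^bsub>L\<^esub> r' b \<longleftrightarrow> a \<sqsubseteq>\<^bsub>L\<^esub> s b" if "a \<in> carrier L" for a
      using galois_connection.galois_property[OF r'(2), of a b]
        galois_connection.galois_property[OF s(2), of a b] that b by simp
    then show "r' b = s b" using c by (blast intro: L.le_antisym)
  qed
  ultimately have "\<exists>!r. r \<in> extensional (carrier M) \<and> galois_connection (?g r)"
    by (intro ex1I[of _ r]) auto
  from theI'[OF this] show ?thesis unfolding right_adjoint_def by simp
qed

lemma right_adjoint_closed: "b \<in> carrier M \<Longrightarrow> right_adjoint L M \<alpha> b \<in> carrier L"
  using connection.upper_closed[OF galois_connection.axioms(1)[OF right_adjoint_galois[THEN conjunct2]], of b]
  by simp

lemma right_adjoint_iff:
  "\<lbrakk>a \<in> carrier L; b \<in> carrier M\<rbrakk> \<Longrightarrow> \<alpha> a \<sqsubseteq>\<^bsub>M\<^esub> b \<longleftrightarrow> a \<sqsubseteq>\<^bsub>L\<^esub> right_adjoint L M \<alpha> b"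
  using galois_connection.galois_property[OF right_adjoint_galois[THEN conjunct2], of a b] by simp

text \<open>Since primes separate elements, the relation \<open>\<Y>(\<alpha>)\<close> remembers \<open>\<alpha>\<close> through its box operator.\<close>

lemma rel_box_functor_Y:
  assumes a: "a \<in> carrier L"
  shows "rel_box M.pp (on_hom functor_Y L M \<alpha>) (L.pp_hull a) = M.pp_hull (\<alpha> a)"
proof (intro subset_antisym subsetI)
  fix p assume p: "p \<in> rel_box M.pp (on_hom functor_Y L M \<alpha>) (L.pp_hull a)"
  then have pP: "p \<in> pseudoprime_elements M"
    and all: "\<And>q. q \<in> pseudoprime_elements L \<Longrightarrow> right_adjoint L M \<alpha> p \<sqsubseteq>\<^bsub>L\<^esub> q \<Longrightarrow> a \<sqsubseteq>\<^bsub>L\<^esub> q"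
    by (auto simp: rel_box_def L.mem_hull)
  note pM = M.pseudoprime_carrier[OF pP]
  have "a \<sqsubseteq>\<^bsub>L\<^esub> right_adjoint L M \<alpha> p"
    using L.exists_prime_above[OF right_adjoint_closed[OF pM] a] all L.prime_pseudoprime by blast
  then show "p \<in> M.pp_hull (\<alpha> a)" using pP pM a by (simp add: M.mem_hull right_adjoint_iff)
next
  fix p assume "p \<in> M.pp_hull (\<alpha> a)"
  then have pP: "p \<in> pseudoprime_elements M" and "\<alpha> a \<sqsubseteq>\<^bsub>M\<^esub> p" by (auto simp: M.mem_hull)
  note pM = M.pseudoprime_carrier[OF pP]
  have ap: "a \<sqsubseteq>\<^bsub>L\<^esub> right_adjoint L M \<alpha> p" using \<open>\<alpha> a \<sqsubseteq>\<^bsub>M\<^esub> p\<close> a pM by (simp add: right_adjoint_iff)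
  have "a \<sqsubseteq>\<^bsub>L\<^esub> q" if "q \<in> pseudoprime_elements L" "right_adjoint L M \<alpha> p \<sqsubseteq>\<^bsub>L\<^esub> q" for q
    using L.le_trans[OF ap that(2)] a right_adjoint_closed[OF pM] L.pseudoprime_carrier[OF that(1)] by blast
  then show "p \<in> rel_box M.pp (on_hom functor_Y L M \<alpha>) (L.pp_hull a)"
    using pP by (auto simp: rel_box_def L.mem_hull)
qed

lemma functor_Y_hom: "on_hom functor_Y L M \<alpha> \<in> hom gps M.pp L.pp"
proof (rule gps_homI)
  show "on_hom functor_Y L M \<alpha> \<subseteq> points M.pp \<times> points L.pp" by auto
  show "rel_box M.pp (on_hom functor_Y L M \<alpha>) U \<in> admissible M.pp" if "U \<in> admissible L.pp" for U
    using that rel_box_functor_Y compact L.compact_carrier by (auto simp: L.admissible_pp M.admissible_pp)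
  fix p q assume p: "p \<in> points M.pp" and q: "q \<in> points L.pp" and n: "(p, q) \<notin> on_hom functor_Y L M \<alpha>"
  have pM: "p \<in> carrier M" and qL: "q \<in> carrier L" and nle: "\<not> right_adjoint L M \<alpha> p \<sqsubseteq>\<^bsub>L\<^esub> q"
    using p q n M.pseudoprime_carrier L.pseudoprime_carrier by auto
  note rL = right_adjoint_closed[OF pM]
  obtain k where k: "k \<in> compact_elements L" "k \<sqsubseteq>\<^bsub>L\<^esub> right_adjoint L M \<alpha> p" "\<not> k \<sqsubseteq>\<^bsub>L\<^esub> q"
    using L.compact_below[OF rL qL nle] by blast
  have "k \<sqsubseteq>\<^bsub>L\<^esub> q'" if "q' \<in> pseudoprime_elements L" "right_adjoint L M \<alpha> p \<sqsubseteq>\<^bsub>L\<^esub> q'" for q'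
    using L.le_trans[OF k(2) that(2)] L.compact_carrier[OF k(1)] rL L.pseudoprime_carrier[OF that(1)] by blast
  then have "on_hom functor_Y L M \<alpha> `` {p} \<subseteq> L.pp_hull k" by (auto simp: L.mem_hull)
  then show "\<exists>U\<in>admissible L.pp. on_hom functor_Y L M \<alpha> `` {p} \<subseteq> U \<and> q \<notin> U"
    using k L.hull_admissible by (auto simp: L.mem_hull)
qed

lemma functor_Y_total_iff:
  "(\<forall>p\<in>points M.pp. on_hom functor_Y L M \<alpha> `` {p} \<noteq> {}) \<longleftrightarrow> \<alpha> \<top>\<^bsub>L\<^esub> = \<top>\<^bsub>M\<^esub>"
proof -
  have top: "L.pp_hull \<top>\<^bsub>L\<^esub> = {}" "M.pp_hull \<top>\<^bsub>M\<^esub> = {}"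
    using L.pseudoprime_top M.pseudoprime_top by (auto simp: L.mem_hull M.mem_hull)
  have "(\<forall>p\<in>points M.pp. on_hom functor_Y L M \<alpha> `` {p} \<noteq> {})
      \<longleftrightarrow> rel_box M.pp (on_hom functor_Y L M \<alpha>) {} = {}"
    unfolding rel_box_def by blast
  also have "\<dots> \<longleftrightarrow> M.pp_hull (\<alpha> \<top>\<^bsub>L\<^esub>) = {}"
    using rel_box_functor_Y[OF L.top_closed] unfolding top(1) by simp
  also have "\<dots> \<longleftrightarrow> M.pp_hull (\<alpha> \<top>\<^bsub>L\<^esub>) \<subseteq> M.pp_hull \<top>\<^bsub>M\<^esub>" by (simp add: top)
  also have "\<dots> \<longleftrightarrow> \<alpha> \<top>\<^bsub>L\<^esub> = \<top>\<^bsub>M\<^esub>"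
    using closed[OF L.top_closed] M.hull_subset_iff[of "\<alpha> \<top>\<^bsub>L\<^esub>" "\<top>\<^bsub>M\<^esub>"] by (auto intro: M.le_antisym)
  finally show ?thesis .
qed

end

lemma is_functor_Y: "is_functor kalgfrm_sup (op_cat gps) functor_Y"
  unfolding is_functor_def op_cat_simps
proof (intro conjI ballI)
  show "category kalgfrm_sup" "category (op_cat gps)"
    using order_category_category[OF order_category_kalgfrm_sup] category_op_cat[OF category_gps] by auto
  fix L :: "'a gorder" assume L: "L \<in> obj kalgfrm_sup"
  then interpret L: compact_frame L by (simp add: kalgfrm_sup_obj)
  show "on_ob functor_Y L \<in> obj gps" using L.gps_space_pp by (simp add: gps_obj)
  show "on_hom functor_Y L L (ide kalgfrm_sup L) = ide gps (on_ob functor_Y L)"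
  proof -
    interpret id: frame_morphism L L "ide kalgfrm_sup L"
      using L category_ide[OF order_category_category[OF order_category_kalgfrm_sup] L]
      by (intro frame_morphismI)
    have "on_hom functor_Y L L (ide kalgfrm_sup L) = gps_ord L.pp"
    proof (rule gps_hom_eqI[OF id.functor_Y_hom gps_ide_hom[OF L.gps_space_pp]])
      fix U assume U: "U \<in> admissible L.pp"
      then obtain k where k: "k \<in> compact_elements L" "U = L.pp_hull k" by (auto simp: L.admissible_pp)
      have "rel_box L.pp (gps_ord L.pp) U = U"
        by (rule rel_box_ord[OF L.gps_space_pp gps_space.admissible_upset[OF L.gps_space_pp U]])
      then show "rel_box L.pp (on_hom functor_Y L L (ide kalgfrm_sup L)) U = rel_box L.pp (gps_ord L.pp) U"
        using id.rel_box_functor_Y[of k] k L.compact_carrier by (simp add: kalgfrm_sup_simps(3))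
    qed
    then show ?thesis by (simp add: gps_simps(3))
  qed
  fix M \<alpha> assume M: "M \<in> obj kalgfrm_sup" and \<alpha>: "\<alpha> \<in> hom kalgfrm_sup L M"
  interpret \<alpha>: frame_morphism L M \<alpha> using L M \<alpha> by (rule frame_morphismI)
  show "on_hom functor_Y L M \<alpha> \<in> hom gps (on_ob functor_Y M) (on_ob functor_Y L)"
    using \<alpha>.functor_Y_hom by simp
  fix N \<beta> assume N: "N \<in> obj kalgfrm_sup" and \<beta>: "\<beta> \<in> hom kalgfrm_sup M N"
  interpret \<beta>: frame_morphism M N \<beta> using M N \<beta> by (rule frame_morphismI)
  interpret \<beta>\<alpha>: frame_morphism L N "cmp kalgfrm_sup L M N \<beta> \<alpha>"
    using L N category_cmp[OF order_category_category[OF order_category_kalgfrm_sup] L M N \<alpha> \<beta>]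
    by (intro frame_morphismI)
  note sp = \<beta>.M.gps_space_pp \<alpha>.M.gps_space_pp L.gps_space_pp
  note box = rel_box_cmp[OF sp \<beta>.functor_Y_hom \<alpha>.functor_Y_hom]
  have "on_hom functor_Y L N (cmp kalgfrm_sup L M N \<beta> \<alpha>)
      = cmp gps \<beta>.M.pp \<alpha>.M.pp L.pp (on_hom functor_Y L M \<alpha>) (on_hom functor_Y M N \<beta>)"
  proof (rule gps_hom_eqI[OF \<beta>\<alpha>.functor_Y_hom gps_cmp_hom[OF sp \<beta>.functor_Y_hom \<alpha>.functor_Y_hom]])
    fix U assume U: "U \<in> admissible L.pp"
    then obtain k where k: "k \<in> compact_elements L" "U = L.pp_hull k" by (auto simp: L.admissible_pp)
    have kL: "k \<in> carrier L" by (rule L.compact_carrier[OF k(1)])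
    have "rel_box \<beta>.M.pp (on_hom functor_Y L N (cmp kalgfrm_sup L M N \<beta> \<alpha>)) U = \<beta>.M.pp_hull (\<beta> (\<alpha> k))"
      unfolding k(2) \<beta>\<alpha>.rel_box_functor_Y[OF kL] using kL by (simp add: kalgfrm_sup_simps(4) compose_eq)
    then show "rel_box \<beta>.M.pp (on_hom functor_Y L N (cmp kalgfrm_sup L M N \<beta> \<alpha>)) U
        = rel_box \<beta>.M.pp (cmp gps \<beta>.M.pp \<alpha>.M.pp L.pp (on_hom functor_Y L M \<alpha>) (on_hom functor_Y M N \<beta>)) U"
      unfolding box[OF U] unfolding k(2) \<alpha>.rel_box_functor_Y[OF kL] \<beta>.rel_box_functor_Y[OF \<alpha>.closed[OF kL]] .
  qed
  then show "on_hom functor_Y L N (cmp kalgfrm_sup L M N \<beta> \<alpha>)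
      = cmp gps (on_ob functor_Y N) (on_ob functor_Y M) (on_ob functor_Y L)
          (on_hom functor_Y L M \<alpha>) (on_hom functor_Y M N \<beta>)"
    unfolding functor_Y_simps(1) .
qed


section \<open>From spaces to frames\<close>

lemma functor_V_simps [simp]:
  "carrier (on_ob functor_V X) = va_elements X" "eq (on_ob functor_V X) = (=)"
  "le (on_ob functor_V X) = (\<lambda>C D. D \<subseteq> C)"
  "on_hom functor_V X Y R = (\<lambda>C\<in>va_elements X. rel_box Y R C)"
  by (simp_all add: functor_V_def)

context gps_space
begin

text \<open>Directedness at a core point \<open>y\<close> outside \<open>C\<close> turns a finite cover of \<open>C\<close> by admissible sets that
  miss \<open>y\<close> into a single admissible set. So the elements of \<open>\<V>\<^sup>a(X)\<close> are the intersections of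
  admissible sets.\<close>

lemma va_separation:
  assumes C: "C \<in> va_elements X" and x: "x \<in> points X" "x \<notin> C"
  obtains W where "W \<in> admissible X" "C \<subseteq> W" "x \<notin> W"
proof -
  have clC: "closedin (gps_top X) C" and upC: "upset X C" using C by (auto simp: va_elements_def)
  have "x \<in> points X - C" using x by blast
  then obtain y where y: "y \<in> gps_core X" "y \<notin> C" "(x, y) \<in> gps_ord X"
    using C unfolding va_elements_def by blast
  have yp: "y \<in> points X" using y core_points by blast
  let ?U = "{U \<in> admissible X. y \<notin> U}"
  have "C \<subseteq> \<Union>?U"
  proof
    fix c assume c: "c \<in> C"
    then have "(c, y) \<notin> gps_ord X" using upC y unfolding upset_def by blast
    moreover have "c \<in> points X" using c upC by (auto simp: upset_def)
    ultimately show "c \<in> \<Union>?U" using ord_iff[of c y] yp by blast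
  qed
  then obtain \<V> where V: "finite \<V>" "\<V> \<subseteq> ?U" "C \<subseteq> \<Union>\<V>" using compact_cover[OF clC, of ?U] by blast
  then obtain W where W: "W \<in> admissible X" "y \<notin> W" "\<Union>\<V> \<subseteq> W"
    using core_upper_bound[OF y(1) V(1)] by blast
  have "x \<notin> W" using W y admissible_up by blast
  then show thesis using that W V by blast
qed

lemma Inter_admissible_va:
  assumes S: "\<S> \<subseteq> admissible X"
  shows "points X \<inter> \<Inter>\<S> \<in> va_elements X"
proof -
  have "closedin (gps_top X) (points X \<inter> \<Inter>\<S>)"
  proof (cases "\<S> = {}")
    case False
    then have "points X \<inter> \<Inter>\<S> = \<Inter>\<S>" using S admissible_points by blast
    then show ?thesis using False S admissible_closed by (auto intro!: closedin_Inter)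
  qed simp
  moreover have "upset X (points X \<inter> \<Inter>\<S>)"
    using S admissible_up ord_points unfolding upset_def by blast
  moreover have "points X - points X \<inter> \<Inter>\<S>
      = {x \<in> points X. \<exists>y\<in>gps_core X - points X \<inter> \<Inter>\<S>. (x, y) \<in> gps_ord X}"
  proof (intro subset_antisym subsetI)
    fix x assume "x \<in> points X - points X \<inter> \<Inter>\<S>"
    then obtain U where U: "U \<in> \<S>" "x \<notin> U" "x \<in> points X" by blast
    then have UA: "U \<in> admissible X" using S by blast
    have "closedin (gps_top X) (points X - U)" using admissible_open[OF UA] by (simp add: openin_closedin_eq)
    then obtain y where "y \<in> maximal_points X (points X - U)" "(x, y) \<in> gps_ord X"
      using exists_maximal_point[of "points X - U" x] U by blast
    then have "y \<in> gps_core X" "y \<notin> U" "(x, y) \<in> gps_ord X"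
      using UA by (auto simp: admissible_def maximal_points_def)
    then show "x \<in> {x \<in> points X. \<exists>y\<in>gps_core X - points X \<inter> \<Inter>\<S>. (x, y) \<in> gps_ord X}"
      using U by blast
  next
    fix x assume "x \<in> {x \<in> points X. \<exists>y\<in>gps_core X - points X \<inter> \<Inter>\<S>. (x, y) \<in> gps_ord X}"
    then obtain y where y: "x \<in> points X" "y \<in> gps_core X" "y \<notin> points X \<inter> \<Inter>\<S>" "(x, y) \<in> gps_ord X"
      by blast
    then obtain U where "U \<in> \<S>" "y \<notin> U" using core_points by blast
    then have "x \<notin> U" using S y admissible_up by blast
    then show "x \<in> points X - points X \<inter> \<Inter>\<S>" using y \<open>U \<in> \<S>\<close> by blast
  qed
  ultimately show ?thesis by (simp add: va_elements_def)
qed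

text \<open>Meets in \<open>\<V>\<^sup>a(X)\<close> are closures of unions in this sense; the union itself need not belong to
  \<open>\<V>\<^sup>a(X)\<close>.\<close>

definition "va_closure Z = points X \<inter> \<Inter>{W \<in> admissible X. Z \<subseteq> W}"

lemma va_closure_va: "va_closure Z \<in> va_elements X"
  unfolding va_closure_def by (rule Inter_admissible_va) blast

lemma va_closure_upper: "Z \<subseteq> points X \<Longrightarrow> Z \<subseteq> va_closure Z"
  by (auto simp: va_closure_def)

lemma va_points: "C \<in> va_elements X \<Longrightarrow> C \<subseteq> points X"
  by (auto simp: va_elements_def upset_def)

lemma va_up: "\<lbrakk>C \<in> va_elements X; x \<in> C; (x, y) \<in> gps_ord X\<rbrakk> \<Longrightarrow> y \<in> C"
  by (auto simp: va_elements_def upset_def)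

lemma va_closure_least:
  assumes C: "C \<in> va_elements X" and Z: "Z \<subseteq> C"
  shows "va_closure Z \<subseteq> C"
proof
  fix x assume x: "x \<in> va_closure Z"
  show "x \<in> C"
  proof (rule ccontr)
    assume "x \<notin> C"
    moreover have "x \<in> points X" using x by (simp add: va_closure_def)
    ultimately obtain W where "W \<in> admissible X" "C \<subseteq> W" "x \<notin> W" using va_separation[OF C] by metis
    then show False using x Z by (auto simp: va_closure_def)
  qed
qed

lemma va_closure_eq: "C \<in> va_elements X \<Longrightarrow> va_closure C = C"
  using va_closure_least[of C C] va_closure_upper[OF va_points] by blast

lemma va_cases:
  assumes "C \<in> va_elements X"
  obtains \<S> where "\<S> \<subseteq> admissible X" "C = points X \<inter> \<Inter>\<S>"
  using va_closure_eq[OF assms] that[of "{W \<in> admissible X. C \<subseteq> W}"] unfolding va_closure_def by blast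

lemma admissible_va: "U \<in> admissible X \<Longrightarrow> U \<in> va_elements X"
  using Inter_admissible_va[of "{U}"] admissible_points[of U] by (simp add: inf_absorb2)

lemma Inter_va:
  assumes S: "\<S> \<subseteq> va_elements X"
  shows "points X \<inter> \<Inter>\<S> \<in> va_elements X"
proof -
  have "va_closure (points X \<inter> \<Inter>\<S>) \<subseteq> points X \<inter> \<Inter>\<S>"
  proof (intro Int_greatest Inter_greatest)
    show "va_closure (points X \<inter> \<Inter>\<S>) \<subseteq> points X" by (auto simp: va_closure_def)
    show "va_closure (points X \<inter> \<Inter>\<S>) \<subseteq> C" if "C \<in> \<S>" for C
      using that S by (intro va_closure_least) auto
  qed
  then have "va_closure (points X \<inter> \<Inter>\<S>) = points X \<inter> \<Inter>\<S>" using va_closure_upper[of "points X \<inter> \<Inter>\<S>"] by blast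
  then show ?thesis using va_closure_va by metis
qed

abbreviation "va \<equiv> on_ob functor_V X"

lemma partial_order_va: "partial_order va"
  by (rule partial_orderI) auto

lemma complete_lattice_va: "complete_lattice va"
proof -
  interpret partial_order va by (rule partial_order_va)
  show ?thesis
  proof (rule complete_latticeI)
    fix S assume "S \<subseteq> carrier va"
    then have S: "S \<subseteq> va_elements X" by simp
    have "least va (points X \<inter> \<Inter>S) (Upper va S)"
      using Inter_va[OF S] S va_points by (auto simp: least_def Upper_def)
    then show "\<exists>s. least va s (Upper va S)" ..
    have U: "\<Union>S \<subseteq> points X" using S va_points by blast
    have "va_closure (\<Union>S) \<subseteq> D" if "D \<in> va_elements X" "\<And>C. C \<in> S \<Longrightarrow> C \<subseteq> D" for D
      using that by (intro va_closure_least) auto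
    then have "greatest va (va_closure (\<Union>S)) (Lower va S)"
      unfolding greatest_def Lower_def functor_V_simps using va_closure_va va_closure_upper[OF U] S by blast
    then show "\<exists>i. greatest va i (Lower va S)" ..
  qed
qed

sublocale va: complete_lattice va
  by (rule complete_lattice_va)

lemma va_Sup:
  assumes S: "S \<subseteq> va_elements X"
  shows "\<Squnion>\<^bsub>va\<^esub>S = points X \<inter> \<Inter>S"
  by (rule va.sup_eqI) (use Inter_va[OF S] S va_points in auto)

lemma va_meet:
  assumes C: "C \<in> va_elements X" and D: "D \<in> va_elements X"
  shows "C \<sqinter>\<^bsub>va\<^esub> D = va_closure (C \<union> D)"
proof (rule va.meet_eqI)
  have "C \<union> D \<subseteq> points X" using C D va_points by blast
  then show "va_closure (C \<union> D) \<sqsubseteq>\<^bsub>va\<^esub> C" "va_closure (C \<union> D) \<sqsubseteq>\<^bsub>va\<^esub> D"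
    using va_closure_upper[of "C \<union> D"] by auto
  show "E \<sqsubseteq>\<^bsub>va\<^esub> va_closure (C \<union> D)" if "E \<in> carrier va" "E \<sqsubseteq>\<^bsub>va\<^esub> C" "E \<sqsubseteq>\<^bsub>va\<^esub> D" for E
    using that va_closure_least[of E "C \<union> D"] by simp
qed (use va_closure_va C D in auto)

lemma va_top: "\<top>\<^bsub>va\<^esub> = {}"
  using admissible_va[OF empty_admissible] by (intro va.top_eqI) auto

text \<open>On core points meets are unions, and core points detect inclusion; so the frame law can be
  checked on the core.\<close>

lemma core_va_closure_Un:
  assumes C: "C \<in> va_elements X" and D: "D \<in> va_elements X" and y: "y \<in> gps_core X"
  shows "y \<in> va_closure (C \<union> D) \<longleftrightarrow> y \<in> C \<or> y \<in> D"
proof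
  assume cl: "y \<in> va_closure (C \<union> D)"
  have yp: "y \<in> points X" using y core_points by blast
  show "y \<in> C \<or> y \<in> D"
  proof (rule ccontr)
    assume n: "\<not> (y \<in> C \<or> y \<in> D)"
    obtain U where U: "U \<in> admissible X" "C \<subseteq> U" "y \<notin> U" using va_separation[OF C yp] n by blast
    obtain V where V: "V \<in> admissible X" "D \<subseteq> V" "y \<notin> V" using va_separation[OF D yp] n by blast
    obtain W where "W \<in> admissible X" "y \<notin> W" "\<Union>{U, V} \<subseteq> W"
      using core_upper_bound[OF y, of "{U, V}"] U V by auto
    moreover from this have "C \<union> D \<subseteq> W" using U V by blast
    ultimately show False using cl unfolding va_closure_def by blast
  qed
next
  assume "y \<in> C \<or> y \<in> D"
  then show "y \<in> va_closure (C \<union> D)" using va_closure_upper[of "C \<union> D"] va_points C D by blast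
qed

lemma va_eqI:
  assumes C: "C \<in> va_elements X" and D: "D \<in> va_elements X"
    and core: "\<And>y. y \<in> gps_core X \<Longrightarrow> y \<in> C \<longleftrightarrow> y \<in> D"
  shows "C = D"
proof -
  have *: "E \<subseteq> F" if E: "E \<in> va_elements X" and F: "F \<in> va_elements X"
    and EF: "\<And>y. y \<in> gps_core X \<Longrightarrow> y \<in> E \<Longrightarrow> y \<in> F" for E F
  proof
    fix x assume x: "x \<in> E"
    show "x \<in> F"
    proof (rule ccontr)
      assume "x \<notin> F"
      then have "x \<in> points X - F" using x va_points[OF E] by blast
      then obtain y where "y \<in> gps_core X" "y \<notin> F" "(x, y) \<in> gps_ord X"
        using F unfolding va_elements_def by blast
      then show False using EF va_up[OF E x] by blast
    qed
  qed
  show ?thesis using *[OF C D] *[OF D C] core by blast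
qed

lemma compact_va: "compact_elements va = admissible X"
proof (intro subset_antisym subsetI)
  fix C assume C: "C \<in> compact_elements va"
  then have CV: "C \<in> va_elements X" and w: "way_below va C C" by (auto simp: compact_elements_def)
  obtain \<S> where S: "\<S> \<subseteq> admissible X" "C = points X \<inter> \<Inter>\<S>" by (rule va_cases[OF CV])
  have SV: "\<S> \<subseteq> va_elements X" using S admissible_va by blast
  obtain \<T> where T: "finite \<T>" "\<T> \<subseteq> \<S>" "C \<sqsubseteq>\<^bsub>va\<^esub> \<Squnion>\<^bsub>va\<^esub>\<T>"
    by (rule way_belowE[OF w, of \<S>]) (use SV S va_Sup[OF SV] in auto)
  have "\<Squnion>\<^bsub>va\<^esub>\<T> = points X \<inter> \<Inter>\<T>" using T SV by (intro va_Sup) auto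
  then have "C = points X \<inter> \<Inter>\<T>" using T S by auto
  then show "C \<in> admissible X" using finite_Inter_admissible[OF T(1)] T S by auto
next
  fix U assume U: "U \<in> admissible X"
  have "\<exists>\<T>. finite \<T> \<and> \<T> \<subseteq> \<S> \<and> U \<sqsubseteq>\<^bsub>va\<^esub> \<Squnion>\<^bsub>va\<^esub>\<T>"
    if S: "\<S> \<subseteq> carrier va" "U \<sqsubseteq>\<^bsub>va\<^esub> \<Squnion>\<^bsub>va\<^esub>\<S>" for \<S>
  proof -
    have SV: "\<S> \<subseteq> va_elements X" using S by simp
    then have "(points X - U) \<inter> \<Inter>\<S> = {}" using S(2) va_Sup[OF SV] by auto
    moreover have "closedin (gps_top X) (points X - U)"
      using admissible_open[OF U] by (simp add: openin_closedin_eq)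
    moreover have "closedin (gps_top X) C" if "C \<in> \<S>" for C using that SV by (auto simp: va_elements_def)
    ultimately obtain \<T> where T: "finite \<T>" "\<T> \<subseteq> \<S>" "(points X - U) \<inter> \<Inter>\<T> = {}"
      using compact_closed_Inter[OF compact] by metis
    have "\<Squnion>\<^bsub>va\<^esub>\<T> = points X \<inter> \<Inter>\<T>" using T SV by (intro va_Sup) auto
    then show ?thesis using T by (intro exI[of _ \<T>]) auto
  qed
  then show "U \<in> compact_elements va"
    using admissible_va[OF U] by (auto simp: compact_elements_def way_below_def)
qed

lemma compact_algebraic_frame_va: "compact_algebraic_frame va"
  unfolding compact_algebraic_frame_def
proof (intro conjI ballI allI impI)
  show "complete_lattice va" by (rule complete_lattice_va)
  show "\<top>\<^bsub>va\<^esub> \<in> compact_elements va" using empty_admissible by (simp add: va_top compact_va)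
  fix C assume "C \<in> carrier va"
  then have C: "C \<in> va_elements X" by simp
  obtain \<S> where S: "\<S> \<subseteq> admissible X" "C = points X \<inter> \<Inter>\<S>" by (rule va_cases[OF C])
  then show "\<exists>S. S \<subseteq> compact_elements va \<and> C = \<Squnion>\<^bsub>va\<^esub>S"
    using va_Sup[of \<S>] admissible_va by (intro exI[of _ \<S>]) (auto simp: compact_va)
  fix T assume "T \<subseteq> carrier va"
  then have T: "T \<subseteq> va_elements X" by simp
  have CT: "(\<lambda>D. C \<sqinter>\<^bsub>va\<^esub> D) ` T \<subseteq> va_elements X"
    using va_meet[OF C] T va_closure_va by auto
  show "C \<sqinter>\<^bsub>va\<^esub> \<Squnion>\<^bsub>va\<^esub>T = \<Squnion>\<^bsub>va\<^esub>((\<lambda>D. C \<sqinter>\<^bsub>va\<^esub> D) ` T)"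
    unfolding va_Sup[OF T] va_Sup[OF CT] va_meet[OF C Inter_va[OF T]]
  proof (rule va_eqI[OF va_closure_va Inter_va[OF CT]])
    fix y assume y: "y \<in> gps_core X"
    then have yp: "y \<in> points X" using core_points by blast
    have "y \<in> C \<sqinter>\<^bsub>va\<^esub> D \<longleftrightarrow> y \<in> C \<or> y \<in> D" if "D \<in> T" for D
    proof -
      have "D \<in> va_elements X" using that T by blast
      then show ?thesis using core_va_closure_Un[OF C _ y] va_meet[OF C] by simp
    qed
    then show "y \<in> va_closure (C \<union> points X \<inter> \<Inter>T) \<longleftrightarrow> y \<in> points X \<inter> \<Inter>((\<lambda>D. C \<sqinter>\<^bsub>va\<^esub> D) ` T)"
      unfolding core_va_closure_Un[OF C Inter_va[OF T] y] using yp by auto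
  qed
qed

sublocale va_frame: compact_frame va
  by (rule compact_frame.intro[OF compact_algebraic_frame_va])

end

lemma rel_box_Inter:
  assumes "R \<subseteq> points Y \<times> points X"
  shows "rel_box Y R (points X \<inter> \<Inter>\<S>) = points Y \<inter> \<Inter>(rel_box Y R ` \<S>)"
  using assms by (auto simp: rel_box_def subset_iff)

locale gps_morphism = Y: gps_space Y + X: gps_space X
  for Y X :: "'a gps" and R :: "'a rel" +
  assumes hom: "R \<in> hom gps Y X"
begin

lemma rel_points: "R \<subseteq> points Y \<times> points X"
  using hom by (simp add: gps_simps)

lemma rel_box_va:
  assumes C: "C \<in> va_elements X"
  shows "rel_box Y R C \<in> va_elements Y"
proof -
  obtain \<S> where S: "\<S> \<subseteq> admissible X" "C = points X \<inter> \<Inter>\<S>" by (rule X.va_cases[OF C])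
  have "rel_box Y R ` \<S> \<subseteq> admissible Y" using S gps_hom_box[OF hom] by blast
  then show ?thesis unfolding S(2) rel_box_Inter[OF rel_points] by (rule Y.Inter_admissible_va)
qed

lemma functor_V_hom: "on_hom functor_V X Y R \<in> hom kalgfrm_sup X.va Y.va"
proof -
  have "on_hom functor_V X Y R (\<Squnion>\<^bsub>X.va\<^esub>S) = \<Squnion>\<^bsub>Y.va\<^esub>(on_hom functor_V X Y R ` S)"
    if S: "S \<subseteq> va_elements X" for S
  proof -
    have im: "on_hom functor_V X Y R ` S = rel_box Y R ` S" using S by (intro image_cong) auto
    have "rel_box Y R ` S \<subseteq> va_elements Y" using S rel_box_va by blast
    then show ?thesis
      unfolding im X.va_Sup[OF S] using X.Inter_va[OF S] by (simp add: Y.va_Sup rel_box_Inter[OF rel_points])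
  qed
  moreover have "on_hom functor_V X Y R ` compact_elements X.va \<subseteq> compact_elements Y.va"
    using gps_hom_box[OF hom] X.admissible_va by (auto simp: X.compact_va Y.compact_va)
  ultimately show ?thesis using rel_box_va by (simp add: kalgfrm_sup_simps)
qed

lemma functor_V_top_iff:
  "on_hom functor_V X Y R \<top>\<^bsub>X.va\<^esub> = \<top>\<^bsub>Y.va\<^esub> \<longleftrightarrow> (\<forall>y\<in>points Y. R `` {y} \<noteq> {})"
  using X.admissible_va[OF X.empty_admissible] by (auto simp: X.va_top Y.va_top rel_box_def)

end

lemma gps_morphismI:
  "\<lbrakk>Y \<in> obj gps; X \<in> obj gps; R \<in> hom gps Y X\<rbrakk> \<Longrightarrow> gps_morphism Y X R"
  by (simp add: gps_morphism_def gps_morphism_axioms_def gps_obj)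

lemma is_functor_V: "is_functor (op_cat gps) kalgfrm_sup functor_V"
  unfolding is_functor_def op_cat_simps
proof (intro conjI ballI)
  show "category kalgfrm_sup" "category (op_cat gps)"
    using order_category_category[OF order_category_kalgfrm_sup] category_op_cat[OF category_gps] by auto
  fix X :: "'a gps" assume X: "X \<in> obj gps"
  then interpret X: gps_space X by (simp add: gps_obj)
  show "on_ob functor_V X \<in> obj kalgfrm_sup"
    using X.compact_algebraic_frame_va by (simp add: kalgfrm_sup_simps)
  show "on_hom functor_V X X (ide gps X) = ide kalgfrm_sup (on_ob functor_V X)"
    unfolding functor_V_simps kalgfrm_sup_simps gps_simps
    by (rule restrict_ext) (auto simp: va_elements_def rel_box_ord[OF X.gps_space_axioms])
  fix Y R assume Y: "Y \<in> obj gps" and R: "R \<in> hom gps Y X"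
  interpret R: gps_morphism Y X R using Y X R by (rule gps_morphismI)
  show "on_hom functor_V X Y R \<in> hom kalgfrm_sup (on_ob functor_V X) (on_ob functor_V Y)"
    by (rule R.functor_V_hom)
  fix Z S assume Z: "Z \<in> obj gps" and S: "S \<in> hom gps Z Y"
  interpret S: gps_morphism Z Y S using Z Y S by (rule gps_morphismI)
  note sp = S.Y.gps_space_axioms R.Y.gps_space_axioms X.gps_space_axioms
  note RS = gps_cmp_hom[OF sp S R]
  interpret RS: gps_morphism Z X "cmp gps Z Y X R S" using Z X RS by (rule gps_morphismI)
  show "on_hom functor_V X Z (cmp gps Z Y X R S)
      = cmp kalgfrm_sup (on_ob functor_V X) (on_ob functor_V Y) (on_ob functor_V Z)
          (on_hom functor_V Y Z S) (on_hom functor_V X Y R)"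
    unfolding functor_V_simps kalgfrm_sup_simps compose_def
  proof (rule restrict_ext)
    fix C assume C: "C \<in> va_elements X"
    obtain \<S> where \<S>: "\<S> \<subseteq> admissible X" "C = points X \<inter> \<Inter>\<S>" by (rule X.va_cases[OF C])
    have "rel_box Z (cmp gps Z Y X R S) C = points Z \<inter> \<Inter>(rel_box Z (cmp gps Z Y X R S) ` \<S>)"
      unfolding \<S>(2) by (rule rel_box_Inter[OF RS.rel_points])
    also have "rel_box Z (cmp gps Z Y X R S) ` \<S> = rel_box Z S ` rel_box Y R ` \<S>"
      unfolding image_image using \<S>(1) by (intro image_cong refl rel_box_cmp[OF sp S R]) auto
    also have "points Z \<inter> \<Inter>(rel_box Z S ` rel_box Y R ` \<S>) = rel_box Z S (rel_box Y R C)"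
      unfolding \<S>(2) rel_box_Inter[OF R.rel_points] rel_box_Inter[OF S.rel_points] ..
    finally show "rel_box Z (cmp gps Z Y X R S) C
        = (\<lambda>C\<in>va_elements Y. rel_box Z S C) ((\<lambda>C\<in>va_elements X. rel_box Y R C) C)"
      using C R.rel_box_va[OF C] by simp
  qed
qed


section \<open>Frames and spaces are dual\<close>

lemma natural_order_iso_VY: "natural_order_iso kalgfrm_sup (functor_V \<circ>\<^sub>F functor_Y) compact_frame.pp_hull"
  unfolding natural_order_iso_def
proof (intro conjI ballI)
  fix L :: "'a gorder" assume L: "L \<in> obj kalgfrm_sup"
  then interpret L: compact_frame L by (simp add: kalgfrm_sup_obj)
  interpret pp: gps_space L.pp by (rule L.gps_space_pp)
  have "inj_on L.pp_hull (carrier L)"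
    using L.hull_subset_iff by (intro inj_onI) (metis L.le_antisym order_refl)
  moreover have "L.pp_hull ` carrier L = va_elements L.pp"
  proof (intro subset_antisym subsetI)
    fix C assume "C \<in> L.pp_hull ` carrier L"
    then obtain a where a: "a \<in> carrier L" "C = L.pp_hull a" by blast
    let ?K = "{k \<in> compact_elements L. k \<sqsubseteq>\<^bsub>L\<^esub> a}"
    have "C = points L.pp \<inter> \<Inter>(L.pp_hull ` ?K)"
      using L.hull_Sup[of ?K] L.compacts_below[OF a(1)] a L.compact_carrier by auto
    also have "\<dots> \<in> va_elements L.pp"
      by (rule pp.Inter_admissible_va) (auto simp: L.admissible_pp)
    finally show "C \<in> va_elements L.pp" .
  next
    fix C assume "C \<in> va_elements L.pp"
    then obtain \<S> where S: "\<S> \<subseteq> admissible L.pp" "C = points L.pp \<inter> \<Inter>\<S>" by (rule pp.va_cases)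
    then obtain B where B: "B \<subseteq> compact_elements L" "\<S> = L.pp_hull ` B"
      unfolding L.admissible_pp by (auto elim: subset_imageE)
    have "B \<subseteq> carrier L" using B L.compact_carrier by blast
    then show "C \<in> L.pp_hull ` carrier L" using S B L.hull_Sup[of B] by (auto intro!: image_eqI[of _ _ "\<Squnion>\<^bsub>L\<^esub>B"])
  qed
  ultimately show "order_iso L (on_ob (functor_V \<circ>\<^sub>F functor_Y) L) L.pp_hull"
    using L.hull_subset_iff by (simp add: order_iso_def bij_betw_def)
  fix M \<alpha> a assume M: "M \<in> obj kalgfrm_sup" "\<alpha> \<in> hom kalgfrm_sup L M" and a: "a \<in> carrier L"
  then interpret \<alpha>: frame_morphism L M \<alpha> using L by (intro frame_morphismI)
  have "L.pp_hull a \<in> va_elements L.pp" using \<open>L.pp_hull ` carrier L = va_elements L.pp\<close> a by blast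
  then show "on_hom (functor_V \<circ>\<^sub>F functor_Y) L M \<alpha> (L.pp_hull a) = \<alpha>.M.pp_hull (\<alpha> a)"
    using \<alpha>.rel_box_functor_Y[OF a] by (simp del: functor_Y_simps(2))
qed

definition principal_upset :: "'a gps \<Rightarrow> 'a \<Rightarrow> 'a set" where
  "principal_upset X x = gps_ord X `` {x}"

context gps_space
begin

lemma principal_upset_subset_iff:
  assumes "C \<in> va_elements X" "x \<in> points X"
  shows "principal_upset X x \<subseteq> C \<longleftrightarrow> x \<in> C"
  using va_up[OF assms(1)] ord_refl[OF assms(2)] by (auto simp: principal_upset_def)

lemma principal_upset_va:
  assumes x: "x \<in> points X"
  shows "principal_upset X x \<in> va_elements X"
proof -
  have "principal_upset X x = points X \<inter> \<Inter>{U \<in> admissible X. x \<in> U}"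
    using ord_iff[OF x] ord_points by (auto simp: principal_upset_def)
  then show ?thesis using Inter_admissible_va[of "{U \<in> admissible X. x \<in> U}"] by auto
qed

lemma core_prime:
  assumes y: "y \<in> gps_core X"
  shows "principal_upset X y \<in> prime_elements va"
proof -
  have yp: "y \<in> points X" using y core_points by blast
  have "principal_upset X y \<noteq> {}" using ord_refl[OF yp] by (auto simp: principal_upset_def)
  then show ?thesis
    using principal_upset_va[OF yp] core_va_closure_Un[OF _ _ y] principal_upset_subset_iff[OF _ yp] va_closure_va
    by (auto simp: prime_elements_def va_top va_meet)
qed

text \<open>If \<open>k \<le> \<up>x\<close> in the frame and \<open>k\<close> is above a finite meet, then \<open>k\<close> is an open neighbourhood of
  \<open>x\<close>; were no member of the meet below \<open>\<up>x\<close>, then the complements of the members would be further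
  open neighbourhoods, and a core point in the intersection would contradict primality there.\<close>

lemma principal_upset_pseudoprime:
  assumes x: "x \<in> points X"
  shows "principal_upset X x \<in> pseudoprime_elements va"
proof (rule va_frame.pseudoprimeI)
  show "principal_upset X x \<in> carrier va" using principal_upset_va[OF x] by simp
  show "\<not> \<top>\<^bsub>va\<^esub> \<sqsubseteq>\<^bsub>va\<^esub> principal_upset X x" using ord_refl[OF x] by (auto simp: va_top principal_upset_def)
  fix A k assume A: "finite A" "A \<subseteq> carrier va" and k: "k \<in> compact_elements va"
    "\<Sqinter>\<^bsub>va\<^esub>A \<sqsubseteq>\<^bsub>va\<^esub> k" "k \<sqsubseteq>\<^bsub>va\<^esub> principal_upset X x"
  have kA: "k \<in> admissible X" using k(1) by (simp add: compact_va)
  have xk: "x \<in> k" using k(3) principal_upset_subset_iff[OF admissible_va[OF kA] x] by simp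
  show "\<exists>C\<in>A. C \<sqsubseteq>\<^bsub>va\<^esub> principal_upset X x"
  proof (rule ccontr)
    assume "\<not> (\<exists>C\<in>A. C \<sqsubseteq>\<^bsub>va\<^esub> principal_upset X x)"
    then have n: "x \<notin> C" if "C \<in> A" for C
      using that A principal_upset_subset_iff[OF _ x] by auto
    have "openin (gps_top X) (points X - C)" if "C \<in> A" for C
      using that A by (auto simp: va_elements_def)
    then have "openin (gps_top X) (k \<inter> \<Inter>((\<lambda>C. points X - C) ` A))"
      using A(1) admissible_open[OF kA] by (intro openin_Int_Inter) auto
    moreover have "x \<in> k \<inter> \<Inter>((\<lambda>C. points X - C) ` A)" using xk x n by auto
    ultimately obtain y where "y \<in> gps_core X" "y \<in> k \<inter> \<Inter>((\<lambda>C. points X - C) ` A)"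
      by (rule core_meets_open)
    then have y: "y \<in> gps_core X" "y \<in> k" "\<And>C. C \<in> A \<Longrightarrow> y \<notin> C" by blast+
    have yp: "y \<in> points X" using y core_points by blast
    have "\<Sqinter>\<^bsub>va\<^esub>A \<in> va_elements X" using va.inf_closed[OF A(2)] by simp
    then have "\<Sqinter>\<^bsub>va\<^esub>A \<sqsubseteq>\<^bsub>va\<^esub> principal_upset X y"
      using k(2) y(2) principal_upset_subset_iff[OF _ yp] by auto
    then obtain C where "C \<in> A" "C \<sqsubseteq>\<^bsub>va\<^esub> principal_upset X y"
      using va_frame.prime_finite_meet[OF core_prime[OF y(1)] A] by blast
    then show False using y(3) A(2) principal_upset_subset_iff[OF _ yp] by auto
  qed
qed

text \<open>A pseudoprime \<open>C\<close> is \<open>\<up>x\<close> for any \<open>x\<close> in \<open>C\<close> that lies in no admissible set failing to contain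
  \<open>C\<close>. By compactness, if there were no such \<open>x\<close>, then an admissible set containing \<open>C\<close> would be covered
  by finitely many that do not, against pseudoprimeness.\<close>

lemma pseudoprime_principal_upset:
  assumes C: "C \<in> pseudoprime_elements va"
  shows "\<exists>x\<in>points X. C = principal_upset X x"
proof -
  have CV: "C \<in> va_elements X" using va_frame.pseudoprime_carrier[OF C] by simp
  have clC: "closedin (gps_top X) C" using CV by (simp add: va_elements_def)
  define \<U> where "\<U> = {U \<in> admissible X. \<not> C \<subseteq> U}"
  have "\<not> C \<subseteq> \<Union>\<U>"
  proof
    assume cover: "C \<subseteq> \<Union>\<U>"
    obtain \<V> where V: "finite \<V>" "\<V> \<subseteq> \<U>" "C \<subseteq> \<Union>\<V>"
      using compact_cover[OF clC _ cover] by (auto simp: \<U>_def)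
    have VA: "\<V> \<subseteq> admissible X" using V by (auto simp: \<U>_def)
    have "openin (gps_top X) (\<Union>\<V>)" using VA admissible_open by blast
    then have cl: "closedin (gps_top X) (points X - \<Union>\<V>)" by (simp add: openin_closedin_eq)
    have "(points X - \<Union>\<V>) \<inter> \<Inter>{W \<in> admissible X. C \<subseteq> W} = {}"
      using va_closure_eq[OF CV] V(3) unfolding va_closure_def by blast
    then obtain \<W> where W: "finite \<W>" "\<W> \<subseteq> {W \<in> admissible X. C \<subseteq> W}" "(points X - \<Union>\<V>) \<inter> \<Inter>\<W> = {}"
      using compact_Inter[OF cl, of "{W \<in> admissible X. C \<subseteq> W}"] by blast
    define k where "k = points X \<inter> \<Inter>\<W>"
    have k: "k \<in> admissible X" unfolding k_def using W by (intro finite_Inter_admissible) auto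
    have Ck: "C \<subseteq> k" using W va_points[OF CV] by (auto simp: k_def)
    have kV: "k \<subseteq> \<Union>\<V>" using W(3) by (auto simp: k_def)
    have Vva: "\<V> \<subseteq> carrier va" using VA admissible_va by auto
    have "U \<subseteq> \<Sqinter>\<^bsub>va\<^esub>\<V>" if "U \<in> \<V>" for U using va.inf_lower[OF Vva that] by simp
    then have "\<Sqinter>\<^bsub>va\<^esub>\<V> \<sqsubseteq>\<^bsub>va\<^esub> k" using kV by auto
    then obtain U where "U \<in> \<V>" "U \<sqsubseteq>\<^bsub>va\<^esub> C"
      using va_frame.pseudoprime_finite_meet[OF C V(1) Vva, of k] k Ck by (auto simp: compact_va)
    then show False using V by (auto simp: \<U>_def)
  qed
  then obtain x where x: "x \<in> C" "x \<notin> \<Union>\<U>" by blast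
  have xp: "x \<in> points X" using x va_points[OF CV] by blast
  have "C \<subseteq> principal_upset X x"
  proof
    fix y assume y: "y \<in> C"
    have "y \<in> U" if "U \<in> admissible X" "x \<in> U" for U
      using that x y by (auto simp: \<U>_def)
    then show "y \<in> principal_upset X x"
      using ord_iff[OF xp] y va_points[OF CV] by (auto simp: principal_upset_def)
  qed
  then have "C = principal_upset X x" using principal_upset_subset_iff[OF CV xp] x by blast
  then show ?thesis using xp by blast
qed

lemma principal_upset_image_hull:
  assumes U: "U \<in> admissible X"
  shows "principal_upset X ` U = va_frame.pp_hull U"
proof (intro subset_antisym subsetI)
  fix C assume "C \<in> principal_upset X ` U"
  then obtain x where x: "x \<in> U" "C = principal_upset X x" by blast
  then have xp: "x \<in> points X" using admissible_points[OF U] by blast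
  show "C \<in> va_frame.pp_hull U"
    using x principal_upset_pseudoprime[OF xp] principal_upset_subset_iff[OF admissible_va[OF U] xp]
    by (simp add: va_frame.mem_hull)
next
  fix C assume "C \<in> va_frame.pp_hull U"
  then have C: "C \<in> pseudoprime_elements va" "C \<subseteq> U" by (auto simp: va_frame.mem_hull)
  then obtain x where "x \<in> points X" "C = principal_upset X x" using pseudoprime_principal_upset by blast
  then show "C \<in> principal_upset X ` U"
    using C principal_upset_subset_iff[OF admissible_va[OF U]] by blast
qed

lemma gps_iso_principal_upset: "gps_iso X va_frame.pp (principal_upset X)"
proof -
  have inj: "inj_on (principal_upset X) (points X)"
  proof (rule inj_onI)
    fix x y assume xy: "x \<in> points X" "y \<in> points X" and eq: "principal_upset X x = principal_upset X y"
    then have "(x, y) \<in> gps_ord X" "(y, x) \<in> gps_ord X"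
      using ord_refl[OF xy(1)] ord_refl[OF xy(2)] by (auto simp: principal_upset_def)
    then show "x = y" by (rule ord_antisym)
  qed
  have im: "principal_upset X ` points X = pseudoprime_elements va"
    using principal_upset_pseudoprime pseudoprime_principal_upset by blast
  have "principal_upset X ` U \<in> admissible va_frame.pp \<longleftrightarrow> U \<in> admissible X" if Up: "U \<subseteq> points X" for U
  proof
    assume "U \<in> admissible X"
    then show "principal_upset X ` U \<in> admissible va_frame.pp"
      using principal_upset_image_hull by (simp add: va_frame.admissible_pp compact_va)
  next
    assume "principal_upset X ` U \<in> admissible va_frame.pp"
    then obtain V where V: "V \<in> admissible X" "principal_upset X ` U = va_frame.pp_hull V"
      by (auto simp: va_frame.admissible_pp compact_va)
    then have "principal_upset X ` U = principal_upset X ` V" using principal_upset_image_hull by simp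
    then have "U = V" using inj_on_image_eq_iff[OF inj Up admissible_points[OF V(1)]] by blast
    then show "U \<in> admissible X" using V by simp
  qed
  then show ?thesis using inj im by (simp add: gps_iso_def bij_betw_def)
qed

end

lemma natural_gps_iso_YV: "natural_gps_iso (functor_Y \<circ>\<^sub>F functor_V) principal_upset"
  unfolding natural_gps_iso_def
proof (intro conjI ballI)
  fix X :: "'a gps" assume X: "X \<in> obj gps"
  then interpret X: gps_space X by (simp add: gps_obj)
  show "gps_iso X (on_ob (functor_Y \<circ>\<^sub>F functor_V) X) (principal_upset X)"
    using X.gps_iso_principal_upset by simp
  fix Y R U assume Y: "Y \<in> obj gps" and R: "R \<in> hom gps X Y" and U: "U \<in> admissible Y"
  interpret R: gps_morphism X Y R using X Y R by (rule gps_morphismI)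
  interpret VR: frame_morphism R.X.va X.va "on_hom functor_V Y X R"
    using R.functor_V_hom functor_ob[OF is_functor_V, of X] functor_ob[OF is_functor_V, of Y] X Y
    by (intro frame_morphismI) auto
  have UV: "U \<in> va_elements Y" by (rule R.X.admissible_va[OF U])
  show "rel_box (on_ob (functor_Y \<circ>\<^sub>F functor_V) X) (on_hom (functor_Y \<circ>\<^sub>F functor_V) Y X R) (principal_upset Y ` U)
      = principal_upset X ` rel_box X R U"
    using VR.rel_box_functor_Y[of U] UV R.X.principal_upset_image_hull[OF U]
      X.principal_upset_image_hull[OF gps_hom_box[OF R U]]
    by (simp del: functor_Y_simps(2))
qed


section \<open>Semilattices and spaces are dual\<close>

lemma order_iso_compacts:
  assumes "compact_frame L" "compact_frame L'" and d: "order_iso L L' d"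
  shows "order_iso (on_ob functor_K L) (on_ob functor_K L') d"
    and "d ` compact_elements L = compact_elements L'"
proof -
  interpret L: compact_frame L by fact
  interpret L': compact_frame L' by fact
  interpret d: complete_order_isomorphism L L' d
    by unfold_locales (use d L'.eq_is_equal in auto)
  show im: "d ` compact_elements L = compact_elements L'" by (simp add: d.compact_elements_target)
  have "inj_on d (compact_elements L)"
    using order_iso_inj[OF d] compact_elements_carrier by (rule inj_on_subset)
  then show "order_iso (on_ob functor_K L) (on_ob functor_K L') d"
    using im d.le_iff L.compact_carrier by (simp add: order_iso_def bij_betw_def)
qed

lemma order_iso_pp_hull:
  assumes "compact_frame L" "compact_frame L'" and d: "order_iso L L' d" and a: "a \<in> carrier L"
  shows "d ` compact_frame.pp_hull L a = compact_frame.pp_hull L' (d a)"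
proof -
  interpret L: compact_frame L by fact
  interpret L': compact_frame L' by fact
  interpret d: complete_order_isomorphism L L' d
    by unfold_locales (use d L'.eq_is_equal in auto)
  show ?thesis
    using a d.le_iff[OF a L.pseudoprime_carrier]
    by (auto simp: L.mem_hull L'.mem_hull d.pseudoprime_elements_target)
qed

lemma order_iso_gps_iso:
  assumes L: "compact_frame L" and L': "compact_frame L'" and d: "order_iso L L' d"
  shows "gps_iso (pseudoprime_space L) (pseudoprime_space L') d"
proof -
  interpret L: compact_frame L by fact
  interpret L': compact_frame L' by fact
  interpret d: complete_order_isomorphism L L' d
    by unfold_locales (use d L'.eq_is_equal in auto)
  have inj: "inj_on d (pseudoprime_elements L)"
    using order_iso_inj[OF d] L.pseudoprime_carrier by (auto intro: inj_on_subset)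
  have adm: "admissible L'.pp = (`) d ` admissible L.pp"
    unfolding L.admissible_pp L'.admissible_pp d.compact_elements_target image_image
    using order_iso_pp_hull[OF L L' d] L.compact_carrier by (intro image_cong refl) auto
  have "d ` U \<in> admissible L'.pp \<longleftrightarrow> U \<in> admissible L.pp" if U: "U \<subseteq> points L.pp" for U
  proof
    assume "d ` U \<in> admissible L'.pp"
    then obtain V where V: "V \<in> admissible L.pp" "d ` U = d ` V" unfolding adm by blast
    have "V \<subseteq> pseudoprime_elements L" using V(1) L.hull_subset by (auto simp: L.admissible_pp)
    then have "U = V" using inj_on_image_eq_iff[OF inj, of U V] U V by simp
    then show "U \<in> admissible L.pp" using V by simp
  qed (simp add: adm)
  then show ?thesis using inj by (simp add: gps_iso_def bij_betw_def d.pseudoprime_elements_target)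
qed

lemma is_functor_X: "is_functor bdms (op_cat gps) functor_X"
  unfolding functor_X_def by (rule is_functor_comp[OF is_functor_F is_functor_Y])

lemma is_functor_A: "is_functor (op_cat gps) bdms functor_A"
  unfolding functor_A_def by (rule is_functor_comp[OF is_functor_V is_functor_K])

text \<open>The isomorphism from \<open>M\<close> to \<open>\<K>(\<F>(M))\<close>, followed by the isomorphism from \<open>L\<close> to
  \<open>\<V>\<^sup>a(\<Y>(L))\<close> for \<open>L = \<F>(M)\<close>, restricted to compact elements.\<close>

lemma natural_order_iso_AX:
  "natural_order_iso bdms (functor_A \<circ>\<^sub>F functor_X)
     (\<lambda>M. compact_frame.pp_hull (filter_frame M) \<circ> up_set M)"
  unfolding natural_order_iso_def
proof (intro conjI ballI)
  fix M :: "'a gorder" assume M: "M \<in> obj bdms"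
  let ?L = "filter_frame M"
  have L: "?L \<in> obj kalgfrm_sup" using functor_ob[OF is_functor_F M] by simp
  have L': "on_ob functor_V (on_ob functor_Y ?L) \<in> obj kalgfrm_sup"
    using functor_ob[OF is_functor_comp[OF is_functor_Y is_functor_V] L] by simp
  have e: "order_iso M (on_ob functor_K ?L) (up_set M)"
    using natural_order_iso_iso[OF natural_order_iso_KF M] by simp
  have d: "order_iso ?L (on_ob functor_V (on_ob functor_Y ?L)) (compact_frame.pp_hull ?L)"
    using natural_order_iso_iso[OF natural_order_iso_VY L] by simp
  have "order_iso (on_ob functor_K ?L) (on_ob functor_K (on_ob functor_V (on_ob functor_Y ?L))) (compact_frame.pp_hull ?L)"
    using order_iso_compacts(1)[OF _ _ d] L L' by (simp add: kalgfrm_sup_obj)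
  from order_iso_comp[OF e this]
  show "order_iso M (on_ob (functor_A \<circ>\<^sub>F functor_X) M) (compact_frame.pp_hull ?L \<circ> up_set M)"
    by (simp add: functor_A_def functor_X_def)
  fix N \<alpha> a assume N: "N \<in> obj bdms" and \<alpha>: "\<alpha> \<in> hom bdms M N" and a: "a \<in> carrier M"
  let ?F = "on_hom functor_F M N \<alpha>"
  let ?VY = "on_hom functor_V (on_ob functor_Y ?L) (on_ob functor_Y (filter_frame N))
      (on_hom functor_Y ?L (filter_frame N) ?F)"
  have F: "?F \<in> hom kalgfrm_sup ?L (filter_frame N)"
    using functor_hom[OF is_functor_F M N \<alpha>] by simp
  have LN: "filter_frame N \<in> obj kalgfrm_sup" using functor_ob[OF is_functor_F N] by simp
  have up: "up_set M a \<in> compact_elements ?L"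
    using order_iso_closed[OF e a] by simp
  then have upL: "up_set M a \<in> carrier ?L" by (rule subsetD[OF compact_elements_carrier])
  have "compact_frame.pp_hull ?L (up_set M a) \<in> compact_elements (on_ob functor_V (on_ob functor_Y ?L))"
    using imageI[OF up, of "compact_frame.pp_hull ?L"]
      order_iso_compacts(2)[OF L[unfolded kalgfrm_sup_obj] L'[unfolded kalgfrm_sup_obj] d] by simp
  then have "on_hom (functor_A \<circ>\<^sub>F functor_X) M N \<alpha> (compact_frame.pp_hull ?L (up_set M a))
      = ?VY (compact_frame.pp_hull ?L (up_set M a))"
    by (simp add: functor_A_def functor_X_def del: functor_V_simps(4) functor_Y_simps(2) functor_F_simps(2))
  also have "\<dots> = compact_frame.pp_hull (filter_frame N) (?F (up_set M a))"
    by (rule natural_order_iso_natural[OF natural_order_iso_VY L LN F upL, unfolded comp_functor_simps])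
  also have "?F (up_set M a) = up_set N (\<alpha> a)"
    using natural_order_iso_natural[OF natural_order_iso_KF M N \<alpha> a] up
    by (simp del: functor_F_simps(2))
  finally show "on_hom (functor_A \<circ>\<^sub>F functor_X) M N \<alpha> ((compact_frame.pp_hull ?L \<circ> up_set M) a)
      = (compact_frame.pp_hull (filter_frame N) \<circ> up_set N) (\<alpha> a)" by simp
qed

text \<open>The isomorphism from \<open>X\<close> to \<open>\<Y>(L)\<close> for \<open>L = \<V>\<^sup>a(X)\<close>, followed by the action of the isomorphism from \<open>L\<close>
  to \<open>\<F>(\<K>(L))\<close> on pseudoprimes.\<close>

lemma natural_gps_iso_XA:
  "natural_gps_iso (functor_X \<circ>\<^sub>F functor_A)
     (\<lambda>X. compacts_below_set (on_ob functor_V X) \<circ> principal_upset X)"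
  unfolding natural_gps_iso_def
proof (intro conjI ballI)
  let ?FK = "\<lambda>L. on_ob functor_F (on_ob functor_K L)"
  let ?d = compacts_below_set
  have fr: "compact_frame (on_ob functor_V X)" "compact_frame (?FK (on_ob functor_V X))" if "X \<in> obj gps" for X :: "'a gps"
    using functor_ob[OF is_functor_V, of X] that
      functor_ob[OF is_functor_comp[OF is_functor_K is_functor_F], of "on_ob functor_V X"]
    by (auto simp: kalgfrm_sup_obj)
  have d: "order_iso L (?FK L) (?d L)" if "compact_frame L" for L :: "'a set gorder"
    using natural_order_iso_iso[OF natural_order_iso_FK, of L] that by (simp add: kalgfrm_sup_obj)
  fix X :: "'a gps" assume X: "X \<in> obj gps"
  note frX = fr[OF X]
  let ?VX = "on_ob functor_V X"
  have "gps_iso (pseudoprime_space ?VX) (pseudoprime_space (?FK ?VX)) (?d ?VX)"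
    by (rule order_iso_gps_iso[OF frX d[OF frX(1)]])
  moreover have "gps_iso X (pseudoprime_space ?VX) (principal_upset X)"
    using natural_gps_iso_YV X by (auto simp: natural_gps_iso_def)
  ultimately show "gps_iso X (on_ob (functor_X \<circ>\<^sub>F functor_A) X) (?d ?VX \<circ> principal_upset X)"
    using gps_iso_comp by (auto simp: functor_A_def functor_X_def)
  fix Y R U assume Y: "Y \<in> obj gps" and R: "R \<in> hom gps X Y" and U: "U \<in> admissible Y"
  note frY = fr[OF Y]
  let ?VY = "on_ob functor_V Y"
  let ?VR = "on_hom functor_V Y X R"
  let ?FKR = "on_hom functor_F (on_ob functor_K ?VY) (on_ob functor_K ?VX) (on_hom functor_K ?VY ?VX ?VR)"
  have VR: "?VR \<in> hom kalgfrm_sup ?VY ?VX"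
    using functor_hom[OF is_functor_V, of Y X R] X Y R by simp
  have "?FKR \<in> hom kalgfrm_sup (?FK ?VY) (?FK ?VX)"
    using functor_hom[OF is_functor_comp[OF is_functor_K is_functor_F], of ?VY ?VX ?VR] frX frY VR
    by (simp add: kalgfrm_sup_obj del: functor_K_simps functor_V_simps functor_F_simps)
  then interpret FKR: frame_morphism "?FK ?VY" "?FK ?VX" ?FKR
    using frX frY by (intro frame_morphismI) (simp_all add: kalgfrm_sup_obj)
  interpret X: gps_space X using X by (simp add: gps_obj)
  interpret Y: gps_space Y using Y by (simp add: gps_obj)
  have UV: "U \<in> carrier ?VY" "?VR U \<in> carrier ?VX" "?VR U = rel_box X R U" "rel_box X R U \<in> admissible X"
    using Y.admissible_va[OF U] X.admissible_va gps_hom_box[OF R U] by auto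
  have "(?d ?VY \<circ> principal_upset Y) ` U = ?d ?VY ` compact_frame.pp_hull ?VY U"
    using Y.principal_upset_image_hull[OF U] by (simp only: image_comp[symmetric])
  also have "\<dots> = compact_frame.pp_hull (?FK ?VY) (?d ?VY U)"
    by (rule order_iso_pp_hull[OF frY d[OF frY(1)] UV(1)])
  finally have 1: "(?d ?VY \<circ> principal_upset Y) ` U = compact_frame.pp_hull (?FK ?VY) (?d ?VY U)" .
  have nat: "?FKR (?d ?VY U) = ?d ?VX (?VR U)"
    by (rule natural_order_iso_natural[OF natural_order_iso_FK _ _ VR UV(1), unfolded comp_functor_simps])
      (simp_all only: kalgfrm_sup_obj frX frY)
  have "rel_box (pseudoprime_space (?FK ?VX)) (on_hom functor_Y (?FK ?VY) (?FK ?VX) ?FKR)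
      (compact_frame.pp_hull (?FK ?VY) (?d ?VY U)) = compact_frame.pp_hull (?FK ?VX) (?FKR (?d ?VY U))"
    by (rule FKR.rel_box_functor_Y) (rule order_iso_closed[OF d[OF frY(1)] UV(1)])
  also have "\<dots> = ?d ?VX ` compact_frame.pp_hull ?VX (?VR U)"
    unfolding nat by (rule order_iso_pp_hull[OF frX d[OF frX(1)] UV(2), symmetric])
  also have "\<dots> = (?d ?VX \<circ> principal_upset X) ` rel_box X R U"
    unfolding UV(3) using X.principal_upset_image_hull[OF UV(4)] by (simp only: image_comp[symmetric])
  finally show "rel_box (on_ob (functor_X \<circ>\<^sub>F functor_A) X) (on_hom (functor_X \<circ>\<^sub>F functor_A) Y X R)
      ((?d ?VY \<circ> principal_upset Y) ` U) = (?d ?VX \<circ> principal_upset X) ` rel_box X R U"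
    unfolding 1 functor_A_def functor_X_def comp_functor_simps functor_Y_simps(1) .
qed


section \<open>The equivalences\<close>

lemma inj_singleton: "inj (\<lambda>x. {x})" and inj_singleton2: "inj (\<lambda>x. {{x}})"
  by (auto intro: injI)

lemma fully_faithful_lift_bdms: "inj j \<Longrightarrow> fully_faithful bdms bdms (order_lift j)"
  by (intro fully_faithful_order_lift order_category_bdms order_invariant_bdms)

lemma fully_faithful_lift_kalgfrm_sup: "inj j \<Longrightarrow> fully_faithful kalgfrm_sup kalgfrm_sup (order_lift j)"
  by (intro fully_faithful_order_lift order_category_kalgfrm_sup order_invariant_kalgfrm_sup)

lemma naturally_isomorphic_lift_bdms:
  assumes "inj j" "is_functor bdms bdms T" "natural_order_iso bdms T e"
  shows "naturally_isomorphic bdms bdms T (order_lift j)"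
  using fully_faithful_lift_bdms[OF assms(1)]
  by (intro naturally_isomorphic_order_lift[OF _ _ _ _ assms(2,1,3)])
    (auto simp: fully_faithful_def intro: order_category_bdms order_invariant_bdms)

lemma naturally_isomorphic_lift_kalgfrm_sup:
  assumes "inj j" "is_functor kalgfrm_sup kalgfrm_sup T" "natural_order_iso kalgfrm_sup T e"
  shows "naturally_isomorphic kalgfrm_sup kalgfrm_sup T (order_lift j)"
  using fully_faithful_lift_kalgfrm_sup[OF assms(1)]
  by (intro naturally_isomorphic_order_lift[OF _ _ _ _ assms(2,1,3)])
    (auto simp: fully_faithful_def intro: order_category_kalgfrm_sup order_invariant_kalgfrm_sup)

lemma naturally_isomorphic_KF: "naturally_isomorphic bdms bdms (functor_K \<circ>\<^sub>F functor_F) (order_lift (\<lambda>x. {x}))"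
  by (rule naturally_isomorphic_lift_bdms[OF inj_singleton
        is_functor_comp[OF is_functor_F is_functor_K] natural_order_iso_KF])

lemma naturally_isomorphic_FK: "naturally_isomorphic kalgfrm_sup kalgfrm_sup (functor_F \<circ>\<^sub>F functor_K) (order_lift (\<lambda>x. {x}))"
  by (rule naturally_isomorphic_lift_kalgfrm_sup[OF inj_singleton
        is_functor_comp[OF is_functor_K is_functor_F] natural_order_iso_FK])

lemma naturally_isomorphic_VY: "naturally_isomorphic kalgfrm_sup kalgfrm_sup (functor_V \<circ>\<^sub>F functor_Y) (order_lift (\<lambda>x. {x}))"
  by (rule naturally_isomorphic_lift_kalgfrm_sup[OF inj_singleton
        is_functor_comp[OF is_functor_Y is_functor_V] natural_order_iso_VY])

lemma naturally_isomorphic_YV: "naturally_isomorphic (op_cat gps) (op_cat gps) (functor_Y \<circ>\<^sub>F functor_V) (gps_lift (\<lambda>x. {x}))"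
  by (rule naturally_isomorphic_gps_lift[OF inj_singleton
        is_functor_comp[OF is_functor_V is_functor_Y] natural_gps_iso_YV])

lemma naturally_isomorphic_AX: "naturally_isomorphic bdms bdms (functor_A \<circ>\<^sub>F functor_X) (order_lift (\<lambda>x. {{x}}))"
  by (rule naturally_isomorphic_lift_bdms[OF inj_singleton2
        is_functor_comp[OF is_functor_X is_functor_A] natural_order_iso_AX])

lemma naturally_isomorphic_XA: "naturally_isomorphic (op_cat gps) (op_cat gps) (functor_X \<circ>\<^sub>F functor_A) (gps_lift (\<lambda>x. {{x}}))"
  by (rule naturally_isomorphic_gps_lift[OF inj_singleton2
        is_functor_comp[OF is_functor_A is_functor_X] natural_gps_iso_XA])

lemma bdms_kalgfrm_sup:
  "quasi_inverse_up_to_lift bdms kalgfrm_sup bdms (order_lift (\<lambda>x. {x})) functor_F functor_K"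
  by (rule quasi_inverse_up_to_lift_if_naturally_isomorphic[OF is_functor_F is_functor_K is_functor_F
        naturally_isomorphic_KF fully_faithful_lift_bdms[OF inj_singleton] naturally_isomorphic_FK fully_faithful_lift_kalgfrm_sup[OF inj_singleton]
        naturally_isomorphic_KF fully_faithful_lift_bdms[OF inj_singleton]])

lemma kalgfrm_sup_bdms:
  "quasi_inverse_up_to_lift kalgfrm_sup bdms kalgfrm_sup (order_lift (\<lambda>x. {x})) functor_K functor_F"
  by (rule quasi_inverse_up_to_lift_if_naturally_isomorphic[OF is_functor_K is_functor_F is_functor_K
        naturally_isomorphic_FK fully_faithful_lift_kalgfrm_sup[OF inj_singleton] naturally_isomorphic_KF fully_faithful_lift_bdms[OF inj_singleton]
        naturally_isomorphic_FK fully_faithful_lift_kalgfrm_sup[OF inj_singleton]])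

lemma kalgfrm_sup_gps:
  "quasi_inverse_up_to_lift kalgfrm_sup (op_cat gps) kalgfrm_sup (order_lift (\<lambda>x. {x})) functor_Y functor_V"
  by (rule quasi_inverse_up_to_lift_if_naturally_isomorphic[OF is_functor_Y is_functor_V is_functor_Y
        naturally_isomorphic_VY fully_faithful_lift_kalgfrm_sup[OF inj_singleton] naturally_isomorphic_YV fully_faithful_gps_lift[OF inj_singleton]
        naturally_isomorphic_VY fully_faithful_lift_kalgfrm_sup[OF inj_singleton]])

lemma gps_kalgfrm_sup:
  "quasi_inverse_up_to_lift (op_cat gps) kalgfrm_sup (op_cat gps) (gps_lift (\<lambda>x. {x})) functor_V functor_Y"
  by (rule quasi_inverse_up_to_lift_if_naturally_isomorphic[OF is_functor_V is_functor_Y is_functor_V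
        naturally_isomorphic_YV fully_faithful_gps_lift[OF inj_singleton] naturally_isomorphic_VY fully_faithful_lift_kalgfrm_sup[OF inj_singleton]
        naturally_isomorphic_YV fully_faithful_gps_lift[OF inj_singleton]])

lemma bdms_gps:
  "quasi_inverse_up_to_lift bdms (op_cat gps) bdms (order_lift (\<lambda>x. {{x}})) functor_X functor_A"
  by (rule quasi_inverse_up_to_lift_if_naturally_isomorphic[OF is_functor_X is_functor_A is_functor_X
        naturally_isomorphic_AX fully_faithful_lift_bdms[OF inj_singleton2] naturally_isomorphic_XA fully_faithful_gps_lift[OF inj_singleton2]
        naturally_isomorphic_AX fully_faithful_lift_bdms[OF inj_singleton2]])

lemma gps_bdms:
  "quasi_inverse_up_to_lift (op_cat gps) bdms (op_cat gps) (gps_lift (\<lambda>x. {{x}})) functor_A functor_X"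
  by (rule quasi_inverse_up_to_lift_if_naturally_isomorphic[OF is_functor_A is_functor_X is_functor_A
        naturally_isomorphic_XA fully_faithful_gps_lift[OF inj_singleton2] naturally_isomorphic_AX fully_faithful_lift_bdms[OF inj_singleton2]
        naturally_isomorphic_XA fully_faithful_gps_lift[OF inj_singleton2]])


section \<open>Restriction to bottom-preserving, top-preserving and total morphisms\<close>

definition preserves_bottom :: "'a gorder \<Rightarrow> 'a gorder \<Rightarrow> ('a \<Rightarrow> 'a) \<Rightarrow> bool" where
  "preserves_bottom M N \<alpha> \<longleftrightarrow> \<alpha> \<bottom>\<^bsub>M\<^esub> = \<bottom>\<^bsub>N\<^esub>"

definition preserves_top :: "'a gorder \<Rightarrow> 'a gorder \<Rightarrow> ('a \<Rightarrow> 'a) \<Rightarrow> bool" where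
  "preserves_top L M \<alpha> \<longleftrightarrow> \<alpha> \<top>\<^bsub>L\<^esub> = \<top>\<^bsub>M\<^esub>"

text \<open>The arguments are those of a morphism of \<open>op_cat gps\<close>: the relation goes from \<open>Y\<close> to \<open>X\<close>.\<close>

definition total_rel :: "'a gps \<Rightarrow> 'a gps \<Rightarrow> 'a rel \<Rightarrow> bool" where
  "total_rel X Y R \<longleftrightarrow> (\<forall>y\<in>points Y. R `` {y} \<noteq> {})"

lemma wide_subcategories:
  "bdms_B = wide_subcategory bdms preserves_bottom"
  "kalgfrm_supB = wide_subcategory kalgfrm_sup preserves_top"
  "op_cat gps_T = wide_subcategory (op_cat gps) total_rel"
  by (simp_all add: bdms_B_def kalgfrm_supB_def gps_T_def wide_subcategory_def preserves_bottom_def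
      preserves_top_def total_rel_def op_cat_def)

lemma category_preserves_bottom: "category (wide_subcategory bdms preserves_bottom)"
proof (rule category_wide_subcategory)
  show "category bdms" by (rule order_category_category[OF order_category_bdms])
  fix M :: "'a gorder" assume "M \<in> obj bdms"
  then interpret M: bounded_distributive_semilattice M by (simp add: bdms_obj)
  show "preserves_bottom M M (ide bdms M)" by (simp add: preserves_bottom_def bdms_simps)
  show "preserves_bottom M P (cmp bdms M N P \<beta> \<alpha>)" if "preserves_bottom M N \<alpha>" "preserves_bottom N P \<beta>" for N P \<alpha> \<beta>
    using that by (simp add: preserves_bottom_def bdms_simps compose_def)
qed

lemma category_preserves_top: "category (wide_subcategory kalgfrm_sup preserves_top)"
proof (rule category_wide_subcategory)
  show "category kalgfrm_sup" by (rule order_category_category[OF order_category_kalgfrm_sup])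
  fix L :: "'a gorder" assume "L \<in> obj kalgfrm_sup"
  then interpret L: compact_frame L by (simp add: kalgfrm_sup_obj)
  show "preserves_top L L (ide kalgfrm_sup L)" by (simp add: preserves_top_def kalgfrm_sup_simps)
  show "preserves_top L N (cmp kalgfrm_sup L M N \<beta> \<alpha>)" if "preserves_top L M \<alpha>" "preserves_top M N \<beta>" for M N \<alpha> \<beta>
    using that by (simp add: preserves_top_def kalgfrm_sup_simps compose_def)
qed

text \<open>Since the empty set is admissible, totality is thus visible in the box operator on admissible
  sets, where relations compose as functions.\<close>

lemma total_rel_iff: "total_rel X Y R \<longleftrightarrow> rel_box Y R {} = {}"
  by (auto simp: total_rel_def rel_box_def)

lemma category_total_rel: "category (wide_subcategory (op_cat gps) total_rel)"
proof (rule category_wide_subcategory)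
  show "category (op_cat gps)" by (intro category_op_cat category_gps)
  fix Z :: "'a gps" assume Z: "Z \<in> obj (op_cat gps)"
  then interpret Z: gps_space Z by (simp add: gps_obj)
  show "total_rel Z Z (ide (op_cat gps) Z)"
    using Z.ord_refl by (auto simp: total_rel_def gps_simps)
  fix Y X S R assume *: "Y \<in> obj (op_cat gps)" "X \<in> obj (op_cat gps)"
    "S \<in> hom (op_cat gps) Z Y" "R \<in> hom (op_cat gps) Y X" "total_rel Z Y S" "total_rel Y X R"
  have "rel_box X (cmp gps X Y Z S R) {} = rel_box X R (rel_box Y S {})"
    using * Z by (intro rel_box_cmp Z.empty_admissible) (auto simp: gps_obj)
  then show "total_rel Z X (cmp (op_cat gps) Z Y X R S)"
    using * by (simp add: total_rel_iff)
qed

text \<open>An isomorphism is monotone and takes some element to the bottom.\<close>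

lemma iso_preserves_bottom:
  assumes M: "M \<in> obj bdms" and N: "N \<in> obj bdms" and iso: "iso_in bdms M N \<alpha>"
  shows "preserves_bottom M N \<alpha>"
proof -
  obtain \<beta> where \<alpha>: "\<alpha> \<in> hom bdms M N" and \<beta>: "\<beta> \<in> hom bdms N M"
    and inv: "cmp bdms N M N \<alpha> \<beta> = ide bdms N" using iso by (auto simp: iso_in_def)
  interpret \<alpha>: bdms_morphism M N \<alpha> using M N \<alpha> by (rule bdms_morphismI)
  interpret \<beta>: bdms_morphism N M \<beta> using N M \<beta> by (rule bdms_morphismI)
  have "\<alpha> (\<beta> \<bottom>\<^bsub>N\<^esub>) = \<bottom>\<^bsub>N\<^esub>"
    using fun_cong[OF inv, of "\<bottom>\<^bsub>N\<^esub>"] by (simp add: bdms_simps compose_def)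
  moreover have "\<alpha> \<bottom>\<^bsub>M\<^esub> \<sqsubseteq>\<^bsub>N\<^esub> \<alpha> (\<beta> \<bottom>\<^bsub>N\<^esub>)"
    by (rule \<alpha>.mono) (auto simp: \<beta>.closed)
  ultimately show ?thesis
    unfolding preserves_bottom_def using \<alpha>.closed by (auto intro: \<alpha>.N.le_antisym)
qed

lemma iso_preserves_top:
  assumes L: "L \<in> obj kalgfrm_sup" and M: "M \<in> obj kalgfrm_sup" and iso: "iso_in kalgfrm_sup L M \<alpha>"
  shows "preserves_top L M \<alpha>"
proof -
  obtain \<beta> where \<alpha>: "\<alpha> \<in> hom kalgfrm_sup L M" and \<beta>: "\<beta> \<in> hom kalgfrm_sup M L"
    and inv: "cmp kalgfrm_sup M L M \<alpha> \<beta> = ide kalgfrm_sup M" using iso by (auto simp: iso_in_def)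
  interpret \<alpha>: frame_morphism L M \<alpha> using L M \<alpha> by (rule frame_morphismI)
  interpret \<beta>: frame_morphism M L \<beta> using M L \<beta> by (rule frame_morphismI)
  have "\<alpha> (\<beta> \<top>\<^bsub>M\<^esub>) = \<top>\<^bsub>M\<^esub>"
    using fun_cong[OF inv, of "\<top>\<^bsub>M\<^esub>"] by (simp add: kalgfrm_sup_simps compose_def)
  moreover have "\<alpha> (\<beta> \<top>\<^bsub>M\<^esub>) \<sqsubseteq>\<^bsub>M\<^esub> \<alpha> \<top>\<^bsub>L\<^esub>"
    by (rule \<alpha>.mono) (auto simp: \<beta>.closed)
  ultimately show ?thesis
    unfolding preserves_top_def using \<alpha>.closed by (auto intro: \<alpha>.M.le_antisym)
qed

lemma iso_total_rel:
  assumes X: "X \<in> obj (op_cat gps)" and Y: "Y \<in> obj (op_cat gps)" and iso: "iso_in (op_cat gps) X Y R"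
  shows "total_rel X Y R"
proof -
  obtain S where R: "R \<in> hom gps Y X" and S: "S \<in> hom gps X Y"
    and inv: "cmp gps Y X Y S R = gps_ord Y" using iso by (auto simp: iso_in_def gps_simps)
  interpret X: gps_space X using X by (simp add: gps_obj)
  interpret Y: gps_space Y using Y by (simp add: gps_obj)
  have "rel_box Y R (rel_box X S {}) = rel_box Y (gps_ord Y) {}"
    unfolding inv[symmetric] using X.gps_space_axioms Y.gps_space_axioms
    by (intro rel_box_cmp[symmetric] R S Y.empty_admissible)
  also have "\<dots> = {}" by (intro rel_box_ord Y.gps_space_axioms Y.admissible_upset Y.empty_admissible)
  finally have "rel_box Y R (rel_box X S {}) = {}" .
  moreover have "rel_box Y R {} \<subseteq> rel_box Y R (rel_box X S {})" by (rule rel_box_mono) blast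
  ultimately show ?thesis unfolding total_rel_iff by blast
qed

lemma functor_F_preserves_iff:
  "\<lbrakk>M \<in> obj bdms; N \<in> obj bdms; \<alpha> \<in> hom bdms M N\<rbrakk> \<Longrightarrow>
     preserves_top (on_ob functor_F M) (on_ob functor_F N) (on_hom functor_F M N \<alpha>) \<longleftrightarrow> preserves_bottom M N \<alpha>"
  using bdms_morphism.functor_F_top_iff[OF bdms_morphismI]
  by (simp add: preserves_top_def preserves_bottom_def del: functor_F_simps(2))

lemma functor_K_preserves_iff:
  "\<lbrakk>L \<in> obj kalgfrm_sup; M \<in> obj kalgfrm_sup; \<alpha> \<in> hom kalgfrm_sup L M\<rbrakk> \<Longrightarrow>
     preserves_bottom (on_ob functor_K L) (on_ob functor_K M) (on_hom functor_K L M \<alpha>) \<longleftrightarrow> preserves_top L M \<alpha>"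
  using frame_morphism.functor_K_bottom_iff[OF frame_morphismI]
  by (simp add: preserves_top_def preserves_bottom_def del: functor_K_simps(4))

lemma functor_Y_preserves_iff:
  "\<lbrakk>L \<in> obj kalgfrm_sup; M \<in> obj kalgfrm_sup; \<alpha> \<in> hom kalgfrm_sup L M\<rbrakk> \<Longrightarrow>
     total_rel (on_ob functor_Y L) (on_ob functor_Y M) (on_hom functor_Y L M \<alpha>) \<longleftrightarrow> preserves_top L M \<alpha>"
  using frame_morphism.functor_Y_total_iff[OF frame_morphismI]
  by (simp add: preserves_top_def total_rel_def del: functor_Y_simps(2))

lemma functor_V_preserves_iff:
  "\<lbrakk>X \<in> obj (op_cat gps); Y \<in> obj (op_cat gps); R \<in> hom (op_cat gps) X Y\<rbrakk> \<Longrightarrow>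
     preserves_top (on_ob functor_V X) (on_ob functor_V Y) (on_hom functor_V X Y R) \<longleftrightarrow> total_rel X Y R"
  using gps_morphism.functor_V_top_iff[OF gps_morphismI, of Y X R]
  by (simp add: preserves_top_def total_rel_def del: functor_V_simps)

lemma functor_X_preserves_iff:
  "\<lbrakk>M \<in> obj bdms; N \<in> obj bdms; \<alpha> \<in> hom bdms M N\<rbrakk> \<Longrightarrow>
     total_rel (on_ob functor_X M) (on_ob functor_X N) (on_hom functor_X M N \<alpha>) \<longleftrightarrow> preserves_bottom M N \<alpha>"
  unfolding functor_X_def comp_functor_simps
  by (simp only: functor_Y_preserves_iff functor_F_preserves_iff functor_ob[OF is_functor_F]
      functor_hom[OF is_functor_F])

lemma functor_A_preserves_iff:
  "\<lbrakk>X \<in> obj (op_cat gps); Y \<in> obj (op_cat gps); R \<in> hom (op_cat gps) X Y\<rbrakk> \<Longrightarrow>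
     preserves_bottom (on_ob functor_A X) (on_ob functor_A Y) (on_hom functor_A X Y R) \<longleftrightarrow> total_rel X Y R"
  unfolding functor_A_def comp_functor_simps
  by (simp only: functor_K_preserves_iff functor_V_preserves_iff functor_ob[OF is_functor_V]
      functor_hom[OF is_functor_V])

lemma restricted_equivalences:
  shows "quasi_inverse_up_to_lift (wide_subcategory bdms preserves_bottom)
      (wide_subcategory kalgfrm_sup preserves_top)
      (wide_subcategory bdms preserves_bottom) (order_lift (\<lambda>x. {x})) functor_F functor_K"
    and "quasi_inverse_up_to_lift (wide_subcategory kalgfrm_sup preserves_top)
      (wide_subcategory bdms preserves_bottom)
      (wide_subcategory kalgfrm_sup preserves_top) (order_lift (\<lambda>x. {x})) functor_K functor_F"
    and "quasi_inverse_up_to_lift (wide_subcategory kalgfrm_sup preserves_top)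
      (wide_subcategory (op_cat gps) total_rel)
      (wide_subcategory kalgfrm_sup preserves_top) (order_lift (\<lambda>x. {x})) functor_Y functor_V"
    and "quasi_inverse_up_to_lift (wide_subcategory (op_cat gps) total_rel)
      (wide_subcategory kalgfrm_sup preserves_top)
      (wide_subcategory (op_cat gps) total_rel) (gps_lift (\<lambda>x. {x})) functor_V functor_Y"
    and "quasi_inverse_up_to_lift (wide_subcategory bdms preserves_bottom)
      (wide_subcategory (op_cat gps) total_rel)
      (wide_subcategory bdms preserves_bottom) (order_lift (\<lambda>x. {{x}})) functor_X functor_A"
    and "quasi_inverse_up_to_lift (wide_subcategory (op_cat gps) total_rel)
      (wide_subcategory bdms preserves_bottom)
      (wide_subcategory (op_cat gps) total_rel) (gps_lift (\<lambda>x. {{x}})) functor_A functor_X"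
  subgoal
    by (rule quasi_inverse_up_to_lift_wide_subcategory[OF bdms_kalgfrm_sup
          category_preserves_bottom category_preserves_top category_preserves_bottom];
        erule (2) functor_F_preserves_iff functor_K_preserves_iff iso_preserves_bottom)
  subgoal
    by (rule quasi_inverse_up_to_lift_wide_subcategory[OF kalgfrm_sup_bdms
          category_preserves_top category_preserves_bottom category_preserves_top];
        erule (2) functor_K_preserves_iff functor_F_preserves_iff iso_preserves_top)
  subgoal
    by (rule quasi_inverse_up_to_lift_wide_subcategory[OF kalgfrm_sup_gps
          category_preserves_top category_total_rel category_preserves_top];
        erule (2) functor_Y_preserves_iff functor_V_preserves_iff iso_preserves_top)
  subgoal
    by (rule quasi_inverse_up_to_lift_wide_subcategory[OF gps_kalgfrm_sup
          category_total_rel category_preserves_top category_total_rel];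
        erule (2) functor_V_preserves_iff functor_Y_preserves_iff iso_total_rel)
  subgoal
    by (rule quasi_inverse_up_to_lift_wide_subcategory[OF bdms_gps
          category_preserves_bottom category_total_rel category_preserves_bottom];
        erule (2) functor_X_preserves_iff functor_A_preserves_iff iso_preserves_bottom)
  subgoal
    by (rule quasi_inverse_up_to_lift_wide_subcategory[OF gps_bdms
          category_total_rel category_preserves_bottom category_total_rel];
        erule (2) functor_A_preserves_iff functor_X_preserves_iff iso_total_rel)
  done

theorem corollary4p31:
  shows "
   \<comment> \<open>(1)\<close>
   (quasi_inverse_up_to_lift
        (bdms :: ('u gorder, _) cat) (kalgfrm_sup :: ('u set gorder, _) cat) (bdms :: ('u set gorder, _) cat)
        (order_lift (\<lambda>x. {x})) functor_F functor_K) \<and>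
   (quasi_inverse_up_to_lift
        (kalgfrm_sup :: ('u gorder, _) cat) (bdms :: ('u gorder, _) cat) (kalgfrm_sup :: ('u set gorder, _) cat)
        (order_lift (\<lambda>x. {x})) functor_K functor_F) \<and>
   (quasi_inverse_up_to_lift
        (kalgfrm_sup :: ('u gorder, _) cat) (op_cat gps :: ('u gps, _) cat) (kalgfrm_sup :: ('u set gorder, _) cat)
        (order_lift (\<lambda>x. {x})) functor_Y functor_V) \<and>
   (quasi_inverse_up_to_lift
        (op_cat gps :: ('u gps, _) cat) (kalgfrm_sup :: ('u set gorder, _) cat) (op_cat gps :: ('u set gps, _) cat)
        (gps_lift (\<lambda>x. {x})) functor_V functor_Y) \<and>
   (quasi_inverse_up_to_lift
        (bdms :: ('u gorder, _) cat) (op_cat gps :: ('u set gps, _) cat) (bdms :: ('u set set gorder, _) cat)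
        (order_lift (\<lambda>x. {{x}})) functor_X functor_A) \<and>
   (quasi_inverse_up_to_lift
        (op_cat gps :: ('u gps, _) cat) (bdms :: ('u set gorder, _) cat) (op_cat gps :: ('u set set gps, _) cat)
        (gps_lift (\<lambda>x. {{x}})) functor_A functor_X) \<and>
   \<comment> \<open>(2)\<close>
   (quasi_inverse_up_to_lift
        (bdms_B :: ('u gorder, _) cat) (kalgfrm_supB :: ('u set gorder, _) cat) (bdms_B :: ('u set gorder, _) cat)
        (order_lift (\<lambda>x. {x})) functor_F functor_K) \<and>
   (quasi_inverse_up_to_lift
        (kalgfrm_supB :: ('u gorder, _) cat) (bdms_B :: ('u gorder, _) cat) (kalgfrm_supB :: ('u set gorder, _) cat)
        (order_lift (\<lambda>x. {x})) functor_K functor_F) \<and>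
   (quasi_inverse_up_to_lift
        (kalgfrm_supB :: ('u gorder, _) cat) (op_cat gps_T :: ('u gps, _) cat) (kalgfrm_supB :: ('u set gorder, _) cat)
        (order_lift (\<lambda>x. {x})) functor_Y functor_V) \<and>
   (quasi_inverse_up_to_lift
        (op_cat gps_T :: ('u gps, _) cat) (kalgfrm_supB :: ('u set gorder, _) cat) (op_cat gps_T :: ('u set gps, _) cat)
        (gps_lift (\<lambda>x. {x})) functor_V functor_Y) \<and>
   (quasi_inverse_up_to_lift
        (bdms_B :: ('u gorder, _) cat) (op_cat gps_T :: ('u set gps, _) cat) (bdms_B :: ('u set set gorder, _) cat)
        (order_lift (\<lambda>x. {{x}})) functor_X functor_A) \<and>
   (quasi_inverse_up_to_lift
        (op_cat gps_T :: ('u gps, _) cat) (bdms_B :: ('u set gorder, _) cat) (op_cat gps_T :: ('u set set gps, _) cat)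
        (gps_lift (\<lambda>x. {{x}})) functor_A functor_X)"
  unfolding wide_subcategories
  by (intro conjI bdms_kalgfrm_sup kalgfrm_sup_bdms kalgfrm_sup_gps gps_kalgfrm_sup bdms_gps gps_bdms
      restricted_equivalences)

end
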